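(* Let $G\subset GL(p,\mathbb{R})$ be a connected linear Lie group with Lie algebra $\mathfrak{g}\subset M_p(\mathbb{R})$. Suppose that one of the following (equivalent) conditions holds: (a) $\mathfrak{g}\cong\theta[G]_0(p)$ as $\mathbb{R}$-vector spaces; (b) for any $\eta=\sum_{i=1}^p\eta_i(y)\frac{\partial}{\partial y_i}\in\theta[G]_0(p)$, the functions $\eta_i(y)$ $(i=1,\dots,p)$ are linear; (c) $\mathrm{Diff}_0[G](p)=G$. Then: (1) $T\mathcal{A}[G](f)=T(\mathcal{R}\times G)(f)$ for any map germ $f:(\mathbb{R}^n,0)\to(\mathbb{R}^p,0)$; (2) map germs $f,g:(\mathbb{R}^n,0)\to(\mathbb{R}^p,0)$ are $\mathcal{A}_0[G]$-equivalent if and only if they are $G$-congruent.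
   Context: All maps and germs are of class $C^\infty$. $\mathfrak{g}=T_IG\subset M_p(\mathbb{R})$ is the Lie algebra of $G$. $\theta[G]_0(p)$ is the real vector space of germs at $0\in\mathbb{R}^p$ of smooth vector fields $\eta=\sum_{i=1}^p\eta_i(y)\frac{\partial}{\partial y_i}$ such that $\left(\frac{\partial\eta_i}{\partial y_j}(y)\right)\in\mathfrak{g}$ for all $y$ near $0$, and $\eta_i(0)=0$ for all $i$. $\mathrm{Diff}[G](p)$ is the group of germs of diffeomorphisms $\psi:(\mathbb{R}^p,0)\to(\mathbb{R}^p,0)$ whose Jacobi matrix satisfies $J_\psi(y)\in G$ for all $y$ near $0$. An element $\psi\in\mathrm{Diff}[G](p)$ is isotopic to the identity if there is a smooth family $\Psi:(\mathbb{R}^p\times\mathbb{R},0\times[0,1])\to(\mathbb{R}^p,0)$ such that, with $\psi_t(y)=\Psi(y,t)$, $\psi_t\in\mathrm{Diff}[G](p)$ for all $t$, $\psi_0=1_{\mathbb{R}^p}$ and $\psi_1=\psi$. $\mathrm{Diff}_0[G](p)$ is the set of such $\psi$. $A\in G$ is identified with the germ of the linear isomorphism $\psi_A(y)=Ay$, so that $G\subset\mathrm{Diff}[G](p)$. Map germs $f,g:(\mathbb{R}^n,0)\to(\mathbb{R}^p,0)$ are $\mathcal{A}_0[G]$-equivalent if there exist a diffeomorphism germ $\phi:(\mathbb{R}^n,0)\to(\mathbb{R}^n,0)$ and $\psi\in\mathrm{Diff}_0[G](p)$ with $f\circ\phi=\psi\circ g$. They are $G$-congruent (equivalently, $\mathcal{R}\times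 G$-equivalent) if there exist a diffeomorphism germ $\phi:(\mathbb{R}^n,0)\to(\mathbb{R}^n,0)$ and $A\in G$ with $f\circ\phi=\psi_A\circ g$. Let $\mathcal{E}_n$ be the ring of smooth function germs at $0\in\mathbb{R}^n$ with maximal ideal $\mathfrak{M}_n$, $\theta(n)$ the $\mathcal{E}_n$-module of vector field germs on $(\mathbb{R}^n,0)$, and $\theta(f)\cong\mathcal{E}_n^p$ the $\mathcal{E}_n$-module of germs of vector fields along $f$. Put $tf:\theta(n)\to\theta(f)$, $tf(\zeta)=df\circ\zeta$, and $\omega f(\xi)=\xi\circ f$ for a vector field germ $\xi$ on $(\mathbb{R}^p,0)$. Then $T\mathcal{A}[G](f)=tf(\mathfrak{M}_n\theta(n))+\omega f(\theta[G]_0(p))$ and $T(\mathcal{R}\times G)(f)=tf(\mathfrak{M}_n\theta(n))+\mathfrak{g}(f)$, where $\mathfrak{g}(f)=\{X\cdot f\mid X\in\mathfrak{g}\}$ and $(X\cdot f)(x)=X\,{}^tf(x)$ (matrix times column vector). *)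

theory Defs
  imports "HOL-Analysis.Analysis"
begin

section \<open>Smooth maps and germs\<close>

text \<open>On an open subset of a Euclidean space, continuity of all iterated directional
  derivatives (together with differentiability) is the usual notion of class \<open>C\<^sup>k\<close>.
  The definition is only meaningful for open \<open>S\<close>.\<close>

primrec Ck_on :: "nat \<Rightarrow> 'a::euclidean_space set \<Rightarrow> ('a \<Rightarrow> 'b::real_normed_vector) \<Rightarrow> bool" where
  "Ck_on 0 S f \<longleftrightarrow> continuous_on S f"
| "Ck_on (Suc k) S f \<longleftrightarrow> (\<forall>x\<in>S. f differentiable (at x)) \<and>
     (\<forall>v. Ck_on k S (\<lambda>x. frechet_derivative f (at x) v))"

definition smooth_on :: "'a::euclidean_space set \<Rightarrow> ('a \<Rightarrow> 'b::real_normed_vector) \<Rightarrow> bool" where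
  "smooth_on S f \<longleftrightarrow> (\<forall>k. Ck_on k S f)"

definition smooth_near_0 :: "('a::euclidean_space \<Rightarrow> 'b::real_normed_vector) \<Rightarrow> bool" where
  "smooth_near_0 f \<longleftrightarrow> (\<exists>U. open U \<and> 0 \<in> U \<and> smooth_on U f)"

text \<open>Germs at \<open>0\<close> of arbitrary functions; smoothness is imposed separately. The filter
  \<open>nhds 0\<close> includes the point \<open>0\<close>, so the value at \<open>0\<close> depends only on the germ.\<close>

quotient_type (overloaded) ('a, 'b) germ = "'a::real_normed_vector \<Rightarrow> 'b"
  / "\<lambda>f g. \<forall>\<^sub>F x in nhds 0. f x = g x"
  morphisms rep_germ germ_of
proof (rule equivpI)
  show "reflp (\<lambda>f g :: 'a \<Rightarrow> 'b. \<forall>\<^sub>F x in nhds 0. f x = g x)"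
    by (simp add: reflp_def)
  show "symp (\<lambda>f g :: 'a \<Rightarrow> 'b. \<forall>\<^sub>F x in nhds 0. f x = g x)"
    by (simp add: symp_def eq_commute)
  show "transp (\<lambda>f g :: 'a \<Rightarrow> 'b. \<forall>\<^sub>F x in nhds 0. f x = g x)"
    by (auto simp: transp_def elim: eventually_elim2)
qed

lemma germ_of_eq_iff: "germ_of f = germ_of g \<longleftrightarrow> (\<forall>\<^sub>F x in nhds 0. f x = g x)"
  by (rule germ.abs_eq_iff)

instantiation germ :: (real_normed_vector, real_vector) real_vector
begin

lift_definition zero_germ :: "('a, 'b) germ" is "\<lambda>x. 0" .

lift_definition plus_germ :: "('a, 'b) germ \<Rightarrow> ('a, 'b) germ \<Rightarrow> ('a, 'b) germ"
  is "\<lambda>f g x. f x + g x" by (auto elim: eventually_elim2)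

lift_definition minus_germ :: "('a, 'b) germ \<Rightarrow> ('a, 'b) germ \<Rightarrow> ('a, 'b) germ"
  is "\<lambda>f g x. f x - g x" by (auto elim: eventually_elim2)

lift_definition uminus_germ :: "('a, 'b) germ \<Rightarrow> ('a, 'b) germ"
  is "\<lambda>f x. - f x" by (auto elim: eventually_mono)

lift_definition scaleR_germ :: "real \<Rightarrow> ('a, 'b) germ \<Rightarrow> ('a, 'b) germ"
  is "\<lambda>c f x. c *\<^sub>R f x" by (auto elim: eventually_mono)

instance
  by standard (transfer; simp add: algebra_simps)+

end

lift_definition germ_smult ::
  "('a::real_normed_vector, real) germ \<Rightarrow> ('a, 'b::real_vector) germ \<Rightarrow> ('a, 'b) germ"
  is "\<lambda>a f x. a x *\<^sub>R f x" by (auto elim: eventually_elim2)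

text \<open>These are predicates on representatives; they depend only on the germ.\<close>

definition map_germ :: "('a::euclidean_space \<Rightarrow> 'b::real_normed_vector) \<Rightarrow> bool" where
  "map_germ f \<longleftrightarrow> smooth_near_0 f \<and> f 0 = 0"

definition diffeo_germ :: "('a::euclidean_space \<Rightarrow> 'a) \<Rightarrow> bool" where
  "diffeo_germ \<phi> \<longleftrightarrow> \<phi> 0 = 0 \<and>
     (\<exists>U V \<phi>'. open U \<and> open V \<and> 0 \<in> U \<and> homeomorphism U V \<phi> \<phi>' \<and>
        smooth_on U \<phi> \<and> smooth_on V \<phi>')"

section \<open>Linear Lie groups\<close>

text \<open>A linear Lie group is a closed subgroup of \<open>GL(p,\<real>)\<close> (closed in \<open>GL(p,\<real>)\<close>, not
  necessarily in the space of all matrices).\<close>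

definition linear_lie_group :: "(real^'p^'p) set \<Rightarrow> bool" where
  "linear_lie_group G \<longleftrightarrow>
     closedin (top_of_set {A. invertible A}) G \<and>
     mat 1 \<in> G \<and> (\<forall>A\<in>G. \<forall>B\<in>G. A ** B \<in> G) \<and> (\<forall>A\<in>G. matrix_inv A \<in> G)"

text \<open>The tangent space of \<open>G\<close> at the identity: velocities of smooth curves in \<open>G\<close>.\<close>

definition lie_algebra :: "(real^'p^'p) set \<Rightarrow> (real^'p^'p) set" where
  "lie_algebra G = {X. \<exists>\<gamma>. smooth_near_0 \<gamma> \<and> \<gamma> 0 = mat 1 \<and> (\<forall>\<^sub>F t in nhds (0::real). \<gamma> t \<in> G) \<and>
     (\<gamma> has_vector_derivative X) (at 0)}"

definition theta0 :: "(real^'p^'p) set \<Rightarrow> (real^'p, real^'p) germ set" where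
  "theta0 G = {germ_of \<eta> | \<eta>. map_germ \<eta> \<and>
     (\<forall>\<^sub>F y in nhds 0. jacobian \<eta> (at y) \<in> lie_algebra G)}"

definition Diff :: "(real^'p^'p) set \<Rightarrow> (real^'p, real^'p) germ set" where
  "Diff G = {germ_of \<psi> | \<psi>. diffeo_germ \<psi> \<and> (\<forall>\<^sub>F y in nhds 0. jacobian \<psi> (at y) \<in> G)}"

text \<open>Here \<open>\<Psi>\<close> represents a germ along the compact set \<open>{0} \<times> [0,1]\<close>.\<close>

definition Diff0 :: "(real^'p^'p) set \<Rightarrow> (real^'p, real^'p) germ set" where
  "Diff0 G = {\<psi> \<in> Diff G. \<exists>(\<Psi> :: (real^'p) \<times> real \<Rightarrow> real^'p) W.
     open W \<and> {0} \<times> {0..1} \<subseteq> W \<and> smooth_on W \<Psi> \<and>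
     (\<forall>t\<in>{0..1}. \<Psi> (0, t) = 0) \<and>
     (\<forall>t\<in>{0..1}. germ_of (\<lambda>y. \<Psi> (y, t)) \<in> Diff G) \<and>
     germ_of (\<lambda>y. \<Psi> (y, 0)) = germ_of (\<lambda>y. y) \<and>
     germ_of (\<lambda>y. \<Psi> (y, 1)) = \<psi>}"

definition linear_germ :: "real^'p^'p \<Rightarrow> (real^'p, real^'p) germ" where
  "linear_germ A = germ_of (\<lambda>y. A *v y)"

definition isomorphic_subspaces :: "'a::real_vector set \<Rightarrow> 'b::real_vector set \<Rightarrow> bool" where
  "isomorphic_subspaces S T \<longleftrightarrow> (\<exists>h. bij_betw h S T \<and>
     (\<forall>x\<in>S. \<forall>y\<in>S. h (x + y) = h x + h y) \<and> (\<forall>c. \<forall>x\<in>S. h (c *\<^sub>R x) = c *\<^sub>R h x))"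

section \<open>Equivalences of map germs\<close>

text \<open>For continuous \<open>g\<close> and \<open>\<phi>\<close> fixing the origin, the germs of \<open>f \<circ> \<phi>\<close> and \<open>\<psi> \<circ> g\<close> depend only
  on the germs involved.\<close>

definition A0_equivalent ::
  "(real^'p^'p) set \<Rightarrow> (real^'n \<Rightarrow> real^'p) \<Rightarrow> (real^'n \<Rightarrow> real^'p) \<Rightarrow> bool" where
  "A0_equivalent G f g \<longleftrightarrow> (\<exists>\<phi> \<psi>. diffeo_germ \<phi> \<and> germ_of \<psi> \<in> Diff0 G \<and>
     germ_of (f \<circ> \<phi>) = germ_of (\<psi> \<circ> g))"

definition G_congruent ::
  "(real^'p^'p) set \<Rightarrow> (real^'n \<Rightarrow> real^'p) \<Rightarrow> (real^'n \<Rightarrow> real^'p) \<Rightarrow> bool" where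
  "G_congruent G f g \<longleftrightarrow> (\<exists>\<phi> A. diffeo_germ \<phi> \<and> A \<in> G \<and>
     germ_of (f \<circ> \<phi>) = germ_of ((\<lambda>y. A *v y) \<circ> g))"

section \<open>Tangent spaces\<close>

definition maximal_ideal :: "(real^'n, real) germ set" where
  "maximal_ideal = {germ_of a | a. smooth_near_0 a \<and> a 0 = 0}"

definition theta :: "(real^'n, real^'n) germ set" where
  "theta = {germ_of \<zeta> | \<zeta>. smooth_near_0 \<zeta>}"

definition maximal_ideal_theta :: "(real^'n, real^'n) germ set" where
  "maximal_ideal_theta = {\<Sum>i<k. germ_smult (a i) (\<zeta> i) | (k::nat) a \<zeta>.
     (\<forall>i<k. a i \<in> maximal_ideal \<and> \<zeta> i \<in> theta)}"

lift_definition tf ::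
  "('a::real_normed_vector \<Rightarrow> 'b::real_normed_vector) \<Rightarrow> ('a, 'a) germ \<Rightarrow> ('a, 'b) germ"
  is "\<lambda>f \<zeta> x. frechet_derivative f (at x) (\<zeta> x)" by (auto elim: eventually_mono)

text \<open>The image of a set of vector field germs under \<open>\<xi> \<mapsto> \<xi> \<circ> f\<close>.\<close>

definition omega_image ::
  "(real^'n \<Rightarrow> real^'p) \<Rightarrow> (real^'p, real^'p) germ set \<Rightarrow> (real^'n, real^'p) germ set" where
  "omega_image f S = {germ_of (\<xi> \<circ> f) | \<xi>. germ_of \<xi> \<in> S}"

definition TA :: "(real^'p^'p) set \<Rightarrow> (real^'n \<Rightarrow> real^'p) \<Rightarrow> (real^'n, real^'p) germ set" where
  "TA G f = {u + v | u v. u \<in> tf f ` maximal_ideal_theta \<and> v \<in> omega_image f (theta0 G)}"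

definition TRG :: "(real^'p^'p) set \<Rightarrow> (real^'n \<Rightarrow> real^'p) \<Rightarrow> (real^'n, real^'p) germ set" where
  "TRG G f = {u + v | u v. u \<in> tf f ` maximal_ideal_theta \<and>
     v \<in> {germ_of (\<lambda>x. X *v f x) | X. X \<in> lie_algebra G}}"

definition condition_a :: "(real^'p^'p) set \<Rightarrow> bool" where
  "condition_a G \<longleftrightarrow> isomorphic_subspaces (lie_algebra G) (theta0 G)"

definition condition_b :: "(real^'p^'p) set \<Rightarrow> bool" where
  "condition_b G \<longleftrightarrow> (\<forall>\<eta>. germ_of \<eta> \<in> theta0 G \<longrightarrow>
     (\<forall>i. \<exists>l :: real^'p \<Rightarrow> real. linear l \<and> (\<forall>\<^sub>F y in nhds 0. \<eta> y $ i = l y)))"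

definition condition_c :: "(real^'p^'p) set \<Rightarrow> bool" where
  "condition_c G \<longleftrightarrow> Diff0 G = linear_germ ` G"

end

theory Submission
  imports Defs
begin

text \<open>Everything is governed by the first prolongation of the Lie algebra \<open>\<gg>\<close> of \<open>G\<close>: the symmetric
  bilinear maps \<open>B\<close> with \<open>B v \<in> \<gg>\<close> for all \<open>v\<close>. If it is trivial, then so is the second derivative of every
  vector field in \<open>\<theta>[G]\<^sub>0\<close> and, since \<open>J\<inverse> \<partial>\<^sub>v J \<in> \<gg>\<close>, of every \<open>\<psi> \<in> Diff[G]\<close>; so both are linear. Conversely, a
  nonzero \<open>B\<close> gives the nonlinear vector field \<open>B(y, y)\<close>, whose flow \<open>y + t B(y, y) + O(|y|\<^sup>3)\<close> is a
  nonlinear element of \<open>Diff\<^sub>0[G]\<close>. Only flows of quadratic vector fields are needed, and matrix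
  exponentials are flows of this kind as well: \<open>(M, X)' = (X M, 0)\<close>.

  That such flows have their Jacobian in \<open>G\<close> is an invariance theorem of Nagumo type: a linear equation
  \<open>J' = A J\<close> with \<open>A\<close> in the contingent cone of \<open>G\<close> at \<open>1\<close> does not leave \<open>G\<close>. It also shows that this
  cone is \<open>\<gg>\<close>, from which one gets the closed subgroup theorem in the form that a connected \<open>G\<close>
  is connected by smooth paths, so that \<open>G \<subseteq> Diff\<^sub>0[G]\<close>.\<close>


section \<open>Calculus of smooth maps\<close>

text \<open>\<open>Diff0\<close> asks for joint smoothness in space and time, and
  \<open>diffeo_germ\<close> for a smooth inverse, so mere existence of flows is not enough. Written
  as an integral equation, a quadratic flow is a fixed point
  \<open>x = c y + t \<beta>(x, x)\<close> in a Banach space of paths. This equation reproduces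
  itself under differentiation: every derivative of the solution solves the equation linearised at
  that same solution, so one induction gives smoothness. Inverses of flow maps come from reversing
  time. The group is only known to be closed among invertible matrices, so its tangent directions
  are first taken in the weakest sense, as limits of secants. For these, neither curves nor sums are
  available at the start; invariance is therefore a Gronwall argument for the distance to
  \<open>closure G\<close>, and only afterwards are the directions recognised as velocities of
  one-parameter groups. Condition (a) supplies an abstract isomorphism, not the canonical embedding
  of matrices as linear germs; finite dimension turns the former into surjectivity of the
  latter.\<close>

lemma Ck_on_Suc_imp: "Ck_on (Suc k) S f \<Longrightarrow> Ck_on k S f"
proof (induction k arbitrary: f)
  case 0
  then show ?case
    by (auto intro!: continuous_at_imp_continuous_on differentiable_imp_continuous_within)
qed auto

lemma Ck_on_subset: "Ck_on k S f \<Longrightarrow> T \<subseteq> S \<Longrightarrow> Ck_on k T f"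
  by (induction k arbitrary: f) (auto intro: continuous_on_subset)

lemma frechet_derivative_cong_open:
  assumes "open S" "x \<in> S" "\<And>y. y \<in> S \<Longrightarrow> f y = g y"
  shows "frechet_derivative f (at x) = frechet_derivative g (at x)"
proof -
  have "(f has_derivative D) (at x) \<longleftrightarrow> (g has_derivative D) (at x)" for D
    using has_derivative_transform_within_open[OF _ assms(1,2), of f D UNIV g]
      has_derivative_transform_within_open[OF _ assms(1,2), of g D UNIV f] assms(3) by auto
  then show ?thesis by (simp add: frechet_derivative_def)
qed

lemma Ck_on_cong:
  assumes "open S" "\<And>y. y \<in> S \<Longrightarrow> f y = g y" "Ck_on k S f"
  shows "Ck_on k S g"
  using assms(2,3)
proof (induction k arbitrary: f g)
  case 0
  then show ?case using continuous_on_eq[of S f g] by simp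
next
  case (Suc k)
  have fd: "frechet_derivative f (at x) = frechet_derivative g (at x)" if "x \<in> S" for x
    using frechet_derivative_cong_open assms(1) that Suc.prems(1) by blast
  have "g differentiable (at x)" if x: "x \<in> S" for x
  proof -
    obtain D where "(f has_derivative D) (at x)" using Suc.prems x by (auto simp: differentiable_def)
    then have "(g has_derivative D) (at x)"
      using has_derivative_transform_within_open[OF _ assms(1) x, of f D UNIV g] Suc.prems(1) by auto
    then show ?thesis by (auto simp: differentiable_def)
  qed
  moreover have "Ck_on k S (\<lambda>x. frechet_derivative g (at x) v)" for v
    by (rule Suc.IH[of "\<lambda>x. frechet_derivative f (at x) v"]) (use Suc.prems fd in auto)
  ultimately show ?case by simp
qed

text \<open>Uniqueness of the derivative on an open set lets an explicit formula \<open>D\<close>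
  replace \<open>frechet_derivative\<close> in the recursive definition; the closure properties
  below are inductions over this rule.\<close>

lemma Ck_on_SucI:
  assumes "open S" "\<And>x. x \<in> S \<Longrightarrow> (f has_derivative D x) (at x)" "\<And>v. Ck_on k S (\<lambda>x. D x v)"
  shows "Ck_on (Suc k) S f"
proof -
  have "frechet_derivative f (at x) = D x" if "x \<in> S" for x
    using assms(2)[OF that] frechet_derivative_at by metis
  then have "Ck_on k S (\<lambda>x. frechet_derivative f (at x) v)" for v
    using Ck_on_cong[OF assms(1) _ assms(3)[of v]] by simp
  then show ?thesis using assms(2) by (auto simp: differentiable_def)
qed

lemma Ck_on_SucD:
  assumes "Ck_on (Suc k) S f" "x \<in> S"
  shows "(f has_derivative frechet_derivative f (at x)) (at x)"
  using assms frechet_derivative_works by auto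

lemma Ck_on_const: "open S \<Longrightarrow> Ck_on k S (\<lambda>x. c)"
proof (induction k arbitrary: c)
  case (Suc k)
  show ?case
    by (rule Ck_on_SucI[where D = "\<lambda>x v. 0"]) (use Suc in auto)
qed simp

lemma Ck_on_linear:
  assumes "bounded_linear L" "open S" shows "Ck_on k S L"
proof (cases k)
  case 0
  then show ?thesis using assms linear_continuous_on by auto
next
  case (Suc k)
  show ?thesis unfolding Suc
    by (rule Ck_on_SucI[where D = "\<lambda>x. L"])
      (use assms in \<open>auto intro: bounded_linear_imp_has_derivative Ck_on_const\<close>)
qed

lemma Ck_on_compose_linear:
  assumes "bounded_linear L" "open S" "Ck_on k S f" shows "Ck_on k S (\<lambda>x. L (f x))"
  using assms(3)
proof (induction k arbitrary: f)
  case 0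
  then show ?case using assms bounded_linear.continuous_on by auto
next
  case (Suc k)
  show ?case
    by (rule Ck_on_SucI[where D = "\<lambda>x v. L (frechet_derivative f (at x) v)"])
      (use Suc assms in \<open>auto intro!: bounded_linear.has_derivative[OF assms(1)] Ck_on_SucD[OF Suc.prems]\<close>)
qed

lemma Ck_on_add:
  assumes "open S" "Ck_on k S f" "Ck_on k S g" shows "Ck_on k S (\<lambda>x. f x + g x)"
  using assms(2,3)
proof (induction k arbitrary: f g)
  case 0
  then show ?case by (auto intro: continuous_intros)
next
  case (Suc k)
  show ?case
    by (rule Ck_on_SucI[where D = "\<lambda>x v. frechet_derivative f (at x) v + frechet_derivative g (at x) v"])
      (use Suc assms in \<open>auto intro!: has_derivative_add Ck_on_SucD[OF Suc.prems(1)] Ck_on_SucD[OF Suc.prems(2)]\<close>)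
qed

lemma Ck_on_bilinear:
  assumes "bounded_bilinear b" "open S" "Ck_on k S f" "Ck_on k S g"
  shows "Ck_on k S (\<lambda>x. b (f x) (g x))"
  using assms(3,4)
proof (induction k arbitrary: f g)
  case 0
  then show ?case using bounded_bilinear.continuous_on[OF assms(1)] by auto
next
  case (Suc k)
  note * = Ck_on_Suc_imp[OF Suc.prems(1)] Ck_on_Suc_imp[OF Suc.prems(2)]
  show ?case
    by (rule Ck_on_SucI[where D = "\<lambda>x v. b (f x) (frechet_derivative g (at x) v)
        + b (frechet_derivative f (at x) v) (g x)"])
      (use Suc.prems in \<open>auto intro!: bounded_bilinear.FDERIV[OF assms(1)] Ck_on_add assms(2)
        Suc.IH * Ck_on_SucD[OF Suc.prems(1)] Ck_on_SucD[OF Suc.prems(2)]\<close>)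
qed

text \<open>The derivative \<open>L\<close> of the inner map is constant, so each derivative of the
  composite is again of the form treated by the induction. Restricting a flow to a slice is a
  composition of this kind.\<close>

lemma Ck_on_affine:
  assumes "Ck_on k S f" "bounded_linear L" "open T" "\<And>t. t \<in> T \<Longrightarrow> p + L t \<in> S"
  shows "Ck_on k T (\<lambda>t. f (p + L t))"
  using assms(1)
proof (induction k arbitrary: f)
  case 0
  have "continuous_on T (\<lambda>t. p + L t)"
    using assms(2) by (intro continuous_intros linear_continuous_on)
  then show ?case using 0 assms(4) continuous_on_compose2[of S f T "\<lambda>t. p + L t"] by auto
next
  case (Suc k)
  interpret L: bounded_linear L by fact
  have d: "((\<lambda>t. f (p + L t)) has_derivative (\<lambda>v. frechet_derivative f (at (p + L t)) (L v))) (at t)"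
    if "t \<in> T" for t
    by (rule has_derivative_compose[of "\<lambda>t. p + L t" L, OF _ Ck_on_SucD[OF Suc.prems assms(4)[OF that]]])
      (auto intro!: derivative_eq_intros L.has_derivative)
  show ?case
    by (rule Ck_on_SucI[OF assms(3) d]) (use Suc in auto)
qed

lemma smooth_on_Ck: "smooth_on S f \<Longrightarrow> Ck_on k S f"
  by (simp add: smooth_on_def)

lemma smooth_on_has_derivative:
  assumes "smooth_on S f" "x \<in> S"
  shows "(f has_derivative frechet_derivative f (at x)) (at x)"
  using Ck_on_SucD[OF smooth_on_Ck[OF assms(1), of "Suc 0"] assms(2)] .

lemma smooth_on_deriv: "smooth_on S f \<Longrightarrow> smooth_on S (\<lambda>x. frechet_derivative f (at x) v)"
  unfolding smooth_on_def by (metis Ck_on.simps(2))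

lemma smooth_on_continuous: "smooth_on S f \<Longrightarrow> continuous_on S f"
  unfolding smooth_on_def by (metis Ck_on.simps(1))

lemma smooth_on_subset: "smooth_on S f \<Longrightarrow> T \<subseteq> S \<Longrightarrow> smooth_on T f"
  using Ck_on_subset unfolding smooth_on_def by metis

lemma smooth_on_linear: "bounded_linear L \<Longrightarrow> open S \<Longrightarrow> smooth_on S L"
  using Ck_on_linear unfolding smooth_on_def by metis

lemma smooth_on_const: "open S \<Longrightarrow> smooth_on S (\<lambda>x. c)"
  using Ck_on_const unfolding smooth_on_def by metis

lemma smooth_on_compose_linear:
  "bounded_linear L \<Longrightarrow> open S \<Longrightarrow> smooth_on S f \<Longrightarrow> smooth_on S (\<lambda>x. L (f x))"
  using Ck_on_compose_linear unfolding smooth_on_def by metis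

lemma smooth_on_bilinear:
  "bounded_bilinear b \<Longrightarrow> open S \<Longrightarrow> smooth_on S f \<Longrightarrow> smooth_on S g \<Longrightarrow> smooth_on S (\<lambda>x. b (f x) (g x))"
  using Ck_on_bilinear unfolding smooth_on_def by metis

lemma smooth_on_affine:
  "smooth_on S f \<Longrightarrow> bounded_linear L \<Longrightarrow> open T \<Longrightarrow> (\<And>t. t \<in> T \<Longrightarrow> p + L t \<in> S) \<Longrightarrow>
    smooth_on T (\<lambda>t. f (p + L t))"
  using Ck_on_affine unfolding smooth_on_def by metis

section \<open>Symmetry of second derivatives\<close>

text \<open>Schwarz's argument. The mixed second difference is an increment along \<open>u\<close>
  of increments along \<open>v\<close>; one mean value theorem per direction turns it into a second
  derivative at an intermediate point. Swapping \<open>u\<close> and \<open>v\<close> leaves the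
  left side unchanged but reverses the order of differentiation on the right.\<close>

lemma second_difference_mvt:
  fixes f :: "'a::euclidean_space \<Rightarrow> real"
  assumes f: "smooth_on S f" and S: "\<And>s t. s \<in> {0..h} \<Longrightarrow> t \<in> {0..h} \<Longrightarrow> x + s *\<^sub>R u + t *\<^sub>R v \<in> S"
    and h: "0 < h"
  shows "\<exists>s\<in>{0..h}. \<exists>t\<in>{0..h}. f (x + h *\<^sub>R u + h *\<^sub>R v) - f (x + h *\<^sub>R u) - f (x + h *\<^sub>R v) + f x =
    h\<^sup>2 * frechet_derivative (\<lambda>y. frechet_derivative f (at y) u) (at (x + s *\<^sub>R u + t *\<^sub>R v)) v"
proof -
  let ?Du = "\<lambda>y. frechet_derivative f (at y) u"
  have line: "((\<lambda>s. g (y + s *\<^sub>R w)) has_field_derivative frechet_derivative g (at (y + s *\<^sub>R w)) w) (at s)"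
    if "smooth_on S g" "y + s *\<^sub>R w \<in> S" for g :: "'a \<Rightarrow> real" and y w s
  proof -
    have d: "(g has_derivative frechet_derivative g (at (y + s *\<^sub>R w))) (at (y + s *\<^sub>R w))"
      using that smooth_on_has_derivative by blast
    have "((\<lambda>s. g (y + s *\<^sub>R w)) has_derivative (\<lambda>r. frechet_derivative g (at (y + s *\<^sub>R w)) (r *\<^sub>R w))) (at s)"
      by (rule has_derivative_compose[where f = "\<lambda>s. y + s *\<^sub>R w" and f' = "\<lambda>r. r *\<^sub>R w", OF _ d])
        (auto intro!: derivative_eq_intros)
    then show ?thesis
      using linear_scale[OF has_derivative_linear[OF d]]
      by (simp add: has_field_derivative_def mult.commute[of _ "frechet_derivative g (at (y + s *\<^sub>R w)) w"] fun_eq_iff mult_commute_abs)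
  qed
  have "\<exists>s>0. s < h \<and> (\<lambda>s. f (x + h *\<^sub>R v + s *\<^sub>R u) - f (x + s *\<^sub>R u)) h - (\<lambda>s. f (x + h *\<^sub>R v + s *\<^sub>R u) - f (x + s *\<^sub>R u)) 0
      = (h - 0) * (?Du (x + h *\<^sub>R v + s *\<^sub>R u) - ?Du (x + s *\<^sub>R u))"
  proof (rule MVT2[OF h])
    fix s assume s: "0 \<le> s" "s \<le> h"
    show "((\<lambda>s. f (x + h *\<^sub>R v + s *\<^sub>R u) - f (x + s *\<^sub>R u)) has_real_derivative
      ?Du (x + h *\<^sub>R v + s *\<^sub>R u) - ?Du (x + s *\<^sub>R u)) (at s)"
      using S[of s 0] S[of s h] s h by (intro DERIV_diff line f) (auto simp: algebra_simps)
  qed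
  then obtain s where s: "0 < s" "s < h" and eq1:
    "f (x + h *\<^sub>R v + h *\<^sub>R u) - f (x + h *\<^sub>R u) - (f (x + h *\<^sub>R v) - f x)
      = h * (?Du (x + h *\<^sub>R v + s *\<^sub>R u) - ?Du (x + s *\<^sub>R u))" by auto
  have "\<exists>t>0. t < h \<and> ?Du (x + s *\<^sub>R u + h *\<^sub>R v) - ?Du (x + s *\<^sub>R u + 0 *\<^sub>R v)
      = (h - 0) * frechet_derivative ?Du (at (x + s *\<^sub>R u + t *\<^sub>R v)) v"
    using S s by (intro MVT2[OF h] line smooth_on_deriv f) auto
  then obtain t where t: "0 < t" "t < h" and eq2:
    "?Du (x + s *\<^sub>R u + h *\<^sub>R v) - ?Du (x + s *\<^sub>R u)
      = h * frechet_derivative ?Du (at (x + s *\<^sub>R u + t *\<^sub>R v)) v" by auto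
  have "f (x + h *\<^sub>R u + h *\<^sub>R v) - f (x + h *\<^sub>R u) - f (x + h *\<^sub>R v) + f x
    = h * (?Du (x + s *\<^sub>R u + h *\<^sub>R v) - ?Du (x + s *\<^sub>R u))"
    using eq1 by (simp add: algebra_simps)
  then show ?thesis using s t unfolding eq2 by (force simp: power2_eq_square)
qed

text \<open>Both orders of differentiation evaluate the same second difference at points of a small
  parallelogram. If the values at \<open>x\<close> were \<open>2 * e\<close> apart, continuity would
  keep the intermediate values within \<open>e\<close> of them, and these could not agree.\<close>

lemma second_derivative_symmetric_real:
  fixes f :: "'a::euclidean_space \<Rightarrow> real"
  assumes f: "smooth_on S f" and S: "open S" "x \<in> S"
  shows "frechet_derivative (\<lambda>y. frechet_derivative f (at y) u) (at x) v
    = frechet_derivative (\<lambda>y. frechet_derivative f (at y) v) (at x) u" (is "?F u v x = ?F v u x")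
proof (rule ccontr)
  assume ne: "\<not> ?thesis"
  define e where "e = \<bar>?F u v x - ?F v u x\<bar> / 2"
  have e: "e > 0" using ne by (simp add: e_def)
  have cont: "\<exists>d>0. \<forall>y. dist y x < d \<longrightarrow> y \<in> S \<and> dist (?F a b y) (?F a b x) < e" for a b
  proof -
    have "continuous_on S (?F a b)"
      by (intro smooth_on_continuous smooth_on_deriv f)
    then have "isCont (?F a b) x" using S continuous_on_eq_continuous_at by blast
    then have "eventually (\<lambda>y. dist (?F a b y) (?F a b x) < e) (nhds x)"
      using e by (metis isCont_def tendsto_at_iff_tendsto_nhds tendstoD)
    moreover have "eventually (\<lambda>y. y \<in> S) (nhds x)" using S eventually_nhds by blast
    ultimately have "eventually (\<lambda>y. y \<in> S \<and> dist (?F a b y) (?F a b x) < e) (nhds x)"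
      by eventually_elim auto
    then show ?thesis by (simp add: eventually_nhds_metric)
  qed
  from cont[of u v] obtain d1 where d1: "d1 > 0" "\<And>y. dist y x < d1 \<Longrightarrow> y \<in> S \<and> dist (?F u v y) (?F u v x) < e"
    by blast
  from cont[of v u] obtain d2 where d2: "d2 > 0" "\<And>y. dist y x < d2 \<Longrightarrow> y \<in> S \<and> dist (?F v u y) (?F v u x) < e"
    by blast
  \<comment> \<open>Every point \<open>x + s u + t v\<close> with \<open>s\<close>, \<open>t\<close>
    in \<open>{0..h}\<close> then lies within \<open>min d1 d2\<close> of \<open>x\<close>; the
    summand 1 covers \<open>u = v = 0\<close>.\<close>
  define h where "h = min d1 d2 / (2 * (norm u + norm v + 1))"
  have n: "norm u + norm v + 1 > 0" by (smt (verit) norm_ge_zero)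
  have h: "h > 0" using d1(1) d2(1) n by (simp add: h_def)
  have small: "dist (x + s *\<^sub>R a + t *\<^sub>R b) x < min d1 d2"
    if "s \<in> {0..h}" "t \<in> {0..h}" "{a, b} = {u, v}" for s t a b
  proof -
    have ab: "norm a + norm b = norm u + norm v" using that(3) by (auto simp: doubleton_eq_iff)
    have "norm (s *\<^sub>R a + t *\<^sub>R b) \<le> s * norm a + t * norm b"
      using that norm_triangle_ineq[of "s *\<^sub>R a" "t *\<^sub>R b"] by auto
    also have "\<dots> \<le> h * norm a + h * norm b"
      using that by (intro add_mono mult_right_mono) auto
    also have "\<dots> = h * (norm u + norm v)" using ab by (simp add: algebra_simps flip: ab)
    also have "\<dots> < h * (2 * (norm u + norm v + 1))" using h n by (intro mult_strict_left_mono) (auto simp: add_nonneg_nonneg add_strict_increasing2 intro: add_nonneg_pos)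
    also have "\<dots> = min d1 d2" using n by (simp add: h_def)
    finally show ?thesis by (simp add: dist_norm add.assoc)
  qed
  have inS: "x + s *\<^sub>R a + t *\<^sub>R b \<in> S"
    if "{a, b} = {u, v}" "s \<in> {0..h}" "t \<in> {0..h}" for s t a b
    using d1(2) small[OF that(2,3,1)] by simp
  obtain s t where st: "s\<in>{0..h}" "t\<in>{0..h}"
    "f (x + h *\<^sub>R u + h *\<^sub>R v) - f (x + h *\<^sub>R u) - f (x + h *\<^sub>R v) + f x = h\<^sup>2 * ?F u v (x + s *\<^sub>R u + t *\<^sub>R v)"
    using second_difference_mvt[OF f inS h, of u v] by auto
  obtain s' t' where st': "s'\<in>{0..h}" "t'\<in>{0..h}"
    "f (x + h *\<^sub>R v + h *\<^sub>R u) - f (x + h *\<^sub>R v) - f (x + h *\<^sub>R u) + f x = h\<^sup>2 * ?F v u (x + s' *\<^sub>R v + t' *\<^sub>R u)"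
    using second_difference_mvt[OF f inS h, of v u] by (auto simp: insert_commute)
  have "h\<^sup>2 * ?F u v (x + s *\<^sub>R u + t *\<^sub>R v) = h\<^sup>2 * ?F v u (x + s' *\<^sub>R v + t' *\<^sub>R u)"
    using st(3) st'(3) by (simp add: algebra_simps)
  then have "?F u v (x + s *\<^sub>R u + t *\<^sub>R v) = ?F v u (x + s' *\<^sub>R v + t' *\<^sub>R u)" using h by simp
  moreover have "dist (?F u v (x + s *\<^sub>R u + t *\<^sub>R v)) (?F u v x) < e"
    using d1(2) small[OF st(1,2)] by auto
  moreover have "dist (?F v u (x + s' *\<^sub>R v + t' *\<^sub>R u)) (?F v u x) < e"
    using d2(2) small[OF st'(1,2), of v u] by auto
  ultimately show False by (simp add: e_def dist_real_def abs_if split: if_splits)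
qed

lemma second_derivative_symmetric:
  fixes f :: "'a::euclidean_space \<Rightarrow> 'b::euclidean_space"
  assumes f: "smooth_on S f" and S: "open S" "x \<in> S"
  shows "frechet_derivative (\<lambda>y. frechet_derivative f (at y) u) (at x) v
    = frechet_derivative (\<lambda>y. frechet_derivative f (at y) v) (at x) u"
proof (rule euclidean_eqI)
  fix i :: 'b assume "i \<in> Basis"
  let ?g = "\<lambda>y. f y \<bullet> i"
  have comp: "frechet_derivative (\<lambda>y. h y \<bullet> i) (at y) w = frechet_derivative h (at y) w \<bullet> i"
    if "smooth_on S h" "y \<in> S" for h :: "'a \<Rightarrow> 'b" and y w
  proof -
    have "((\<lambda>y. h y \<bullet> i) has_derivative (\<lambda>w. frechet_derivative h (at y) w \<bullet> i)) (at y)"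
      by (intro has_derivative_inner_left smooth_on_has_derivative[OF that])
    from frechet_derivative_at[OF this] show ?thesis by metis
  qed
  have g: "smooth_on S ?g"
    using smooth_on_compose_linear[OF bounded_linear_inner_left S(1) f] .
  have step: "frechet_derivative (\<lambda>y. frechet_derivative ?g (at y) a) (at x) b
      = frechet_derivative (\<lambda>y. frechet_derivative f (at y) a) (at x) b \<bullet> i" for a b
  proof -
    have "frechet_derivative (\<lambda>y. frechet_derivative ?g (at y) a) (at x)
        = frechet_derivative (\<lambda>y. frechet_derivative f (at y) a \<bullet> i) (at x)"
      by (rule frechet_derivative_cong_open[OF S]) (rule comp[OF f])
    then show ?thesis using comp[OF smooth_on_deriv[OF f] S(2)] by simp
  qed
  show "frechet_derivative (\<lambda>y. frechet_derivative f (at y) u) (at x) v \<bullet> i =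
    frechet_derivative (\<lambda>y. frechet_derivative f (at y) v) (at x) u \<bullet> i"
    using second_derivative_symmetric_real[OF g S, of u v] unfolding step .
qed

section \<open>Quadratic fixed-point equations in Banach spaces\<close>

text \<open>Inverts \<open>1 - T\<close> by a contraction; the bound says that the inverse has norm
  at most 2.\<close>

lemma contraction_linear_solve:
  fixes T :: "'z::banach \<Rightarrow> 'z"
  assumes T: "bounded_linear T" "\<And>w. norm (T w) \<le> norm w / 2"
  shows "\<exists>!w. w = h + T w" and "w = h + T w \<Longrightarrow> norm w \<le> 2 * norm h"
proof -
  interpret T: bounded_linear T by fact
  have "\<exists>!w. h + T w = w"
  proof (rule banach_fix_type[of "1/2"])
    show "\<forall>x y. dist (h + T x) (h + T y) \<le> 1 / 2 * dist x y"
      using T(2) by (simp add: dist_norm flip: T.diff)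
  qed auto
  then show "\<exists>!w. w = h + T w" by metis
  assume "w = h + T w"
  then have "norm w \<le> norm h + norm (T w)" by (metis norm_triangle_ineq)
  then show "norm w \<le> 2 * norm h" using T(2)[of w] by simp
qed

text \<open>\<open>D\<close> is \<open>(1 - F2)^-1 F1\<close> for the partial maps
  \<open>F1 v = F' (v, 0)\<close> and \<open>F2 w = F' (0, w)\<close>: the derivative forced on an
  implicit function. Its linearity follows from uniqueness of the solution.\<close>

lemma contraction_linear_solve_operator:
  fixes F' :: "'e::real_normed_vector \<times> 'z::banach \<Rightarrow> 'z"
  assumes F': "bounded_linear F'" and half: "\<And>w. norm (F' (0, w)) \<le> norm w / 2"
  obtains D where "bounded_linear D" "\<And>v. D v = F' (v, D v)"
proof -
  interpret F': bounded_linear F' by fact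
  have split: "F' (v, w) = F' (v, 0) + F' (0, w)" for v w
    using F'.add[of "(v, 0)" "(0, w)"] by simp
  have T: "bounded_linear (\<lambda>w. F' (0, w))"
    by (intro bounded_linear_compose[OF F'] bounded_linear_Pair bounded_linear_zero bounded_linear_ident)
  note ex1 = contraction_linear_solve(1)[OF T half] and bd = contraction_linear_solve(2)[OF T half]
  define D where "D v = (THE w. w = F' (v, 0) + F' (0, w))" for v
  have D: "D v = F' (v, 0) + F' (0, D v)" for v
    unfolding D_def by (rule theI'[OF ex1])
  have uniq: "w = D v" if "w = F' (v, 0) + F' (0, w)" for v w
    using ex1[of "F' (v, 0)"] D[of v] that by auto
  obtain K where K: "\<And>x. norm (F' x) \<le> norm x * K" using F'.bounded by blast
  have "bounded_linear D"
  proof (rule bounded_linear_intro)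
    show "D (x + y) = D x + D y" for x y
    proof (rule uniq[symmetric])
      have "F' (x + y, 0) = F' (x, 0) + F' (y, 0)" using F'.add[of "(x, 0)" "(y, 0)"] by simp
      moreover have "F' (0, D x + D y) = F' (0, D x) + F' (0, D y)"
        using F'.add[of "(0, D x)" "(0, D y)"] by simp
      ultimately show "D x + D y = F' (x + y, 0) + F' (0, D x + D y)"
        using D[of x] D[of y] by (metis (no_types, lifting) add.assoc add.left_commute)
    qed
    show "D (r *\<^sub>R x) = r *\<^sub>R D x" for r x
    proof (rule uniq[symmetric])
      have "F' (r *\<^sub>R x, 0) = r *\<^sub>R F' (x, 0)" using F'.scaleR[of r "(x, 0)"] by simp
      moreover have "F' (0, r *\<^sub>R D x) = r *\<^sub>R F' (0, D x)" using F'.scaleR[of r "(0, D x)"] by simp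
      ultimately show "r *\<^sub>R D x = F' (r *\<^sub>R x, 0) + F' (0, r *\<^sub>R D x)"
        using D[of x] by (metis scaleR_right_distrib)
    qed
    show "norm (D x) \<le> norm x * (2 * K)" for x
      using bd[OF D[of x]] K[of "(x, 0)"] by simp
  qed
  then show ?thesis using that D split by metis
qed

section \<open>Regularity of solutions of fixed-point equations with parameters\<close>

lemma isCont_iff_nhds: "isCont f x \<longleftrightarrow> (f \<longlongrightarrow> f x) (nhds x)"
  unfolding isCont_def by (rule tendsto_at_iff_tendsto_nhds)

text \<open>The increment of \<open>u\<close> splits into the change of \<open>F\<close> in its
  second argument, at most half the increment and so absorbed on the left, and the change in the
  parameter, which tends to 0.\<close>

lemma implicit_continuous:
  fixes F :: "'e::real_normed_vector \<times> 'z::real_normed_vector \<Rightarrow> 'z"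
  assumes ev: "\<forall>\<^sub>F z in nhds z0. u z = F (z, u z) \<and> norm (F (z, u z) - F (z, u z0)) \<le> norm (u z - u z0) / 2"
    and cont: "isCont (\<lambda>z. F (z, u z0)) z0"
  shows "isCont u z0"
proof -
  have u0: "u z0 = F (z0, u z0)" using eventually_nhds_x_imp_x[OF ev] by simp
  have "((\<lambda>z. F (z, u z0)) \<longlongrightarrow> F (z0, u z0)) (nhds z0)"
    using cont by (simp add: isCont_iff_nhds)
  then have "((\<lambda>z. F (z, u z0) - F (z0, u z0)) \<longlongrightarrow> 0) (nhds z0)"
    using LIM_zero by blast
  then have lim: "((\<lambda>z. 2 * norm (F (z, u z0) - F (z0, u z0))) \<longlongrightarrow> 0) (nhds z0)"
    by (intro tendsto_mult_right_zero tendsto_norm_zero)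
  have "((\<lambda>z. u z - u z0) \<longlongrightarrow> 0) (nhds z0)"
  proof (rule Lim_null_comparison[OF _ lim])
    show "\<forall>\<^sub>F z in nhds z0. norm (u z - u z0) \<le> 2 * norm (F (z, u z0) - F (z0, u z0))"
      using ev
    proof eventually_elim
      case (elim z)
      have "norm (u z - u z0) = norm ((F (z, u z) - F (z, u z0)) + (F (z, u z0) - F (z0, u z0)))"
        using elim u0 by simp
      also have "\<dots> \<le> norm (u z - u z0) / 2 + norm (F (z, u z0) - F (z0, u z0))"
        using elim norm_triangle_ineq by (metis (no_types, lifting) add_le_cancel_right order_trans)
      finally show ?case by simp
    qed
  qed
  then show ?thesis
    using LIM_zero_cancel by (auto simp: isCont_iff_nhds)
qed

text \<open>Here \<open>u\<close> is given and only its regularity is in question. The error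
  \<open>a = u z - u z0 - D (z - z0)\<close> makes \<open>a - F' (0, a)\<close> small of first order
  in the increments of \<open>z\<close> and \<open>u\<close>. As \<open>F' (0, _)\<close> has norm
  at most 1/2, so is \<open>a\<close> itself, and the increment of \<open>u\<close> is in turn
  bounded by \<open>norm a + C * norm (z - z0)\<close>.\<close>

lemma implicit_has_derivative:
  fixes F :: "'e::real_normed_vector \<times> 'z::banach \<Rightarrow> 'z"
  assumes ev: "\<forall>\<^sub>F z in nhds z0. u z = F (z, u z) \<and> norm (F (z, u z) - F (z, u z0)) \<le> norm (u z - u z0) / 2"
    and F: "(F has_derivative F') (at (z0, u z0))"
    and half: "\<And>w. norm (F' (0, w)) \<le> norm w / 2"
  obtains D where "(u has_derivative D) (at z0)" "\<And>v. D v = F' (v, D v)"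
proof -
  interpret F': bounded_linear F' using F has_derivative_bounded_linear by blast
  obtain D where D: "bounded_linear D" "\<And>v. D v = F' (v, D v)"
    using contraction_linear_solve_operator[OF F'.bounded_linear_axioms half] by blast
  interpret D: bounded_linear D by fact
  have u0: "u z0 = F (z0, u z0)" using eventually_nhds_x_imp_x[OF ev] by simp
  have "isCont F (z0, u z0)" using F has_derivative_continuous by blast
  then have "isCont (\<lambda>z. F (z, u z0)) z0"
    by (intro isCont_o2[where g = F and f = "\<lambda>z. (z, u z0)"] continuous_intros) auto
  then have ucont: "isCont u z0" using implicit_continuous ev by blast
  then have tend: "((\<lambda>z. (z, u z)) \<longlongrightarrow> (z0, u z0)) (nhds z0)"
    by (intro tendsto_Pair) (auto simp: isCont_iff_nhds filterlim_ident)
  obtain C where C: "C > 0" "\<And>v. norm (D v) \<le> norm v * C" using D.pos_bounded by blast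
  have "(u has_derivative D) (at z0)"
    unfolding has_derivative_at_alt
  proof (intro conjI D(1) allI impI)
    fix e :: real assume e: "e > 0"
    \<comment> \<open>The bound 1/4 lets \<open>\<eta> * norm a\<close> be absorbed by the
      \<open>norm a / 2\<close> on the left, which leaves a factor 4; the second bound makes
      \<open>4 * \<eta> * (1 + C) \<le> e\<close>.\<close>
    define \<eta> where "\<eta> = min (1/4) (e / (4 * (1 + C)))"
    have \<eta>: "\<eta> > 0" "\<eta> \<le> 1/4" using e C(1) by (auto simp: \<eta>_def min_def)
    have "\<eta> * (1 + C) \<le> e / (4 * (1 + C)) * (1 + C)"
      using C(1) by (intro mult_right_mono) (auto simp: \<eta>_def)
    also have "\<dots> = e / 4" using C(1) by (simp add: divide_simps)
    finally have \<eta>3: "4 * (\<eta> * (1 + C)) \<le> e" by simp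
    obtain d where d: "d > 0" "\<And>y. norm (y - (z0, u z0)) < d \<Longrightarrow>
        norm (F y - F (z0, u z0) - F' (y - (z0, u z0))) \<le> \<eta> * norm (y - (z0, u z0))"
      using F \<eta>(1) unfolding has_derivative_at_alt by blast
    have "\<forall>\<^sub>F z in nhds z0. dist (z, u z) (z0, u z0) < d" using tendstoD[OF tend d(1)] .
    with ev have "\<forall>\<^sub>F z in nhds z0. norm (u z - u z0 - D (z - z0)) \<le> e * norm (z - z0)"
    proof eventually_elim
      case (elim z)
      define a where "a = u z - u z0 - D (z - z0)"
      have "norm ((z, u z) - (z0, u z0)) < d" using elim(2) by (simp only: dist_norm)
      from d(2)[OF this] elim(1) u0
      have 1: "norm (u z - u z0 - F' (z - z0, u z - u z0)) \<le> \<eta> * norm (z - z0, u z - u z0)"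
        by simp
      have "F' (z - z0, u z - u z0) = F' (z - z0, D (z - z0)) + F' (0, a)"
        using F'.add[of "(z - z0, D (z - z0))" "(0, a)"] by (simp add: a_def)
      then have "u z - u z0 - F' (z - z0, u z - u z0) = a - F' (0, a)"
        using D(2)[of "z - z0"] by (simp add: a_def)
      then have "norm a - norm (F' (0, a)) \<le> \<eta> * norm (z - z0, u z - u z0)"
        using 1 norm_triangle_ineq2[of a "F' (0, a)"] by simp
      moreover have "norm (z - z0, u z - u z0) \<le> norm (z - z0) + norm (u z - u z0)"
        by (rule norm_Pair_le)
      moreover have "norm (u z - u z0) \<le> norm a + norm (z - z0) * C"
        using norm_triangle_ineq[of a "D (z - z0)"] C(2)[of "z - z0"] by (simp add: a_def)
      ultimately have "norm a - norm a / 2 \<le> \<eta> * (norm (z - z0) + (norm a + norm (z - z0) * C))"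
        using half[of a] \<eta>(1) by (smt (verit, best) mult_left_mono)
      also have "\<dots> = \<eta> * norm a + \<eta> * (1 + C) * norm (z - z0)" by (simp add: algebra_simps)
      also have "\<dots> \<le> norm a / 4 + \<eta> * (1 + C) * norm (z - z0)"
        using mult_right_mono[OF \<eta>(2), of "norm a"] by simp
      finally have "norm a \<le> 4 * (\<eta> * (1 + C)) * norm (z - z0)" by simp
      also have "\<dots> \<le> e * norm (z - z0)" using \<eta>3 by (intro mult_right_mono) auto
      finally show ?case by (simp add: a_def)
    qed
    then show "\<exists>d>0. \<forall>y. norm (y - z0) < d \<longrightarrow> norm (u y - u z0 - D (y - z0)) \<le> e * norm (y - z0)"
      by (simp add: eventually_nhds_metric dist_norm)
  qed
  then show ?thesis using that D(2) by blast
qed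


section \<open>Smooth solutions of a quadratic equation\<close>

text \<open>The integral equation of a flow in abstract form: \<open>c\<close> sends an initial
  value to the constant path, and \<open>\<beta>\<close> integrates a bilinear vector field along
  two paths.\<close>

locale quadratic_fixpoint =
  fixes \<beta> :: "'z::banach \<Rightarrow> 'z \<Rightarrow> 'z" and c :: "'e::euclidean_space \<Rightarrow> 'z" and K :: real
  assumes bil: "bounded_bilinear \<beta>" and \<beta>_sym: "\<beta> x y = \<beta> y x"
    and K_pos: "K > 0" and K: "norm (\<beta> x y) \<le> K * norm x * norm y"
    and lin: "bounded_linear c" and norm_c: "norm (c v) \<le> norm v"
begin

interpretation \<beta>: bounded_bilinear \<beta> by (rule bil)

interpretation c: bounded_linear c by (rule lin)

text \<open>For \<open>norm x \<le> \<rho>\<close> and times up to 2 in absolute value,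
  \<open>t \<beta>(x, _)\<close> has norm at most 1/8. This leaves room for the factors 2 that come
  from differences of squares and from linearisation.\<close>

definition \<rho> :: real where "\<rho> = 1 / (16 * K)"

text \<open>Times beyond [0,1] put the interval of an isotopy into the interior, and negative times
  provide inverse maps. Initial values below \<open>\<rho> / 2\<close> leave room for the quadratic
  term within radius \<rho>.\<close>

definition W :: "('e \<times> real) set" where "W = ball 0 (\<rho> / 2) \<times> {-2<..<2}"

lemma \<rho>_pos: "\<rho> > 0"
  using K_pos by (simp add: \<rho>_def)

lemma open_W: "open W"
  unfolding W_def by (intro open_Times) auto

lemma W_D: "z \<in> W \<Longrightarrow> norm (fst z) < \<rho> / 2" "z \<in> W \<Longrightarrow> \<bar>snd z\<bar> < 2"
  by (auto simp: W_def)

lemma \<beta>_small: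
  assumes "norm x \<le> m * \<rho>" "\<bar>t\<bar> \<le> 2" "m \<ge> 0"
  shows "norm (t *\<^sub>R \<beta> x w) \<le> m / 8 * norm w"
proof -
  have "norm (\<beta> x w) \<le> K * (m * \<rho>) * norm w"
    using K[of x w] mult_left_mono[OF assms(1), of K] K_pos
    by (smt (verit) mult_right_mono norm_ge_zero)
  also have "\<dots> = m / 16 * norm w" using K_pos by (simp add: \<rho>_def)
  finally have *: "norm (\<beta> x w) \<le> m / 16 * norm w" .
  have "\<bar>t\<bar> * norm (\<beta> x w) \<le> 2 * (m / 16 * norm w)"
    using * assms by (intro mult_mono) auto
  then show ?thesis by simp
qed

text \<open>By symmetry \<open>\<beta>(x, x) - \<beta>(y, y) = \<beta>(x + y, x - y)\<close>, and
  \<open>norm (x + y) \<le> 2 * \<rho>\<close>.\<close>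

lemma quadratic_contraction:
  assumes "norm x \<le> \<rho>" "norm y \<le> \<rho>" "\<bar>t\<bar> \<le> 2"
  shows "norm (t *\<^sub>R \<beta> x x - t *\<^sub>R \<beta> y y) \<le> norm (x - y) / 2"
proof -
  have "t *\<^sub>R \<beta> x x - t *\<^sub>R \<beta> y y = t *\<^sub>R \<beta> (x + y) (x - y)"
    by (simp add: \<beta>.add_left \<beta>.diff_right \<beta>_sym[of y x] scaleR_diff_right)
  moreover have "norm (x + y) \<le> 2 * \<rho>" using assms norm_triangle_ineq[of x y] by simp
  ultimately have "norm (t *\<^sub>R \<beta> x x - t *\<^sub>R \<beta> y y) \<le> 2 / 8 * norm (x - y)"
    using \<beta>_small[of "x + y" 2 t "x - y"] assms(3) by simp
  then show ?thesis using norm_ge_zero[of "x - y"] by linarith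
qed

lemma ex1_sol:
  assumes "z \<in> W"
  shows "\<exists>!x. norm x \<le> \<rho> \<and> x = c (fst z) + snd z *\<^sub>R \<beta> x x"
proof -
  have "\<exists>!x\<in>cball 0 \<rho>. c (fst z) + snd z *\<^sub>R \<beta> x x = x"
  proof (rule Banach_fix[of _ "1/2"])
    show "complete (cball (0::'z) \<rho>)" by (simp add: complete_eq_closed)
    show "cball (0::'z) \<rho> \<noteq> {}" using \<rho>_pos by auto
    show "(\<lambda>x. c (fst z) + snd z *\<^sub>R \<beta> x x) ` cball 0 \<rho> \<subseteq> cball 0 \<rho>"
    proof clarsimp
      fix x :: 'z assume x: "norm x \<le> \<rho>"
      have "norm (c (fst z) + snd z *\<^sub>R \<beta> x x) \<le> norm (c (fst z)) + norm (snd z *\<^sub>R \<beta> x x)"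
        by (rule norm_triangle_ineq)
      also have "\<dots> \<le> \<rho> / 2 + 1 / 8 * norm x"
        using W_D[OF assms] norm_c[of "fst z"] \<beta>_small[of x 1 "snd z" x] x by (intro add_mono) auto
      also have "\<dots> \<le> \<rho>" using x \<rho>_pos by simp
      finally show "norm (c (fst z) + snd z *\<^sub>R \<beta> x x) \<le> \<rho>" .
    qed
    show "dist (c (fst z) + snd z *\<^sub>R \<beta> x x) (c (fst z) + snd z *\<^sub>R \<beta> y y) \<le> 1 / 2 * dist x y"
      if "x \<in> cball 0 \<rho>" "y \<in> cball 0 \<rho>" for x y
      using quadratic_contraction[of x y "snd z"] that W_D[OF assms] by (simp add: dist_norm)
  qed auto
  then show ?thesis by (metis dist_0_norm mem_cball)
qed

definition sol :: "'e \<times> real \<Rightarrow> 'z" where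
  "sol z = (THE x. norm x \<le> \<rho> \<and> x = c (fst z) + snd z *\<^sub>R \<beta> x x)"

lemma sol:
  assumes "z \<in> W"
  shows "norm (sol z) \<le> \<rho>" "sol z = c (fst z) + snd z *\<^sub>R \<beta> (sol z) (sol z)"
  using theI'[OF ex1_sol[OF assms]] by (auto simp: sol_def)

lemma sol_unique:
  "z \<in> W \<Longrightarrow> norm x \<le> \<rho> \<Longrightarrow> x = c (fst z) + snd z *\<^sub>R \<beta> x x \<Longrightarrow> x = sol z"
  using ex1_sol[of z] sol[of z] by auto

text \<open>The quadratic term is at most \<open>norm (sol z) / 8\<close> and is absorbed on the
  left. Being linear in the initial value, the bound shows that flows fix the origin and controls
  their Taylor remainder.\<close>

lemma norm_sol_le:
  assumes "z \<in> W" shows "norm (sol z) \<le> 2 * norm (fst z)"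
proof -
  have "norm (sol z) \<le> norm (c (fst z)) + norm (snd z *\<^sub>R \<beta> (sol z) (sol z))"
    using sol(2)[OF assms] norm_triangle_ineq by metis
  then show ?thesis
    using \<beta>_small[of "sol z" 1 "snd z" "sol z"] sol(1)[OF assms] W_D(2)[OF assms] norm_c[of "fst z"] norm_ge_zero[of "fst z"]
    by linarith
qed

lemma linear_part:
  assumes "z \<in> W"
  shows "bounded_linear (\<lambda>w. (2 * snd z) *\<^sub>R \<beta> (sol z) w)"
    and "norm ((2 * snd z) *\<^sub>R \<beta> (sol z) w) \<le> norm w / 2"
proof -
  show "bounded_linear (\<lambda>w. (2 * snd z) *\<^sub>R \<beta> (sol z) w)"
    by (intro bounded_linear_const_scaleR \<beta>.bounded_linear_right)
  have "norm (2 *\<^sub>R sol z) \<le> 2 * \<rho>" using sol(1)[OF assms] by simp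
  from \<beta>_small[OF this, of "snd z" w] W_D(2)[OF assms]
  have "norm (snd z *\<^sub>R \<beta> (2 *\<^sub>R sol z) w) \<le> 2 / 8 * norm w" by simp
  moreover have "snd z *\<^sub>R \<beta> (2 *\<^sub>R sol z) w = (2 * snd z) *\<^sub>R \<beta> (sol z) w"
    by (simp add: \<beta>.scaleR_left mult.commute)
  ultimately have "norm ((2 * snd z) *\<^sub>R \<beta> (sol z) w) \<le> 2 / 8 * norm w" by metis
  then show "norm ((2 * snd z) *\<^sub>R \<beta> (sol z) w) \<le> norm w / 2"
    using norm_ge_zero[of w] by linarith
qed

text \<open>The resolvent \<open>(1 - 2 t \<beta>(sol z, _))^-1\<close> of the linearised equation,
  applied to \<open>h\<close>.\<close>

definition lsol :: "'e \<times> real \<Rightarrow> 'z \<Rightarrow> 'z" where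
  "lsol z h = (THE w. w = h + (2 * snd z) *\<^sub>R \<beta> (sol z) w)"

lemma lsol:
  assumes "z \<in> W"
  shows "lsol z h = h + (2 * snd z) *\<^sub>R \<beta> (sol z) (lsol z h)"
  unfolding lsol_def using theI'[OF contraction_linear_solve(1)[OF linear_part[OF assms]]] .

lemma lsol_unique:
  assumes "z \<in> W" "w = h + (2 * snd z) *\<^sub>R \<beta> (sol z) w"
  shows "w = lsol z h"
  using contraction_linear_solve(1)[OF linear_part[OF assms(1)], of h] assms(2) lsol[OF assms(1), of h]
  by auto

lemma lsol_add: "z \<in> W \<Longrightarrow> lsol z (h + h') = lsol z h + lsol z h'"
  by (rule lsol_unique[symmetric], assumption, subst (1 2) lsol)
    (auto simp: \<beta>.add_right scaleR_add_right)

lemma lsol_scaleR: "z \<in> W \<Longrightarrow> lsol z (a *\<^sub>R h) = a *\<^sub>R lsol z h"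
  by (rule lsol_unique[symmetric], assumption, subst (1) lsol)
    (auto simp: \<beta>.scaleR_right scaleR_add_right)

lemma eventually_W: "z \<in> W \<Longrightarrow> \<forall>\<^sub>F z' in nhds z. z' \<in> W"
  using open_W eventually_nhds by blast

text \<open>Differentiating the fixed-point equation in direction \<open>(v, \<tau>)\<close> gives
  \<open>x' = c v + \<tau> \<beta>(x, x) + 2 t \<beta>(x, x')\<close>, which \<open>lsol\<close>
  solves.\<close>

lemma sol_has_derivative:
  assumes z: "z \<in> W"
  shows "(sol has_derivative (\<lambda>v. lsol z (c (fst v) + snd v *\<^sub>R \<beta> (sol z) (sol z)))) (at z)"
proof -
  define F where "F = (\<lambda>(z, u). c (fst z) + snd z *\<^sub>R \<beta> u u)"
  define F' where "F' = (\<lambda>(v, w). c (fst v) + (snd v *\<^sub>R \<beta> (sol z) (sol z)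
    + snd z *\<^sub>R (\<beta> (sol z) w + \<beta> w (sol z))))"
  have *: "(F has_derivative F') (at (z, sol z))"
    unfolding F_def F'_def split_beta
    by (auto intro!: derivative_eq_intros \<beta>.FDERIV c.has_derivative[THEN has_derivative_eq_rhs]
        simp: fun_eq_iff algebra_simps)
  obtain D where D: "(sol has_derivative D) (at z)" "\<And>v. D v = F' (v, D v)"
  proof (rule implicit_has_derivative[where u = sol and ?z0.0 = z and F = F and F' = F', OF _ *])
    show "\<forall>\<^sub>F z' in nhds z. sol z' = F (z', sol z')
      \<and> norm (F (z', sol z') - F (z', sol z)) \<le> norm (sol z' - sol z) / 2"
      using eventually_W[OF z]
    proof eventually_elim
      case (elim z')
      have "F (z', sol z') - F (z', sol z) = snd z' *\<^sub>R \<beta> (sol z') (sol z') - snd z' *\<^sub>R \<beta> (sol z) (sol z)"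
        by (simp add: F_def)
      then have "norm (F (z', sol z') - F (z', sol z)) \<le> norm (sol z' - sol z) / 2"
        using quadratic_contraction[OF sol(1)[OF elim] sol(1)[OF z], of "snd z'"] W_D(2)[OF elim]
        by simp
      moreover have "sol z' = F (z', sol z')" using sol(2)[OF elim] by (simp add: F_def)
      ultimately show ?case by blast
    qed
    show "norm (F' (0, w)) \<le> norm w / 2" for w
      using linear_part(2)[OF z, of w] by (simp add: F'_def \<beta>_sym[of w] scaleR_2[symmetric] mult.commute)
  qed blast
  have "D v = lsol z (c (fst v) + snd v *\<^sub>R \<beta> (sol z) (sol z))" for v
    by (rule lsol_unique[OF z], subst D(2)) (simp add: F'_def \<beta>_sym[of "D v"] scaleR_2[symmetric] mult.commute)
  then show ?thesis using D(1) by (metis (no_types, lifting) ext)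
qed

lemma lsol_implicit:
  assumes z: "z \<in> W"
  shows "\<forall>\<^sub>F z' in nhds z. lsol z' (h z') = h z' + (2 * snd z') *\<^sub>R \<beta> (sol z') (lsol z' (h z')) \<and>
    norm ((h z' + (2 * snd z') *\<^sub>R \<beta> (sol z') (lsol z' (h z'))) - (h z' + (2 * snd z') *\<^sub>R \<beta> (sol z') (lsol z (h z))))
      \<le> norm (lsol z' (h z') - lsol z (h z)) / 2"
  using eventually_W[OF z]
proof eventually_elim
  case (elim z')
  have "(h z' + (2 * snd z') *\<^sub>R \<beta> (sol z') (lsol z' (h z'))) - (h z' + (2 * snd z') *\<^sub>R \<beta> (sol z') (lsol z (h z)))
      = (2 * snd z') *\<^sub>R \<beta> (sol z') (lsol z' (h z') - lsol z (h z))"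
    by (simp add: \<beta>.diff_right scaleR_diff_right)
  then show ?case
    using lsol[OF elim, of "h z'"] linear_part(2)[OF elim, of "lsol z' (h z') - lsol z (h z)"]
    by simp
qed

text \<open>Now the coefficient \<open>sol z\<close> of the linear equation varies as well; the new
  right-hand side involves only the derivatives of \<open>h\<close> and \<open>sol\<close> and the
  solution itself.\<close>

lemma lsol_has_derivative:
  assumes z: "z \<in> W" and h: "(h has_derivative h') (at z)" and s: "(sol has_derivative s') (at z)"
  shows "((\<lambda>z. lsol z (h z)) has_derivative
    (\<lambda>v. lsol z (h' v + ((2 * snd v) *\<^sub>R \<beta> (sol z) (lsol z (h z)) + (2 * snd z) *\<^sub>R \<beta> (s' v) (lsol z (h z))))))
    (at z)"
proof -
  let ?w = "lsol z (h z)"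
  define F where "F = (\<lambda>(z, u). h z + (2 * snd z) *\<^sub>R \<beta> (sol z) u)"
  define F' where "F' = (\<lambda>(v, w). h' v + ((2 * snd v) *\<^sub>R \<beta> (sol z) ?w
    + (2 * snd z) *\<^sub>R (\<beta> (sol z) w + \<beta> (s' v) ?w)))"
  have h1: "((\<lambda>p. h (fst p)) has_derivative (\<lambda>p. h' (fst p))) (at (z, ?w))"
    using has_derivative_compose[of fst fst "(z, ?w)" UNIV h h'] h
      bounded_linear_imp_has_derivative[OF bounded_linear_fst] by auto
  have s1: "((\<lambda>p. sol (fst p)) has_derivative (\<lambda>p. s' (fst p))) (at (z, ?w))"
    using has_derivative_compose[of fst fst "(z, ?w)" UNIV sol s'] s
      bounded_linear_imp_has_derivative[OF bounded_linear_fst] by auto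
  have t1: "((\<lambda>p. 2 * snd (fst p)) has_derivative (\<lambda>p. 2 * snd (fst p))) (at (z, ?w))"
    by (intro bounded_linear_imp_has_derivative bounded_linear_const_mult
        bounded_linear_compose[OF bounded_linear_snd] bounded_linear_fst)
  have *: "(F has_derivative F') (at (z, ?w))"
    unfolding F_def F'_def split_beta
    using has_derivative_add[OF h1 has_derivative_scaleR[OF t1 \<beta>.FDERIV[OF s1
          bounded_linear_imp_has_derivative[OF bounded_linear_snd]]]]
    by (simp add: add.commute)
  obtain D where D: "((\<lambda>z. lsol z (h z)) has_derivative D) (at z)" "\<And>v. D v = F' (v, D v)"
  proof (rule implicit_has_derivative[where u = "\<lambda>z. lsol z (h z)" and ?z0.0 = z and F = F and F' = F', OF _ *])
    show "\<forall>\<^sub>F z' in nhds z. lsol z' (h z') = F (z', lsol z' (h z'))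
      \<and> norm (F (z', lsol z' (h z')) - F (z', ?w)) \<le> norm (lsol z' (h z') - ?w) / 2"
      using lsol_implicit[OF z, of h] by (simp add: F_def)
    have "linear h'" "linear s'" using h s has_derivative_linear by auto
    then show "norm (F' (0, w)) \<le> norm w / 2" for w
      using linear_part(2)[OF z, of w] by (simp add: F'_def linear_0 \<beta>.zero_left)
  qed blast
  have "D v = lsol z (h' v + ((2 * snd v) *\<^sub>R \<beta> (sol z) ?w + (2 * snd z) *\<^sub>R \<beta> (s' v) ?w))" for v
    by (rule lsol_unique[OF z], subst D(2)) (simp add: F'_def algebra_simps)
  then show ?thesis using D(1) by (metis (no_types, lifting) ext)
qed

text \<open>The derivatives of \<open>sol\<close> and \<open>lsol\<close> are again values of \<open>lsol\<close>, so the induction closes.\<close>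

lemma sol_lsol_Ck: "Ck_on k W sol \<and> (\<forall>h. Ck_on k W h \<longrightarrow> Ck_on k W (\<lambda>z. lsol z (h z)))"
proof (induction k)
  case 0
  have "isCont sol z" if "z \<in> W" for z
    using sol_has_derivative[OF that] has_derivative_continuous by blast
  then have s: "continuous_on W sol" by (simp add: continuous_at_imp_continuous_on)
  have "isCont (\<lambda>z. lsol z (h z)) z" if h: "continuous_on W h" and z: "z \<in> W" for h z
  proof (rule implicit_continuous[where F = "\<lambda>(z, u). h z + (2 * snd z) *\<^sub>R \<beta> (sol z) u"])
    show "isCont (\<lambda>z'. case (z', lsol z (h z)) of (z, u) \<Rightarrow> h z + (2 * snd z) *\<^sub>R \<beta> (sol z) u) z"
      using h s z open_W continuous_on_eq_continuous_at by (auto intro!: continuous_intros \<beta>.continuous)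
  qed (use lsol_implicit[OF z, of h] in simp)
  then show ?case using s by (auto simp: continuous_at_imp_continuous_on)
next
  case (Suc k)
  have s: "Ck_on k W sol" and l: "\<And>h. Ck_on k W h \<Longrightarrow> Ck_on k W (\<lambda>z. lsol z (h z))"
    using Suc by auto
  have s': "Ck_on k W (\<lambda>z. lsol z (c (fst v) + snd v *\<^sub>R \<beta> (sol z) (sol z)))" for v
    by (intro l Ck_on_add Ck_on_bilinear[OF bounded_bilinear_scaleR] Ck_on_const Ck_on_bilinear[OF bil] open_W s)
  have S: "Ck_on (Suc k) W sol"
    by (rule Ck_on_SucI[OF open_W sol_has_derivative s'])
  have "Ck_on (Suc k) W (\<lambda>z. lsol z (h z))" if h: "Ck_on (Suc k) W h" for h
  proof (rule Ck_on_SucI[OF open_W])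
    let ?D = "\<lambda>f x v. frechet_derivative f (at x) v"
    show "((\<lambda>z. lsol z (h z)) has_derivative
      (\<lambda>v. lsol z (?D h z v + ((2 * snd v) *\<^sub>R \<beta> (sol z) (lsol z (h z)) + (2 * snd z) *\<^sub>R \<beta> (?D sol z v) (lsol z (h z))))))
      (at z)" if "z \<in> W" for z
      using lsol_has_derivative that Ck_on_SucD h S by blast
    show "Ck_on k W (\<lambda>z. lsol z (?D h z v + ((2 * snd v) *\<^sub>R \<beta> (sol z) (lsol z (h z))
      + (2 * snd z) *\<^sub>R \<beta> (?D sol z v) (lsol z (h z)))))" for v
      using h S Ck_on_Suc_imp[OF h]
      by (intro l Ck_on_add Ck_on_bilinear[OF bounded_bilinear_scaleR] Ck_on_const Ck_on_bilinear[OF bil]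
          open_W s Ck_on_linear[of "\<lambda>z. 2 * snd z"] bounded_linear_const_mult bounded_linear_snd)
        (simp_all del: split_paired_All)
  qed
  then show ?case using S by blast
qed

lemma sol_smooth: "smooth_on W sol"
  using sol_lsol_Ck by (auto simp: smooth_on_def)

end

section \<open>Flows of quadratic vector fields\<close>

instance bcontfun :: (metric_space, banach) banach ..

text \<open>Solutions on [0,1] are continued by constants, so that they lie in the Banach space
  \<open>real \<Rightarrow>\<^sub>C 'a\<close>. The cut-off commutes with
  \<open>s \<mapsto> 1 - s\<close>, which time reversal uses.\<close>

definition clamp01 :: "real \<Rightarrow> real" where "clamp01 s = max 0 (min 1 s)"

lemma clamp01: "0 \<le> clamp01 s" "clamp01 s \<le> 1" "s \<in> {0..1} \<Longrightarrow> clamp01 s = s"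
  "clamp01 (1 - s) = 1 - clamp01 s"
  by (auto simp: clamp01_def)

lemma bcontfun_primitive:
  fixes f :: "real \<Rightarrow> 'a::euclidean_space"
  assumes f: "continuous_on UNIV f" and bd: "\<And>s. norm (f s) \<le> b"
  shows "(\<lambda>s. integral {0..clamp01 s} f) \<in> bcontfun"
    and "norm (integral {0..clamp01 s} f) \<le> b"
proof -
  have int: "f integrable_on {u..v}" for u v
    using f continuous_on_subset by (intro integrable_continuous_real) blast
  have b: "0 \<le> b" using bd[of 0] norm_ge_zero order_trans by blast
  show *: "norm (integral {0..clamp01 s} f) \<le> b" for s
  proof -
    have "norm (integral {0..clamp01 s} f) \<le> b * (clamp01 s - 0)"
      using clamp01(1)[of s] f bd by (intro integral_bound) (auto intro: continuous_on_subset)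
    also have "\<dots> \<le> b" using b clamp01(1,2)[of s] by (simp add: mult_left_le)
    finally show ?thesis .
  qed
  have "continuous_on UNIV (\<lambda>s. integral {0..clamp01 s} f)"
  proof (rule continuous_on_compose2[where g = "\<lambda>s. integral {0..s} f" and t = "{0..1}"])
    show "continuous_on {0..1} (\<lambda>s. integral {0..s} f)"
      using int by (intro indefinite_integral_continuous_1)
    show "continuous_on UNIV clamp01" unfolding clamp01_def by (intro continuous_intros)
  qed (use clamp01 in auto)
  then show "(\<lambda>s. integral {0..clamp01 s} f) \<in> bcontfun"
    using * by (rule bcontfun_normI)
qed

locale quadratic_flow =
  fixes B :: "'a::euclidean_space \<Rightarrow> 'a \<Rightarrow> 'a" and K :: real
  assumes B_bil: "bounded_bilinear B" and B_sym: "B x y = B y x"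
    and B_K_pos: "K > 0" and B_K: "norm (B x y) \<le> K * norm x * norm y"
begin

interpretation B: bounded_bilinear B by (rule B_bil)

text \<open>With \<open>x = w\<close> this is the operator of Picard iteration; as a bilinear map it
  fits the quadratic fixed-point equation.\<close>

definition picard :: "(real \<Rightarrow>\<^sub>C 'a) \<Rightarrow> (real \<Rightarrow>\<^sub>C 'a) \<Rightarrow> (real \<Rightarrow>\<^sub>C 'a)" where
  "picard x w = Bcontfun (\<lambda>s. integral {0..clamp01 s} (\<lambda>\<sigma>. B (x \<sigma>) (w \<sigma>)))"

lemma continuous_B:
  fixes x w :: "real \<Rightarrow>\<^sub>C 'a"
  shows "continuous_on S (\<lambda>\<sigma>. B (apply_bcontfun x \<sigma>) (apply_bcontfun w \<sigma>))"
  by (intro B.continuous_on continuous_on_apply_bcontfun)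

lemma integrable_B:
  fixes x w :: "real \<Rightarrow>\<^sub>C 'a"
  shows "(\<lambda>\<sigma>. B (apply_bcontfun x \<sigma>) (apply_bcontfun w \<sigma>)) integrable_on {u..v}"
  by (intro integrable_continuous_real continuous_B)

lemma bound_B:
  fixes x w :: "real \<Rightarrow>\<^sub>C 'a"
  shows "norm (B (apply_bcontfun x \<sigma>) (apply_bcontfun w \<sigma>)) \<le> K * norm x * norm w"
proof -
  have "norm (B (apply_bcontfun x \<sigma>) (apply_bcontfun w \<sigma>)) \<le> K * (norm (x \<sigma>) * norm (w \<sigma>))"
    using B_K by (simp add: mult.assoc)
  also have "\<dots> \<le> K * (norm x * norm w)"
    using B_K_pos by (intro mult_left_mono mult_mono norm_bounded) auto
  finally show ?thesis by (simp add: mult.assoc)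
qed

lemma picard_apply: "apply_bcontfun (picard x w) s = integral {0..clamp01 s} (\<lambda>\<sigma>. B (x \<sigma>) (w \<sigma>))"
  unfolding picard_def
  by (subst Bcontfun_inverse) (auto intro: bcontfun_primitive(1)[OF continuous_B bound_B])

lemma norm_picard: "norm (picard x w) \<le> K * norm x * norm w"
  by (rule norm_bound) (simp add: picard_apply bcontfun_primitive(2)[OF continuous_B bound_B])

sublocale quadratic_fixpoint picard const_bcontfun K
proof (rule quadratic_fixpoint.intro)
  show "bounded_bilinear picard"
  proof (rule bounded_bilinear.intro)
    show "picard (a + a') b = picard a b + picard a' b" for a a' b
      by (rule bcontfun_eqI) (simp add: picard_apply B.add_left integral_add integrable_B)
    show "picard a (b + b') = picard a b + picard a b'" for a b b'
      by (rule bcontfun_eqI) (simp add: picard_apply B.add_right integral_add integrable_B)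
    show "picard (r *\<^sub>R a) b = r *\<^sub>R picard a b" for r a b
      by (rule bcontfun_eqI) (simp add: picard_apply B.scaleR_left)
    show "picard a (r *\<^sub>R b) = r *\<^sub>R picard a b" for r a b
      by (rule bcontfun_eqI) (simp add: picard_apply B.scaleR_right)
    show "\<exists>K. \<forall>a b. norm (picard a b) \<le> norm a * norm b * K"
      by (rule exI[of _ K]) (use norm_picard in \<open>simp add: mult_ac\<close>)
  qed
  show "picard x y = picard y x" for x y
    by (rule bcontfun_eqI) (simp add: picard_apply B_sym)
  show c: "norm (const_bcontfun v :: real \<Rightarrow>\<^sub>C 'a) \<le> norm v" for v :: 'a
    by (rule norm_bound) simp
  show "bounded_linear (const_bcontfun :: 'a \<Rightarrow> real \<Rightarrow>\<^sub>C 'a)"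
    by (rule bounded_linear_intro[where K = 1])
      (auto intro!: bcontfun_eqI simp: c)
qed (use B_K_pos norm_picard in auto)

text \<open>Two paths on the right cover both the flow itself (\<open>p = x = w\<close>) and its
  first variation (\<open>x = sol z\<close> and \<open>p = w\<close>).\<close>

lemma path_equation:
  fixes p x w :: "real \<Rightarrow>\<^sub>C 'a"
  assumes p: "p = const_bcontfun v + t *\<^sub>R picard x w"
  shows "apply_bcontfun p 0 = v"
    and "s \<in> {0..1} \<Longrightarrow> (apply_bcontfun p has_vector_derivative t *\<^sub>R B (x s) (w s)) (at s within {0..1})"
proof -
  have ap: "apply_bcontfun p s = v + t *\<^sub>R integral {0..clamp01 s} (\<lambda>\<sigma>. B (x \<sigma>) (w \<sigma>))" for s
    using p by (simp add: picard_apply)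
  show "apply_bcontfun p 0 = v" using ap[of 0] by (simp add: clamp01_def)
  assume s: "s \<in> {0..1}"
  have "((\<lambda>s. v + t *\<^sub>R integral {0..s} (\<lambda>\<sigma>. B (x \<sigma>) (w \<sigma>))) has_vector_derivative t *\<^sub>R B (x s) (w s))
      (at s within {0..1})"
    using integral_has_vector_derivative[OF continuous_B s]
    by (auto intro!: derivative_eq_intros)
  then show "(apply_bcontfun p has_vector_derivative t *\<^sub>R B (x s) (w s)) (at s within {0..1})"
    by (rule has_vector_derivative_transform[OF s, rotated]) (simp add: ap clamp01)
qed

lemma flow_path:
  assumes "z \<in> W"
  shows "apply_bcontfun (sol z) 0 = fst z"
    and "s \<in> {0..1} \<Longrightarrow>
      (sol z has_vector_derivative snd z *\<^sub>R B (sol z s) (sol z s)) (at s within {0..1})"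
  using path_equation[OF sol(2)[OF assms]] .

lemma variation_path:
  assumes "z \<in> W"
  shows "apply_bcontfun (lsol z (const_bcontfun v)) 0 = v"
    and "s \<in> {0..1} \<Longrightarrow> (lsol z (const_bcontfun v) has_vector_derivative
      (2 * snd z) *\<^sub>R B (sol z s) (lsol z (const_bcontfun v) s)) (at s within {0..1})"
  using path_equation[OF lsol[OF assms]] .

text \<open>Time \<open>t\<close> is absorbed into the vector field: \<open>flow (y, t)\<close> is the value at time \<open>1\<close> of the solution of
  \<open>x' = t B(x, x)\<close>.\<close>

definition flow :: "'a \<times> real \<Rightarrow> 'a" where "flow z = apply_bcontfun (sol z) 1"

lemma bounded_linear_apply_bcontfun: "bounded_linear (\<lambda>x :: real \<Rightarrow>\<^sub>C 'a. apply_bcontfun x s)"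
  by (rule bounded_linear_intro[where K = 1]) (auto intro: norm_bounded)

lemma flow_smooth: "smooth_on W flow"
  unfolding flow_def using smooth_on_compose_linear[OF bounded_linear_apply_bcontfun open_W sol_smooth] .

lemma flow_has_derivative:
  assumes "z \<in> W"
  shows "(flow has_derivative (\<lambda>v. lsol z (const_bcontfun (fst v) + snd v *\<^sub>R picard (sol z) (sol z)) 1)) (at z)"
  unfolding flow_def
  using bounded_linear.has_derivative[OF bounded_linear_apply_bcontfun sol_has_derivative[OF assms]] .

lemma flow_space_derivative:
  assumes "(y, t) \<in> W"
  shows "((\<lambda>y. flow (y, t)) has_derivative (\<lambda>v. lsol (y, t) (const_bcontfun v) 1)) (at y)"
proof -
  have "((\<lambda>y. (y, t)) has_derivative (\<lambda>v. (v, 0))) (at y)" by (auto intro!: derivative_eq_intros)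
  from has_derivative_compose[OF this flow_has_derivative[OF assms]] show ?thesis by simp
qed

lemma flow_0: "flow (0, t) = 0" if "\<bar>t\<bar> < 2"
proof -
  have "(0, t) \<in> W" using that \<rho>_pos by (auto simp: W_def)
  from norm_sol_le[OF this] show ?thesis by (simp add: flow_def)
qed

lemma flow_id: "flow (y, 0) = y" if "(y, 0) \<in> W"
  using sol(2)[OF that] by (simp add: flow_def)

text \<open>The reversed path solves the equation for \<open>- t\<close>, so uniqueness identifies
  it with \<open>sol\<close>. The inverse of a time map is thus another time map and as smooth as
  the flow.\<close>

lemma flow_reverse:
  assumes z: "(y, t) \<in> W" and z': "(flow (y, t), - t) \<in> W"
  shows "flow (flow (y, t), - t) = y"
proof -
  let ?x = "sol (y, t)"
  have "(\<lambda>s. ?x (1 - s)) \<in> bcontfun"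
  proof (rule bcontfun_normI)
    show "continuous_on UNIV (\<lambda>s. ?x (1 - s))"
      by (rule continuous_on_compose2[OF continuous_on_apply_bcontfun[of UNIV]])
        (auto intro: continuous_intros)
  qed (rule norm_bounded)
  then obtain r :: "real \<Rightarrow>\<^sub>C 'a" where r: "\<And>s. apply_bcontfun r s = ?x (1 - s)"
    by (metis Bcontfun_inverse)
  have d: "(r has_vector_derivative - t *\<^sub>R B (r s) (r s)) (at s within {0..1})" if "s \<in> {0..1}" for s
  proof -
    have im: "(\<lambda>s. 1 - s) ` {0..1} = {0..1::real}"
      by (auto simp: image_iff intro: bexI[of _ "1 - x" for x])
    have 1: "((\<lambda>s. 1 - s :: real) has_vector_derivative - 1) (at s within {0..1})"
      by (auto intro!: derivative_eq_intros)
    have 2: "(?x has_vector_derivative t *\<^sub>R B (?x (1 - s)) (?x (1 - s))) (at (1 - s) within {0..1})"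
      using flow_path(2)[OF z, of "1 - s"] that by simp
    have "apply_bcontfun r = ?x \<circ> (\<lambda>s. 1 - s)" by (auto simp: r)
    then show ?thesis using vector_diff_chain_within[OF 1, of ?x] 2 by (simp add: im r)
  qed
  have "r = const_bcontfun (flow (y, t)) + (- t) *\<^sub>R picard r r"
  proof (rule bcontfun_eqI)
    fix s
    let ?s = "clamp01 s"
    have "((\<lambda>\<sigma>. - t *\<^sub>R B (r \<sigma>) (r \<sigma>)) has_integral r ?s - r 0) {0..?s}"
    proof (rule fundamental_theorem_of_calculus[OF clamp01(1)])
      fix \<sigma> assume "\<sigma> \<in> {0..?s}"
      then have "\<sigma> \<in> {0..1}" using clamp01(2)[of s] by auto
      from has_vector_derivative_within_subset[OF d[OF this]]
      show "(r has_vector_derivative - t *\<^sub>R B (r \<sigma>) (r \<sigma>)) (at \<sigma> within {0..?s})"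
        using clamp01(2)[of s] by auto
    qed
    moreover have "((\<lambda>\<sigma>. - t *\<^sub>R B (r \<sigma>) (r \<sigma>)) has_integral
        - t *\<^sub>R integral {0..?s} (\<lambda>\<sigma>. B (r \<sigma>) (r \<sigma>))) {0..?s}"
      by (intro has_integral_cmul integrable_integral integrable_B)
    ultimately have "r ?s - r 0 = - t *\<^sub>R integral {0..?s} (\<lambda>\<sigma>. B (r \<sigma>) (r \<sigma>))"
      by (rule has_integral_unique)
    \<comment> \<open>Outside [0,1] the solution is constant, hence so is its reversal; this makes
      \<open>r\<close> a fixed point on the whole line.\<close>
    moreover have "r s = r ?s"
    proof -
      have "?x s = ?x (clamp01 s)" for s
        using arg_cong[OF sol(2)[OF z], of "\<lambda>x. apply_bcontfun x s"]
          arg_cong[OF sol(2)[OF z], of "\<lambda>x. apply_bcontfun x (clamp01 s)"]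
        by (simp add: picard_apply clamp01)
      then show ?thesis unfolding r clamp01(4)[symmetric] .
    qed
    ultimately show "apply_bcontfun r s = apply_bcontfun (const_bcontfun (flow (y, t)) + (- t) *\<^sub>R picard r r) s"
      by (simp add: picard_apply r flow_def algebra_simps)
  qed
  moreover have "norm r \<le> \<rho>"
    by (rule norm_bound) (use sol(1)[OF z] norm_bounded[of ?x] order_trans in \<open>auto simp: r\<close>)
  ultimately have "r = sol (flow (y, t), - t)" using sol_unique[OF z'] by simp
  then show ?thesis
    using r[of 1] flow_path(1)[OF z] by (simp add: flow_def)
qed

text \<open>Two Picard steps. The solution differs from the constant path by
  \<open>O(|y|^2)\<close>, hence \<open>picard (x + c) (x - c)\<close> is \<open>O(|y|^3)\<close>.
  The constant is \<open>3 * 4\<close>, both factors from \<open>norm x \<le> 2 * norm y\<close>; at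
  time 1 the integral along the constant path is \<open>B y y\<close>.\<close>

lemma flow_second_order:
  assumes z: "(y, 1) \<in> W"
  shows "norm (flow (y, 1) - (y + B y y)) \<le> 12 * K\<^sup>2 * norm y ^ 3"
proof -
  let ?x = "sol (y, 1)" and ?c = "const_bcontfun y :: real \<Rightarrow>\<^sub>C 'a"
  interpret p: bounded_bilinear picard by (rule bil)
  have x: "?x = ?c + picard ?x ?x" using sol(2)[OF z] by simp
  have nx: "norm ?x \<le> 2 * norm y" using norm_sol_le[OF z] by simp
  have "norm (?x - ?c) \<le> K * norm ?x * norm ?x" using x norm_picard by (metis add_diff_cancel_left')
  also have "\<dots> \<le> K * (2 * norm y) * (2 * norm y)"
    using nx B_K_pos by (intro mult_mono) auto
  finally have 1: "norm (?x - ?c) \<le> 4 * K * (norm y)\<^sup>2" by (simp add: power2_eq_square)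
  have 2: "norm (?x + ?c) \<le> 3 * norm y"
    using norm_triangle_ineq[of ?x ?c] nx norm_c[of y] by simp
  have "?x - ?c - picard ?c ?c = picard ?x ?x - picard ?c ?c" using x by (metis add_diff_cancel_left')
  also have "\<dots> = picard (?x + ?c) (?x - ?c)"
    by (simp add: p.add_left p.diff_right \<beta>_sym[of ?c ?x])
  finally have "norm (?x - ?c - picard ?c ?c) \<le> K * norm (?x + ?c) * norm (?x - ?c)"
    using norm_picard by metis
  also have "\<dots> \<le> K * (3 * norm y) * (4 * K * (norm y)\<^sup>2)"
    using 1 2 B_K_pos by (intro mult_mono) auto
  also have "\<dots> = 12 * K\<^sup>2 * norm y ^ 3" by (simp add: power2_eq_square power3_eq_cube)
  finally have "norm ((?x - ?c - picard ?c ?c) 1) \<le> 12 * K\<^sup>2 * norm y ^ 3"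
    using norm_bounded order_trans by blast
  moreover have "(?x - ?c - picard ?c ?c) 1 = flow (y, 1) - (y + B y y)"
    by (simp add: flow_def picard_apply clamp01)
  ultimately show ?thesis by metis
qed

end

section \<open>The tangent cone of a linear group\<close>

lemma bounded_bilinear_matrix_mult:
  "bounded_bilinear ((**) :: real^'n^'m \<Rightarrow> real^'k^'n \<Rightarrow> real^'k^'m)"
proof -
  have "bilinear ((**) :: real^'n^'m \<Rightarrow> real^'k^'n \<Rightarrow> real^'k^'m)"
    unfolding bilinear_def
    by (auto intro!: linearI simp: matrix_matrix_mult_def vec_eq_iff algebra_simps sum.distrib sum_distrib_left)
  then show ?thesis by (simp add: bilinear_conv_bounded_bilinear)
qed

lemma bounded_bilinear_matrix_vector:
  "bounded_bilinear ((*v) :: real^'n^'m \<Rightarrow> real^'n \<Rightarrow> real^'m)"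
proof -
  have "bilinear ((*v) :: real^'n^'m \<Rightarrow> real^'n \<Rightarrow> real^'m)"
    unfolding bilinear_def
    by (auto intro!: linearI simp: matrix_vector_mult_def vec_eq_iff algebra_simps sum.distrib sum_distrib_left)
  then show ?thesis by (simp add: bilinear_conv_bounded_bilinear)
qed

interpretation mm: bounded_bilinear "(**) :: real^'n^'m \<Rightarrow> real^'k^'n \<Rightarrow> real^'k^'m"
  by (rule bounded_bilinear_matrix_mult)

interpretation mv: bounded_bilinear "(*v) :: real^'n^'m \<Rightarrow> real^'n \<Rightarrow> real^'m"
  by (rule bounded_bilinear_matrix_vector)

lemma matrix_inv:
  fixes A :: "real^'n^'n"
  assumes "invertible A"
  shows "A ** matrix_inv A = mat 1" "matrix_inv A ** A = mat 1"
  using someI_ex[OF assms[unfolded invertible_def]] by (auto simp: matrix_inv_def)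

section \<open>Differential inequalities and linear equations\<close>

lemma constant_velocity:
  fixes f :: "real \<Rightarrow> 'a::euclidean_space"
  assumes "\<And>s. s \<in> {0..1} \<Longrightarrow> (f has_vector_derivative c) (at s within {0..1})" and "s \<in> {0..1}"
  shows "f s = f 0 + s *\<^sub>R c"
proof -
  have "((\<lambda>_. c) has_integral f s - f 0) {0..s}"
    using assms by (intro fundamental_theorem_of_calculus has_vector_derivative_within_subset[OF assms(1), of _ "{0..s}"]) auto
  moreover have "((\<lambda>_. c) has_integral s *\<^sub>R c) {0..s}"
    using has_integral_const_real[of c 0 s] assms(2) by simp
  ultimately have "f s - f 0 = s *\<^sub>R c" by (rule has_integral_unique)
  then show ?thesis by (simp add: algebra_simps)
qed

text \<open>Gronwall's inequality for a lower Dini derivative: from each time some step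
  \<open>h\<close> is controlled, not all small ones. The last time at which \<delta> is below an
  exponential barrier exists by closedness, and from any time before 1 the hypothesis permits a
  further step.\<close>

lemma dini_comparison:
  fixes \<delta> :: "real \<Rightarrow> real"
  assumes cont: "continuous_on {0..1} \<delta>" and 0: "\<delta> 0 \<le> 0" and L: "L \<ge> 0"
    and step: "\<And>s \<epsilon>. s \<in> {0..<1} \<Longrightarrow> \<epsilon> > 0 \<Longrightarrow> \<exists>h>0. s + h \<le> 1 \<and> \<delta> (s + h) \<le> \<delta> s + h * (L * \<delta> s + \<epsilon>)"
  shows "\<delta> 1 \<le> 0"
proof (rule field_le_epsilon)
  fix e :: real assume e: "e > 0"
  \<comment> \<open>Chosen so that the barrier \<open>b\<close> ends at \<open>e\<close>. The extra
    1 in its exponent pays for the error term, taken as \<open>\<epsilon> = \<eta>\<close>, because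
    \<open>b t \<ge> \<eta>\<close>.\<close>
  define \<eta> where "\<eta> = e / exp (L + 1)"
  define b where "b s = \<eta> * exp ((L + 1) * s)" for s
  have \<eta>: "\<eta> > 0" using e by (simp add: \<eta>_def)
  define S where "S = {s \<in> {0..1}. \<delta> s \<le> b s}"
  have "closed S"
    unfolding S_def b_def by (intro continuous_on_closed_Collect_le continuous_intros cont)
  moreover have bdd: "bdd_above S" by (rule bdd_aboveI[of _ 1]) (auto simp: S_def)
  moreover have "0 \<in> S" using 0 \<eta> by (simp add: S_def b_def)
  ultimately have t: "Sup S \<in> S" by (intro closed_contains_Sup) auto
  have "Sup S = 1"
  proof (rule ccontr)
    assume "Sup S \<noteq> 1"
    define t where "t = Sup S"
    have t: "t \<in> {0..<1}" "\<delta> t \<le> b t" using t \<open>Sup S \<noteq> 1\<close> by (auto simp: S_def t_def)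
    have "b t \<ge> \<eta> * 1" unfolding b_def using t L \<eta> by (intro mult_left_mono) auto
    then have bt: "b t \<ge> \<eta>" by simp
    obtain h where h: "h > 0" "t + h \<le> 1" "\<delta> (t + h) \<le> \<delta> t + h * (L * \<delta> t + \<eta>)"
      using step[OF t(1) \<eta>] by blast
    note h(3)
    also have "\<delta> t + h * (L * \<delta> t + \<eta>) \<le> b t + h * (L * b t + b t)"
      using t L h bt by (intro add_mono mult_left_mono) auto
    also have "\<dots> = b t * (1 + (L + 1) * h)" by (simp add: algebra_simps)
    also have "\<dots> \<le> b t * exp ((L + 1) * h)"
      using bt \<eta> exp_ge_add_one_self by (intro mult_left_mono) auto
    also have "\<dots> = b (t + h)" by (simp add: b_def algebra_simps exp_add)
    finally have "t + h \<in> S" using h t by (simp add: S_def)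
    then have "t + h \<le> t" using cSup_upper[OF _ bdd, of "t + h"] unfolding t_def by blast
    then show False using h by simp
  qed
  then have "\<delta> 1 \<le> b 1" using t by (auto simp: S_def)
  then show "\<delta> 1 \<le> 0 + e" by (simp add: b_def \<eta>_def)
qed

text \<open>An energy estimate: \<open>exp (2 c s) |J s v|^2\<close> is nondecreasing when
  \<open>c\<close> bounds the operator norms of \<open>A s\<close>, so \<open>J 1 v = 0\<close>
  forces \<open>v = 0\<close>.\<close>

lemma linear_ode_invertible:
  fixes J :: "real \<Rightarrow> real^'p^'p"
  assumes A: "\<And>s. s \<in> {0..1} \<Longrightarrow> norm (A s) \<le> a"
    and J: "\<And>s. s \<in> {0..1} \<Longrightarrow> (J has_vector_derivative A s ** J s) (at s within {0..1})"
    and J0: "J 0 = mat 1"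
  shows "invertible (J 1)"
proof -
  obtain C where C: "C > 0" "\<And>M (v :: real^'p). norm (M *v v) \<le> norm (M :: real^'p^'p) * norm v * C"
    using mv.pos_bounded by blast
  have "v = 0" if v: "J 1 *v v = 0" for v
  proof -
    define c where "c = C * a"
    define q where "q s = exp (2 * c * s) * ((J s *v v) \<bullet> (J s *v v))" for s
    have d: "((\<lambda>s. J s *v v) has_vector_derivative A s *v (J s *v v)) (at s within {0..1})"
      if "s \<in> {0..1}" for s
    proof -
      have "bounded_linear (\<lambda>M :: real^'p^'p. M *v v)" by (rule mv.bounded_linear_left)
      from bounded_linear.has_vector_derivative[OF this J[OF that]]
      show ?thesis by (simp add: matrix_vector_mul_assoc)
    qed
    have "continuous_on {0..1} (\<lambda>s. J s *v v)"
      unfolding continuous_on_eq_continuous_within by (intro ballI has_vector_derivative_continuous[OF d])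
    then have "continuous_on {0..1} q"
      unfolding q_def by (intro continuous_intros)
    moreover have "\<exists>y. DERIV q s :> y \<and> y \<ge> 0" if s: "0 < s" "s < 1" for s
    proof -
      let ?u = "J s *v v"
      have "((\<lambda>s. J s *v v) has_vector_derivative A s *v ?u) (at s)"
        using d[of s] s by (simp add: at_within_Icc_at)
      then have "((\<lambda>s. J s *v v) has_derivative (\<lambda>h. h *\<^sub>R (A s *v ?u))) (at s)"
        by (simp add: has_vector_derivative_def)
      from has_derivative_inner[OF this this]
      have "((\<lambda>s. (J s *v v) \<bullet> (J s *v v)) has_field_derivative 2 * (?u \<bullet> (A s *v ?u))) (at s)"
        unfolding has_field_derivative_def
        by (rule has_derivative_eq_rhs) (simp add: fun_eq_iff inner_commute[of "A s *v ?u" ?u])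
      then have "DERIV q s :> exp (2 * c * s) * (2 * (c * (?u \<bullet> ?u) + ?u \<bullet> (A s *v ?u)))"
        unfolding q_def by (auto intro!: derivative_eq_intros simp: algebra_simps)
      moreover have "- (?u \<bullet> (A s *v ?u)) \<le> c * (?u \<bullet> ?u)"
      proof -
        have "norm (A s) * norm ?u * C \<le> a * norm ?u * C"
          using A[of s] s C(1) by (intro mult_right_mono) auto
        then have "norm (A s *v ?u) \<le> c * norm ?u"
          using C(2)[of "A s" ?u] by (simp add: c_def mult_ac)
        then have "norm ?u * norm (A s *v ?u) \<le> norm ?u * (c * norm ?u)"
          by (intro mult_left_mono) auto
        moreover have "- (?u \<bullet> (A s *v ?u)) \<le> norm ?u * norm (A s *v ?u)"
          using Cauchy_Schwarz_ineq2[of ?u "A s *v ?u"] by (simp add: abs_le_iff)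
        ultimately show ?thesis by (simp add: dot_square_norm power2_eq_square mult_ac)
      qed
      ultimately show ?thesis by force
    qed
    ultimately have "q 0 \<le> q 1" by (rule DERIV_nonneg_imp_increasing_open[of 0 1 q, OF zero_le_one, rotated])
    then have "v \<bullet> v \<le> 0" by (simp add: q_def v J0)
    then show "v = 0" using inner_ge_zero[of v] by (metis antisym inner_eq_zero_iff)
  qed
  then show ?thesis
    unfolding invertible_left_inverse matrix_left_invertible_ker by blast
qed

section \<open>Contingent cone and invariance\<close>

text \<open>Bouligand's contingent cone at the identity: a sequence of secants suffices and no curve
  is required, so limits of directions of group elements belong to it by definition. One \<epsilon>
  bounds both the step and the relative error; \<open>tangent_coneD\<close> separates them.\<close>

definition tangent_cone :: "(real^'p^'p) set \<Rightarrow> (real^'p^'p) set" where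
  "tangent_cone G = {X. \<forall>\<epsilon>>0. \<exists>h\<in>{0<..<\<epsilon>}. \<exists>A\<in>G. norm (A - mat 1 - h *\<^sub>R X) \<le> \<epsilon> * h}"

lemma tangent_coneD:
  assumes "X \<in> tangent_cone G" "\<epsilon> > 0" "\<epsilon>' > 0"
  obtains h A where "0 < h" "h < \<epsilon>" "A \<in> G" "norm (A - mat 1 - h *\<^sub>R X) \<le> \<epsilon>' * h"
proof -
  have "min \<epsilon> \<epsilon>' > 0" using assms by simp
  then obtain h A where h: "h \<in> {0<..<min \<epsilon> \<epsilon>'}" "A \<in> G"
    "norm (A - mat 1 - h *\<^sub>R X) \<le> min \<epsilon> \<epsilon>' * h"
    using assms(1) unfolding tangent_cone_def by blast
  have "min \<epsilon> \<epsilon>' * h \<le> \<epsilon>' * h" using h(1) by (intro mult_right_mono) auto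
  with h(3) have "norm (A - mat 1 - h *\<^sub>R X) \<le> \<epsilon>' * h" by (rule order_trans)
  then show ?thesis using that[of h A] h by simp
qed

locale lin_group =
  fixes G :: "(real^'p^'p) set"
  assumes lg: "linear_lie_group G"
begin

lemma one_G: "mat 1 \<in> G" and mult_G: "A \<in> G \<Longrightarrow> B \<in> G \<Longrightarrow> A ** B \<in> G"
  and inv_G: "A \<in> G \<Longrightarrow> matrix_inv A \<in> G" and invertible_G: "A \<in> G \<Longrightarrow> invertible A"
proof -
  have "G \<subseteq> {A. invertible A}" using lg closedin_imp_subset unfolding linear_lie_group_def by blast
  then show "A \<in> G \<Longrightarrow> invertible A" by blast
qed (use lg in \<open>auto simp: linear_lie_group_def\<close>)

lemma closure_G:
  assumes "A \<in> closure G" "invertible A" shows "A \<in> G"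
proof -
  obtain T where T: "closed T" "G = {A. invertible A} \<inter> T"
    using lg unfolding linear_lie_group_def closedin_closed by blast
  then have "closure G \<subseteq> T" by (intro closure_minimal) auto
  then show ?thesis using T assms by auto
qed

lemma mult_closure_G:
  assumes "A \<in> G" "M \<in> closure G" shows "A ** M \<in> closure G"
proof -
  have "(\<lambda>M. A ** M) ` closure G \<subseteq> closure G"
  proof (rule image_closure_subset)
    show "continuous_on (closure G) ((**) A)"
      by (intro linear_continuous_on mm.bounded_linear_right)
    show "(**) A ` G \<subseteq> closure G" using mult_G assms(1) closure_subset by blast
  qed auto
  then show ?thesis using assms(2) by blast
qed

text \<open>Let \<open>M\<close> be a point of \<open>closure G\<close> nearest to
  \<open>J s\<close>. Some \<open>N \<in> G\<close> agrees with \<open>1 + h A s\<close> up to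
  \<open>o(h)\<close>, and \<open>N ** M\<close> lies in \<open>closure G\<close>, so the distance
  \<delta> obeys a Gronwall inequality along suitable steps. Nearest points exist in the closure;
  invertibility of \<open>J 1\<close> then leads back to \<open>G\<close>.\<close>

lemma G_invariant:
  fixes J :: "real \<Rightarrow> real^'p^'p"
  assumes A: "continuous_on {0..1} A" and cone: "\<And>s. s \<in> {0..1} \<Longrightarrow> A s \<in> tangent_cone G"
    and J: "\<And>s. s \<in> {0..1} \<Longrightarrow> (J has_vector_derivative A s ** J s) (at s within {0..1})"
    and J0: "J 0 = mat 1"
  shows "J 1 \<in> G"
proof (rule closure_G)
  obtain a where a: "\<And>s. s \<in> {0..1} \<Longrightarrow> norm (A s) \<le> a"
    using compact_imp_bounded[OF compact_continuous_image[OF A compact_Icc]]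
    unfolding bounded_iff by blast
  show "invertible (J 1)" using linear_ode_invertible[OF a J J0] by blast
  obtain C where C: "C > 0" "\<And>M N. norm (M ** N) \<le> norm (M :: real^'p^'p) * norm (N :: real^'p^'p) * C"
    using mm.pos_bounded by blast
  define \<delta> where "\<delta> s = infdist (J s) (closure G)" for s
  have ne: "closure G \<noteq> {}" using one_G by auto
  have "continuous_on {0..1} J"
    unfolding continuous_on_eq_continuous_within by (intro ballI has_vector_derivative_continuous[OF J])
  then have "continuous_on {0..1} \<delta>" unfolding \<delta>_def by (rule continuous_on_infdist)
  moreover have "\<delta> 0 \<le> 0" using subsetD[OF closure_subset one_G] by (simp add: \<delta>_def J0)
  moreover have "a * C \<ge> 0" using order_trans[OF norm_ge_zero a[of 0]] C(1) by simp
  ultimately have "\<delta> 1 \<le> 0"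
  proof (rule dini_comparison)
    fix s \<epsilon> :: real assume s: "s \<in> {0..<1}" and \<epsilon>: "\<epsilon> > 0"
    obtain M where M: "M \<in> closure G" "\<And>N. N \<in> closure G \<Longrightarrow> dist (J s) M \<le> dist (J s) N"
      using distance_attains_inf[OF closed_closure ne, of "J s"] by blast
    have \<delta>s: "norm (J s - M) \<le> \<delta> s"
      using M ne unfolding \<delta>_def dist_norm[symmetric]
      by (simp add: infdist_notempty) (intro cINF_greatest, auto)
    \<comment> \<open>Bounds the growth of the cone error under multiplication by \<open>M\<close>;
      the summand 1 makes it positive.\<close>
    define n where "n = norm M * C + 1"
    have n: "n > 0" using C(1) by (auto simp: n_def intro!: add_nonneg_pos)
    obtain d where d: "d > 0" "\<And>y. y \<in> {0..1} \<Longrightarrow> norm (y - s) < d \<Longrightarrow>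
        norm (J y - J s - (y - s) *\<^sub>R (A s ** J s)) \<le> \<epsilon> / 2 * norm (y - s)"
      using J[of s] s \<epsilon> unfolding has_vector_derivative_def has_derivative_within_alt
      by (metis atLeastAtMost_iff atLeastLessThan_iff half_gt_zero less_le)
    obtain h N where h: "0 < h" "h < min d (1 - s)" and N: "N \<in> G"
      "norm (N - mat 1 - h *\<^sub>R A s) \<le> \<epsilon> / (2 * n) * h"
      using tangent_coneD[OF cone[of s], of "min d (1 - s)" "\<epsilon> / (2 * n)"] s d \<epsilon> n by auto
    have "\<delta> (s + h) \<le> norm (J (s + h) - N ** M)"
      unfolding \<delta>_def dist_norm[symmetric] by (intro infdist_le mult_closure_G N M)
    \<comment> \<open>Error of the differential equation, distance to \<open>M\<close>, its growth
      under \<open>A s\<close>, error of the cone approximation. The middle two give the Gronwall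
      terms, the outer two share \<epsilon>.\<close>
    also have "J (s + h) - N ** M = (J (s + h) - J s - h *\<^sub>R (A s ** J s)) + (J s - M)
        + (h *\<^sub>R A s) ** (J s - M) - (N - mat 1 - h *\<^sub>R A s) ** M"
      by (simp add: mm.add_left mm.diff_left mm.diff_right mm.scaleR_left algebra_simps)
    also have "norm \<dots> \<le> norm (J (s + h) - J s - h *\<^sub>R (A s ** J s)) + norm (J s - M)
        + norm ((h *\<^sub>R A s) ** (J s - M)) + norm ((N - mat 1 - h *\<^sub>R A s) ** M)"
      by (intro norm_triangle_le norm_triangle_le_diff add_mono norm_triangle_ineq order_refl)
    also have "\<dots> \<le> \<epsilon> / 2 * h + \<delta> s + h * (a * C * \<delta> s) + \<epsilon> / 2 * h"
    proof (intro add_mono \<delta>s)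
      show "norm (J (s + h) - J s - h *\<^sub>R (A s ** J s)) \<le> \<epsilon> / 2 * h"
        using d(2)[of "s + h"] h s by simp
      have "norm ((h *\<^sub>R A s) ** (J s - M)) = h * norm (A s ** (J s - M))"
        using h by (simp add: mm.scaleR_left)
      also have "\<dots> \<le> h * (norm (A s) * norm (J s - M) * C)" using C(2) h by (intro mult_left_mono) auto
      also have "\<dots> \<le> h * (a * \<delta> s * C)"
        using a[of s] s \<delta>s C(1) h norm_ge_zero[of "A s"]
        by (intro mult_left_mono mult_right_mono mult_mono) (auto intro: order_trans[OF norm_ge_zero])
      finally show "norm ((h *\<^sub>R A s) ** (J s - M)) \<le> h * (a * C * \<delta> s)" by (simp add: mult_ac)
      have "norm ((N - mat 1 - h *\<^sub>R A s) ** M) \<le> norm (N - mat 1 - h *\<^sub>R A s) * norm M * C" by (rule C(2))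
      also have "\<dots> \<le> (\<epsilon> / (2 * n) * h) * norm M * C"
        using N(2) C(1) by (intro mult_right_mono) auto
      also have "\<dots> = (\<epsilon> / (2 * n) * h) * (norm M * C)" by simp
      also have "\<dots> \<le> (\<epsilon> / (2 * n) * h) * n"
        using \<epsilon> n h by (intro mult_left_mono) (auto simp: n_def)
      also have "\<dots> = \<epsilon> / 2 * h" using n by simp
      finally show "norm ((N - mat 1 - h *\<^sub>R A s) ** M) \<le> \<epsilon> / 2 * h" .
    qed
    also have "\<dots> = \<delta> s + h * (a * C * \<delta> s + \<epsilon>)" by (simp add: algebra_simps)
    finally show "\<exists>h>0. s + h \<le> 1 \<and> \<delta> (s + h) \<le> \<delta> s + h * (a * C * \<delta> s + \<epsilon>)"
      using h by (intro exI[of _ h]) auto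
  qed
  then have "infdist (J 1) (closure G) = 0" using infdist_nonneg[of "J 1" "closure G"] by (simp add: \<delta>_def)
  then show "J 1 \<in> closure G" using in_closed_iff_infdist_zero[OF closed_closure ne] by simp
qed

end

section \<open>The Lie algebra\<close>

text \<open>\<open>E (X, t)\<close> is the exponential of \<open>t X\<close>, for small
  \<open>X\<close>. The flow exists for small initial values only, so the identity enters as
  \<open>d *\<^sub>R mat 1\<close>; the equation is linear in that component, and division by
  \<open>d\<close> undoes the scaling.\<close>

lemma matrix_exponential_family:
  obtains r :: real and E :: "(real^'p^'p) \<times> real \<Rightarrow> real^'p^'p" where
    "r > 0" "smooth_on (ball 0 r \<times> {-2<..<2}) E"
    "\<And>X. X \<in> ball 0 r \<Longrightarrow> E (X, 0) = mat 1"
    "\<And>X. X \<in> ball 0 r \<Longrightarrow> ((\<lambda>t. E (X, t)) has_vector_derivative X) (at 0)"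
    "E (0, 1) = mat 1" "((\<lambda>X. E (X, 1)) has_derivative (\<lambda>V. V)) (at 0)"
    "\<And>X t. X \<in> ball 0 r \<Longrightarrow> \<bar>t\<bar> < 2 \<Longrightarrow> \<exists>J. J 0 = mat 1 \<and> J 1 = E (X, t) \<and>
      (\<forall>s\<in>{0..1}. (J has_vector_derivative (t *\<^sub>R X) ** J s) (at s within {0..1}))"
proof -
  \<comment> \<open>Symmetrised, so that \<open>B p p = (X ** M, 0)\<close> for
    \<open>p = (M, X)\<close>.\<close>
  define B :: "(real^'p^'p) \<times> (real^'p^'p) \<Rightarrow> (real^'p^'p) \<times> (real^'p^'p) \<Rightarrow> (real^'p^'p) \<times> (real^'p^'p)"
    where "B p q = ((1/2) *\<^sub>R (snd p ** fst q + snd q ** fst p), 0)" for p q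
  have "bilinear B"
    unfolding bilinear_def B_def
    by (auto intro!: linearI simp: mm.add_left mm.add_right mm.scaleR_left mm.scaleR_right algebra_simps)
  then have bil: "bounded_bilinear B" by (simp add: bilinear_conv_bounded_bilinear)
  then obtain K where K: "K > 0" "\<And>x y. norm (B x y) \<le> norm x * norm y * K"
    using bounded_bilinear.pos_bounded by blast
  interpret quadratic_flow B K
  proof (rule quadratic_flow.intro[OF bil _ K(1)])
    show "B x y = B y x" for x y by (simp add: B_def add.commute)
    show "norm (B x y) \<le> K * norm x * norm y" for x y using K(2)[of x y] by (simp add: mult_ac)
  qed
  have fstB: "fst (B p p) = snd p ** fst p" for p by (simp add: B_def scaleR_2[symmetric])
  \<comment> \<open>Makes \<open>d *\<^sub>R mat 1\<close> of norm at most
    \<open>\<rho> / 4\<close>; with \<open>norm X < \<rho> / 4\<close> the initial value stays below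
    \<open>\<rho> / 2\<close>.\<close>
  define d where "d = \<rho> / (4 * (norm (mat 1 :: real^'p^'p) + 1))"
  have n1: "norm (mat 1 :: real^'p^'p) + 1 > 0" by (intro add_nonneg_pos) auto
  have d: "d > 0" using \<rho>_pos n1 by (simp add: d_def)
  have "norm (d *\<^sub>R (mat 1 :: real^'p^'p)) \<le> d * (norm (mat 1 :: real^'p^'p) + 1)"
    using d by (simp add: mult_left_mono)
  also have "\<dots> = \<rho> / 4" using n1 by (simp add: d_def divide_simps)
  finally have nd: "norm (d *\<^sub>R (mat 1 :: real^'p^'p)) \<le> \<rho> / 4" .
  define y0 where "y0 X = (d *\<^sub>R (mat 1 :: real^'p^'p), X :: real^'p^'p)" for X
  define r where "r = \<rho> / 4"
  define E where "E z = (1 / d) *\<^sub>R fst (flow (y0 (fst z), snd z))" for z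
  have inW: "(y0 X, t) \<in> W" if "X \<in> ball 0 r" "\<bar>t\<bar> < 2" for X t
  proof -
    have "norm (y0 X) \<le> norm (d *\<^sub>R (mat 1 :: real^'p^'p)) + norm X" unfolding y0_def by (rule norm_Pair_le)
    also have "\<dots> < \<rho> / 2" using nd that by (simp add: r_def)
    finally show ?thesis using that by (auto simp: W_def)
  qed
  have r: "r > 0" using \<rho>_pos by (simp add: r_def)
  have snd_sol: "snd (sol (y0 X, t) s) = X" if "X \<in> ball 0 r" "\<bar>t\<bar> < 2" "s \<in> {0..1}" for X t s
  proof -
    have "((\<lambda>s. snd (sol (y0 X, t) s)) has_vector_derivative 0) (at s within {0..1})" if "s \<in> {0..1}" for s
      using bounded_linear.has_vector_derivative[OF bounded_linear_snd flow_path(2)[OF inW that]] \<open>X \<in> _\<close> \<open>\<bar>t\<bar> < 2\<close>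
      by (simp add: B_def)
    from constant_velocity[OF this that(3)] show ?thesis
      using flow_path(1)[OF inW[OF that(1,2)]] by (simp add: y0_def)
  qed
  have "smooth_on (ball 0 r \<times> {-2<..<2}) (\<lambda>z. flow (((d *\<^sub>R mat 1, 0), 0) + ((0, fst z), snd z)))"
  proof (rule smooth_on_affine[OF flow_smooth])
    show "bounded_linear (\<lambda>z. ((0, fst z), snd z))"
      by (intro bounded_linear_Pair bounded_linear_zero bounded_linear_fst bounded_linear_snd)
    show "((d *\<^sub>R mat 1, 0), 0) + ((0, fst z), snd z) \<in> W" if "z \<in> ball 0 r \<times> {- 2<..<2}" for z
      using inW[of "fst z" "snd z"] that by (auto simp: y0_def abs_less_iff)
  qed (auto intro: open_Times)
  then have "smooth_on (ball 0 r \<times> {-2<..<2}) (\<lambda>z. flow (y0 (fst z), snd z))" by (simp add: y0_def)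
  then have E_smooth: "smooth_on (ball 0 r \<times> {-2<..<2}) E"
    unfolding E_def
    by (intro smooth_on_compose_linear[where L = "\<lambda>p. (1 / d) *\<^sub>R fst p"] bounded_linear_const_scaleR
        bounded_linear_fst) (auto intro: open_Times)
  have E0: "E (X, 0) = mat 1" if "X \<in> ball 0 r" for X
    using flow_id[OF inW[OF that]] d by (simp add: E_def y0_def)
  have Ed: "((\<lambda>t. E (X, t)) has_vector_derivative X) (at 0)" if X: "X \<in> ball 0 r" for X
  proof -
    let ?z = "(y0 X, 0) :: ((real^'p^'p) \<times> (real^'p^'p)) \<times> real"
    have z: "?z \<in> W" using inW[OF X] by simp
    have sol0: "sol ?z = const_bcontfun (y0 X)" using sol(2)[OF z] by simp
    have l: "lsol ?z h = h" for h using lsol[OF z, of h] by simp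
    have 1: "((\<lambda>t. (y0 X, t)) has_derivative (\<lambda>\<tau>. (0, \<tau>))) (at 0)" by (auto intro!: derivative_eq_intros)
    have "((\<lambda>t. flow (y0 X, t)) has_derivative (\<lambda>\<tau>. \<tau> *\<^sub>R B (y0 X) (y0 X))) (at 0)"
      using has_derivative_compose[OF 1 flow_has_derivative[OF z]]
      by (simp add: l sol0 picard_apply clamp01)
    from bounded_linear.has_derivative[OF bounded_linear_fst this]
    have "((\<lambda>t. fst (flow (y0 X, t))) has_derivative (\<lambda>\<tau>. \<tau> *\<^sub>R fst (B (y0 X) (y0 X)))) (at 0)" by simp
    from has_derivative_scaleR_right[OF this, of "1 / d"]
    show ?thesis using d by (simp add: E_def has_vector_derivative_def fstB y0_def mm.scaleR_right)
  qed
  have J: "\<exists>J. J 0 = mat 1 \<and> J 1 = E (X, t) \<and>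
      (\<forall>s\<in>{0..1}. (J has_vector_derivative (t *\<^sub>R X) ** J s) (at s within {0..1}))"
    if "X \<in> ball 0 r" "\<bar>t\<bar> < 2" for X t
  proof (intro exI[of _ "\<lambda>s. (1 / d) *\<^sub>R fst (sol (y0 X, t) s)"] conjI ballI)
    show "(1 / d) *\<^sub>R fst (sol (y0 X, t) 0) = mat 1"
      using flow_path(1)[OF inW[OF that]] d by (simp add: y0_def)
    show "(1 / d) *\<^sub>R fst (sol (y0 X, t) 1) = E (X, t)" by (simp add: E_def flow_def)
    fix s :: real assume s: "s \<in> {0..1}"
    have "bounded_linear (\<lambda>p :: (real^'p^'p) \<times> (real^'p^'p). (1 / d) *\<^sub>R fst p)"
      by (intro bounded_linear_const_scaleR bounded_linear_fst)
    from bounded_linear.has_vector_derivative[OF this flow_path(2)[OF inW[OF that] s]]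
    show "((\<lambda>s. (1 / d) *\<^sub>R fst (sol (y0 X, t) s)) has_vector_derivative
        (t *\<^sub>R X) ** ((1 / d) *\<^sub>R fst (sol (y0 X, t) s))) (at s within {0..1})"
      using snd_sol[OF that s] by (simp add: fstB mm.scaleR_right mm.scaleR_left mult.commute)
  qed
  have z1: "(y0 0, 1) \<in> W" using inW[of 0 1] r by simp
  have c0: "const_bcontfun (y0 0) = sol (y0 0, 1)"
  proof (rule sol_unique[OF z1])
    show "norm (const_bcontfun (y0 0) :: real \<Rightarrow>\<^sub>C _) \<le> \<rho>"
      using norm_c[of "y0 0"] W_D(1)[OF z1] \<rho>_pos by simp
    show "const_bcontfun (y0 0) = const_bcontfun (fst (y0 0, 1))
      + snd (y0 0, 1) *\<^sub>R picard (const_bcontfun (y0 0)) (const_bcontfun (y0 0))"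
      by (rule bcontfun_eqI) (simp add: picard_apply B_def y0_def)
  qed
  have sol0: "apply_bcontfun (sol (y0 0, 1)) s = y0 0" for s by (simp add: c0[symmetric])
  have E1: "E (0, 1) = mat 1" using d by (simp add: E_def flow_def sol0) (simp add: y0_def)
  have "((\<lambda>X. E (X, 1)) has_derivative (\<lambda>V. V)) (at 0)"
  proof -
    \<comment> \<open>At \<open>X = 0\<close> the base solution is constant. The second component of
      its variation is constantly \<open>V\<close>, so the first grows from 0 with constant velocity
      \<open>d V\<close>.\<close>
    have var: "fst (lsol (y0 0, 1) (const_bcontfun (0, V)) 1) = d *\<^sub>R V" for V :: "real^'p^'p"
    proof -
      let ?w = "lsol (y0 0, 1) (const_bcontfun (0, V))"
      note w = variation_path[OF z1, where v = "(0, V)"]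
      have "((\<lambda>s. snd (?w s)) has_vector_derivative 0) (at s within {0..1})" if "s \<in> {0..1}" for s
        using bounded_linear.has_vector_derivative[OF bounded_linear_snd w(2)[OF that]]
        by (simp add: B_def)
      from constant_velocity[OF this] have 1: "snd (?w s) = V" if "s \<in> {0..1}" for s
        using w(1) that by simp
      have "((\<lambda>s. fst (?w s)) has_vector_derivative d *\<^sub>R V) (at s within {0..1})" if "s \<in> {0..1}" for s
        using bounded_linear.has_vector_derivative[OF bounded_linear_fst w(2)[OF that]] 1[OF that]
        unfolding sol0 by (simp add: B_def y0_def mm.scaleR_right)
      from constant_velocity[OF this, of 1] show ?thesis using w(1) by simp
    qed
    have 1: "(y0 has_derivative (\<lambda>V. (0, V))) (at 0)"
      unfolding y0_def by (auto intro!: derivative_eq_intros)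
    have "((\<lambda>X. flow (y0 X, 1)) has_derivative (\<lambda>V. lsol (y0 0, 1) (const_bcontfun (0, V)) 1)) (at 0)"
      using has_derivative_compose[OF 1 flow_space_derivative[OF z1]] .
    from bounded_linear.has_derivative[OF bounded_linear_fst this]
    have "((\<lambda>X. fst (flow (y0 X, 1))) has_derivative (\<lambda>V. d *\<^sub>R V)) (at 0)" by (simp add: var)
    from has_derivative_scaleR_right[OF this, of "1 / d"]
    show ?thesis using d by (simp add: E_def)
  qed
  from that[OF r E_smooth E0 Ed E1 this J] show ?thesis by blast
qed

text \<open>From \<open>A^-1 - 1 = - A^-1 (A - 1)\<close>: near 1, half of the norm of the inverse
  is absorbed, which first bounds the inverse and then its distance to 1.\<close>

lemma matrix_inv_near_one:
  obtains C \<delta> :: real where "C > 0" "\<delta> > 0"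
    "\<And>A :: real^'p^'p. invertible A \<Longrightarrow> norm (A - mat 1) < \<delta> \<Longrightarrow> norm (matrix_inv A) \<le> C"
    "\<And>A :: real^'p^'p. invertible A \<Longrightarrow> norm (A - mat 1) < \<delta> \<Longrightarrow>
      norm (matrix_inv A - mat 1) \<le> C * norm (A - mat 1)"
proof -
  obtain c where c: "c > 0" "\<And>M N. norm (M ** N) \<le> norm (M :: real^'p^'p) * norm (N :: real^'p^'p) * c"
    using mm.pos_bounded by blast
  define C where "C = (2 * norm (mat 1 :: real^'p^'p) + 1) * (1 + c)"
  have C: "C > 0" using c(1) by (auto simp: C_def intro!: mult_pos_pos add_nonneg_pos)
  have *: "norm (matrix_inv A) \<le> 2 * norm (mat 1 :: real^'p^'p)"
      "norm (matrix_inv A - mat 1) \<le> norm (matrix_inv A) * norm (A - mat 1) * c"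
    if A: "invertible A" "norm (A - mat 1) < 1 / (2 * c)" for A :: "real^'p^'p"
  proof -
    have "matrix_inv A - mat 1 = - (matrix_inv A ** (A - mat 1))"
      using matrix_inv[OF A(1)] by (simp add: mm.diff_right)
    then show 1: "norm (matrix_inv A - mat 1) \<le> norm (matrix_inv A) * norm (A - mat 1) * c"
      using c(2)[of "matrix_inv A" "A - mat 1"] by simp
    also have "\<dots> = norm (matrix_inv A) * (norm (A - mat 1) * c)" by simp
    also have "\<dots> \<le> norm (matrix_inv A) * (1 / 2)"
      using A(2) c(1) by (intro mult_left_mono) (auto simp: field_simps)
    finally show "norm (matrix_inv A) \<le> 2 * norm (mat 1 :: real^'p^'p)"
      using norm_triangle_ineq2[of "matrix_inv A" "mat 1"] by simp
  qed
  have n: "0 \<le> norm (mat 1 :: real^'p^'p) * c" using c(1) by simp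
  show ?thesis
  proof (rule that[of C "1 / (2 * c)"])
    fix A :: "real^'p^'p" assume A: "invertible A" "norm (A - mat 1) < 1 / (2 * c)"
    have "2 * norm (mat 1 :: real^'p^'p) \<le> C" using c(1) n by (simp add: C_def algebra_simps)
    then show "norm (matrix_inv A) \<le> C" using *(1)[OF A] by simp
    have "norm (matrix_inv A) * norm (A - mat 1) * c = (norm (matrix_inv A) * c) * norm (A - mat 1)" by simp
    also have "\<dots> \<le> (2 * norm (mat 1 :: real^'p^'p) * c) * norm (A - mat 1)"
      using *(1)[OF A] c(1) by (intro mult_right_mono) auto
    also have "\<dots> \<le> C * norm (A - mat 1)"
      using c(1) by (intro mult_right_mono) (auto simp: C_def algebra_simps)
    finally show "norm (matrix_inv A - mat 1) \<le> C * norm (A - mat 1)" using *(2)[OF A] by simp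
  qed (use C c in auto)
qed

lemma smooth_near_0_has_derivative:
  "smooth_near_0 f \<Longrightarrow> (f has_derivative frechet_derivative f (at 0)) (at 0)"
  unfolding smooth_near_0_def using smooth_on_has_derivative by blast

section \<open>The contingent cone is the Lie algebra\<close>

context lin_group
begin

lemma curve_in_tangent_cone:
  assumes \<gamma>: "(\<gamma> has_vector_derivative X) (at 0)" "\<gamma> 0 = mat 1" "\<forall>\<^sub>F t in nhds (0::real). \<gamma> t \<in> G"
  shows "X \<in> tangent_cone G"
  unfolding tangent_cone_def
proof (intro CollectI allI impI)
  fix \<epsilon> :: real assume \<epsilon>: "\<epsilon> > 0"
  obtain d1 where d1: "d1 > 0" "\<And>t. norm (t - 0) < d1 \<Longrightarrow> norm (\<gamma> t - \<gamma> 0 - (t - 0) *\<^sub>R X) \<le> \<epsilon> * norm (t - 0)"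
    using \<gamma>(1) \<epsilon> unfolding has_vector_derivative_def has_derivative_at_alt by blast
  obtain d2 where d2: "d2 > 0" "\<And>t. dist t 0 < d2 \<Longrightarrow> \<gamma> t \<in> G"
    using \<gamma>(3) unfolding eventually_nhds_metric by blast
  define h where "h = min \<epsilon> (min d1 d2) / 2"
  have h: "0 < h" "h < \<epsilon>" "h < d1" "h < d2" using \<epsilon> d1(1) d2(1) by (auto simp: h_def)
  then show "\<exists>h\<in>{0<..<\<epsilon>}. \<exists>A\<in>G. norm (A - mat 1 - h *\<^sub>R X) \<le> \<epsilon> * h"
    using d1(2)[of h] d2(2)[of h] \<gamma>(2) by (intro bexI[of _ h] bexI[of _ "\<gamma> h"]) auto
qed

lemma tangent_cone_scaleR_pos:
  assumes X: "X \<in> tangent_cone G" and c: "c > 0" shows "c *\<^sub>R X \<in> tangent_cone G"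
  unfolding tangent_cone_def
proof (intro CollectI allI impI)
  fix \<epsilon> :: real assume \<epsilon>: "\<epsilon> > 0"
  obtain h A where h: "0 < h" "h < \<epsilon> * c" "A \<in> G" "norm (A - mat 1 - h *\<^sub>R X) \<le> \<epsilon> / c * h"
    using tangent_coneD[OF X, of "\<epsilon> * c" "\<epsilon> / c"] \<epsilon> c by auto
  then show "\<exists>h\<in>{0<..<\<epsilon>}. \<exists>A\<in>G. norm (A - mat 1 - h *\<^sub>R (c *\<^sub>R X)) \<le> \<epsilon> * h"
    using c by (intro bexI[of _ "h / c"] bexI[of _ A]) (auto simp: field_simps)
qed

text \<open>The inverse of \<open>A\<close> is \<open>1 - h X\<close> up to the error
  \<open>A^-1 ((A - 1 - h X) - h (A - 1) X)\<close>, and \<open>A - 1\<close> is of order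
  \<open>h\<close>. This gives access to negative times of one-parameter groups.\<close>

lemma tangent_cone_uminus:
  assumes X: "X \<in> tangent_cone G" shows "- X \<in> tangent_cone G"
  unfolding tangent_cone_def
proof (intro CollectI allI impI)
  fix \<epsilon> :: real assume \<epsilon>: "\<epsilon> > 0"
  obtain c where c: "c > 0" "\<And>M N. norm (M ** N) \<le> norm (M :: real^'p^'p) * norm (N :: real^'p^'p) * c"
    using mm.pos_bounded by blast
  obtain C \<delta> where C: "C > 0" "\<delta> > 0"
    "\<And>A :: real^'p^'p. invertible A \<Longrightarrow> norm (A - mat 1) < \<delta> \<Longrightarrow> norm (matrix_inv A) \<le> C"
    using matrix_inv_near_one by metis
  define b where "b = 1 + norm X"
  have b: "b \<ge> 1" by (simp add: b_def)
  \<comment> \<open>\<open>e1\<close> controls the relative error of \<open>A\<close> and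
    \<open>e2\<close> the step: each of the two terms of the final estimate may cost
    \<open>\<epsilon> / 2\<close>. As \<open>e1 \<le> 1\<close>, \<open>h * b\<close> bounds
    \<open>norm (A - mat 1)\<close>, and \<open>h * b < \<delta>\<close> bounds the inverse.\<close>
  define e1 where "e1 = min 1 (\<epsilon> / (2 * (C * c)))"
  define e2 where "e2 = min \<epsilon> (min (\<delta> / b) (\<epsilon> / (2 * (C * c * (c * b * b)))))"
  have e1: "e1 > 0" "e1 \<le> 1" "C * c * e1 \<le> \<epsilon> / 2"
  proof -
    have "C * c * e1 \<le> C * c * (\<epsilon> / (2 * (C * c)))" using C c by (intro mult_left_mono) (auto simp: e1_def)
    then show "C * c * e1 \<le> \<epsilon> / 2" using C c by simp
  qed (use \<epsilon> C c in \<open>auto simp: e1_def\<close>)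
  have e2: "e2 > 0" "e2 \<le> \<epsilon>" "e2 \<le> \<delta> / b" "C * c * (c * b * b) * e2 \<le> \<epsilon> / 2"
  proof -
    have "C * c * (c * b * b) * e2 \<le> C * c * (c * b * b) * (\<epsilon> / (2 * (C * c * (c * b * b))))"
      using C c b by (intro mult_left_mono) (auto simp: e2_def)
    then show "C * c * (c * b * b) * e2 \<le> \<epsilon> / 2" using C c b by simp
  qed (use \<epsilon> C c b in \<open>auto simp: e2_def\<close>)
  obtain h A where h: "0 < h" "h < e2" "A \<in> G" "norm (A - mat 1 - h *\<^sub>R X) \<le> e1 * h"
    using tangent_coneD[OF X e2(1) e1(1)] by blast
  have inv: "invertible A" using h invertible_G by blast
  have "norm (A - mat 1) \<le> norm (A - mat 1 - h *\<^sub>R X) + norm (h *\<^sub>R X)"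
    using norm_triangle_ineq[of "A - mat 1 - h *\<^sub>R X" "h *\<^sub>R X"] by simp
  also have "\<dots> \<le> 1 * h + h * norm X"
    using h(1) mult_right_mono[OF e1(2), of h] by (intro add_mono order_trans[OF h(4)]) auto
  finally have A1: "norm (A - mat 1) \<le> h * b" by (simp add: b_def algebra_simps)
  also have "h * b < \<delta>"
    using h(2) e2(3) b less_le_trans[OF h(2) e2(3)] by (simp add: pos_less_divide_eq)
  finally have inv_le: "norm (matrix_inv A) \<le> C" using C(3)[OF inv] by simp
  have "matrix_inv A - mat 1 - h *\<^sub>R (- X)
      = - (matrix_inv A ** ((A - mat 1 - h *\<^sub>R X) - h *\<^sub>R ((A - mat 1) ** X)))"
    using matrix_inv[OF inv]
    by (simp add: mm.add_right mm.minus_right mm.diff_right mm.diff_left mm.scaleR_right matrix_mul_assoc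
        scaleR_diff_right)
  then have "norm (matrix_inv A - mat 1 - h *\<^sub>R (- X))
      \<le> norm (matrix_inv A) * norm ((A - mat 1 - h *\<^sub>R X) - h *\<^sub>R ((A - mat 1) ** X)) * c"
    using c(2) by (metis norm_minus_cancel)
  also have "\<dots> \<le> C * (e1 * h + h * (h * b * b * c)) * c"
  proof (intro mult_right_mono mult_mono inv_le)
    have "norm ((A - mat 1) ** X) \<le> norm (A - mat 1) * norm X * c" by (rule c(2))
    also have "\<dots> \<le> h * b * b * c"
      using A1 h c b by (intro mult_right_mono mult_mono) (auto simp: b_def)
    finally have "norm (h *\<^sub>R ((A - mat 1) ** X)) \<le> h * (h * b * b * c)"
      using h by (simp add: mult_left_mono)
    then show "norm ((A - mat 1 - h *\<^sub>R X) - h *\<^sub>R ((A - mat 1) ** X)) \<le> e1 * h + h * (h * b * b * c)"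
      by (rule order_trans[OF norm_triangle_ineq4 add_mono[OF h(4)]])
  qed (use C c in auto)
  also have "\<dots> = (C * c * e1 + (C * c * (c * b * b)) * h) * h" by (simp add: algebra_simps)
  also have "\<dots> \<le> (\<epsilon> / 2 + \<epsilon> / 2) * h"
  proof (intro mult_right_mono add_mono e1(3))
    have "(C * c * (c * b * b)) * h \<le> (C * c * (c * b * b)) * e2"
      using h C c b by (intro mult_left_mono) auto
    then show "(C * c * (c * b * b)) * h \<le> \<epsilon> / 2" using e2(4) by simp
  qed (use h in auto)
  finally have "norm (matrix_inv A - mat 1 - h *\<^sub>R (- X)) \<le> \<epsilon> * h" by simp
  then show "\<exists>h\<in>{0<..<\<epsilon>}. \<exists>A\<in>G. norm (A - mat 1 - h *\<^sub>R (- X)) \<le> \<epsilon> * h"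
    using h e2(2) inv_G by (intro bexI[of _ h] bexI[of _ "matrix_inv A"]) auto
qed

lemma zero_tangent_cone: "0 \<in> tangent_cone G"
  by (rule curve_in_tangent_cone[of "\<lambda>_. mat 1"]) (use one_G in \<open>auto intro!: derivative_eq_intros\<close>)

lemma tangent_cone_scaleR:
  assumes "X \<in> tangent_cone G" shows "c *\<^sub>R X \<in> tangent_cone G"
proof -
  consider "c > 0" | "c = 0" | "- c > 0" by linarith
  then show ?thesis
  proof cases
    case 3
    then show ?thesis
      using tangent_cone_uminus[OF tangent_cone_scaleR_pos[OF assms 3]] by simp
  qed (use tangent_cone_scaleR_pos assms zero_tangent_cone in auto)
qed

lemma exponential_in_G:
  assumes "X \<in> tangent_cone G" "J 0 = mat 1"
    "\<And>s. s \<in> {0..1} \<Longrightarrow> (J has_vector_derivative (t *\<^sub>R X) ** J s) (at s within {0..1})"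
  shows "J 1 \<in> G"
  by (rule G_invariant[where A = "\<lambda>_. t *\<^sub>R X"]) (use assms tangent_cone_scaleR in auto)

text \<open>A direction of the cone is the velocity of its one-parameter group, which stays in
  \<open>G\<close> by invariance. As \<open>E\<close> is available for small matrices only, the
  curve is \<open>E (c X, t / c)\<close>.\<close>

lemma lie_algebra_eq: "lie_algebra G = tangent_cone G"
proof (intro equalityI subsetI)
  fix X assume "X \<in> lie_algebra G"
  then show "X \<in> tangent_cone G"
    unfolding lie_algebra_def using curve_in_tangent_cone by blast
next
  fix X assume X: "X \<in> tangent_cone G"
  obtain r :: real and E :: "(real^'p^'p) \<times> real \<Rightarrow> real^'p^'p" where E:
    "r > 0" "smooth_on (ball 0 r \<times> {-2<..<2}) E"
    "\<And>X. X \<in> ball 0 r \<Longrightarrow> E (X, 0) = mat 1"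
    "\<And>X. X \<in> ball 0 r \<Longrightarrow> ((\<lambda>t. E (X, t)) has_vector_derivative X) (at 0)"
    "\<And>X t. X \<in> ball 0 r \<Longrightarrow> \<bar>t\<bar> < 2 \<Longrightarrow> \<exists>J. J 0 = mat 1 \<and> J 1 = E (X, t) \<and>
      (\<forall>s\<in>{0..1}. (J has_vector_derivative (t *\<^sub>R X) ** J s) (at s within {0..1}))"
    by (rule matrix_exponential_family) blast
  define c where "c = r / (2 * (norm X + 1))"
  have n: "norm X + 1 > 0" by (intro add_nonneg_pos) auto
  have c: "c > 0" using E(1) n by (simp add: c_def)
  have "norm (c *\<^sub>R X) \<le> c * (norm X + 1)" using c by (simp add: mult_left_mono)
  also have "\<dots> = r / 2" using n by (simp add: c_def divide_simps)
  finally have cX: "c *\<^sub>R X \<in> ball 0 r" using E(1) by simp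
  let ?\<gamma> = "\<lambda>t. E (c *\<^sub>R X, t / c)" and ?U = "{-(2 * c)<..<2 * c}"
  have small: "\<bar>t / c\<bar> < 2" if "t \<in> ?U" for t using that c by (auto simp: abs_less_iff field_simps)
  have "smooth_on ?U (\<lambda>t. E ((c *\<^sub>R X, 0) + (0, t / c)))"
  proof (rule smooth_on_affine[OF E(2)])
    show "bounded_linear (\<lambda>t. (0, t / c))"
      by (intro bounded_linear_Pair bounded_linear_zero bounded_linear_divide)
    show "(c *\<^sub>R X, 0) + (0, t / c) \<in> ball 0 r \<times> {- 2<..<2}" if "t \<in> ?U" for t
    proof -
      have "- 2 < t / c \<and> t / c < 2" using small[OF that] unfolding abs_less_iff by linarith
      then show ?thesis using cX by simp
    qed
  qed auto
  then have "smooth_on ?U ?\<gamma>" by simp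
  then have "smooth_near_0 ?\<gamma>"
    unfolding smooth_near_0_def using c by (intro exI[of _ ?U]) auto
  moreover have "?\<gamma> 0 = mat 1" using E(3)[OF cX] by simp
  moreover have "\<forall>\<^sub>F t in nhds 0. ?\<gamma> t \<in> G"
  proof -
    have "\<forall>\<^sub>F t in nhds 0. t \<in> ?U" using c by (intro eventually_nhds_in_open) auto
    then show ?thesis
    proof eventually_elim
      case (elim t)
      then show ?case
        using E(5)[OF cX small[OF elim]] exponential_in_G[OF tangent_cone_scaleR[OF X]] by metis
    qed
  qed
  moreover have "(?\<gamma> has_vector_derivative X) (at 0)"
  proof -
    have 1: "((\<lambda>t. t / c) has_vector_derivative 1 / c) (at 0)"
      by (auto intro!: derivative_eq_intros)
    show ?thesis
      using vector_diff_chain_at[OF 1, of "\<lambda>t. E (c *\<^sub>R X, t)" "c *\<^sub>R X"] E(4)[OF cX] c by (simp add: o_def)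
  qed
  ultimately show "X \<in> lie_algebra G" unfolding lie_algebra_def by blast
qed

text \<open>Sums need actual curves, whose product has velocity \<open>X + Y\<close>: the steps
  \<open>h\<close> of two secant sequences in the cone need not match.\<close>

lemma subspace_lie_algebra: "subspace (lie_algebra G)"
proof (rule subspaceI)
  show "0 \<in> lie_algebra G" using zero_tangent_cone lie_algebra_eq by simp
  show "c *\<^sub>R X \<in> lie_algebra G" if "X \<in> lie_algebra G" for c X
    using tangent_cone_scaleR that lie_algebra_eq by simp
  fix X Y assume "X \<in> lie_algebra G" "Y \<in> lie_algebra G"
  then obtain \<gamma> \<gamma>' where *: "\<gamma> 0 = mat 1" "\<forall>\<^sub>F t in nhds (0::real). \<gamma> t \<in> G" "(\<gamma> has_vector_derivative X) (at 0)"
    "\<gamma>' 0 = mat 1" "\<forall>\<^sub>F t in nhds (0::real). \<gamma>' t \<in> G" "(\<gamma>' has_vector_derivative Y) (at 0)"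
    unfolding lie_algebra_def by blast
  have "X + Y \<in> tangent_cone G"
  proof (rule curve_in_tangent_cone[of "\<lambda>t. \<gamma> t ** \<gamma>' t"])
    show "((\<lambda>t. \<gamma> t ** \<gamma>' t) has_vector_derivative X + Y) (at 0)"
      using mm.has_vector_derivative[OF *(3,6)] *(1,4) by (simp add: add.commute)
    show "\<forall>\<^sub>F t in nhds 0. \<gamma> t ** \<gamma>' t \<in> G"
      using *(2,5) by eventually_elim (rule mult_G)
  qed (use * in auto)
  then show "X + Y \<in> lie_algebra G" using lie_algebra_eq by simp
qed

end

section \<open>Smooth paths in connected groups\<close>

text \<open>Smoothness on an open neighbourhood of [0,1], with membership in \<open>G\<close> on
  [0,1] only, is the form in which \<open>Diff0\<close> takes its isotopies.\<close>

definition reachable :: "(real^'p^'p) set \<Rightarrow> (real^'p^'p) set" where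
  "reachable G = {A. \<exists>T \<alpha>. open T \<and> {0..1} \<subseteq> T \<and> smooth_on T \<alpha> \<and> (\<forall>t\<in>{0..1::real}. \<alpha> t \<in> G) \<and>
     \<alpha> 0 = mat 1 \<and> \<alpha> 1 = A}"

lemma orthogonal_projection_exists:
  fixes S :: "'a::euclidean_space set"
  assumes "subspace S"
  obtains P where "bounded_linear P" "\<And>x. P x \<in> S" "\<And>x y. y \<in> S \<Longrightarrow> (x - P x) \<bullet> y = 0"
proof -
  obtain B where B: "B \<subseteq> S" "pairwise orthogonal B" "\<And>x. x \<in> B \<Longrightarrow> norm x = 1" "independent B" "span B = S"
    using orthonormal_basis_subspace[OF assms] by metis
  have fin: "finite B" using B(4) independent_imp_finite by blast
  define P where "P x = (\<Sum>b\<in>B. (x \<bullet> b) *\<^sub>R b)" for x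
  show ?thesis
  proof (rule that[of P])
    show "bounded_linear P"
      unfolding P_def by (intro bounded_linear_sum bounded_linear_scaleR_const bounded_linear_inner_left)
    show "P x \<in> S" for x
      unfolding P_def by (intro subspace_sum subspace_scale assms) (use B(1) in auto)
    fix x y assume "y \<in> S"
    then have y: "y \<in> span B" using B(5) by simp
    have "orthogonal (x - P x) y"
    proof (rule orthogonal_to_span[OF y])
      fix b assume b: "b \<in> B"
      have "P x \<bullet> b = (\<Sum>b'\<in>B. if b' = b then x \<bullet> b else 0)"
        unfolding P_def inner_sum_left
      proof (rule sum.cong)
        fix b' assume b': "b' \<in> B"
        show "(x \<bullet> b') *\<^sub>R b' \<bullet> b = (if b' = b then x \<bullet> b else 0)"
          using B(2) B(3)[OF b] b b' by (auto simp: pairwise_def orthogonal_def dot_square_norm)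
      qed simp
      also have "\<dots> = x \<bullet> b" using b fin by simp
      finally show "orthogonal (x - P x) b" by (simp add: orthogonal_def inner_diff_left)
    qed
    then show "(x - P x) \<bullet> y = 0" by (simp add: orthogonal_def)
  qed
qed

context lin_group
begin

lemma reachable_subset: "reachable G \<subseteq> G"
  by (auto simp: reachable_def)

lemma reachable_mult:
  assumes "A \<in> reachable G" "B \<in> reachable G" shows "A ** B \<in> reachable G"
proof -
  obtain T \<alpha> where 1: "open T" "{0..1} \<subseteq> T" "smooth_on T \<alpha>" "\<And>t. t \<in> {0..1::real} \<Longrightarrow> \<alpha> t \<in> G"
    "\<alpha> 0 = mat 1" "\<alpha> 1 = A" using assms(1) unfolding reachable_def by blast
  obtain T' \<alpha>' where 2: "open T'" "{0..1} \<subseteq> T'" "smooth_on T' \<alpha>'" "\<And>t. t \<in> {0..1::real} \<Longrightarrow> \<alpha>' t \<in> G"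
    "\<alpha>' 0 = mat 1" "\<alpha>' 1 = B" using assms(2) unfolding reachable_def by blast
  have "smooth_on (T \<inter> T') (\<lambda>t. \<alpha> t ** \<alpha>' t)"
    by (intro smooth_on_bilinear[OF bounded_bilinear_matrix_mult] open_Int 1 2
        smooth_on_subset[OF 1(3)] smooth_on_subset[OF 2(3)]) auto
  then show ?thesis
    unfolding reachable_def using 1 2 mult_G
    by (intro CollectI exI[of _ "T \<inter> T'"] exI[of _ "\<lambda>t. \<alpha> t ** \<alpha>' t"]) auto
qed

lemma one_reachable: "mat 1 \<in> reachable G"
  unfolding reachable_def
  by (intro CollectI exI[of _ UNIV] exI[of _ "\<lambda>_. mat 1"]) (auto simp: one_G smooth_on_const)

text \<open>The heart of the closed subgroup theorem: near \<open>1\<close>, write elements of \<open>G\<close> as \<open>exp X (1 + Y)\<close> with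
  \<open>X\<close> in the Lie algebra and \<open>Y\<close> orthogonal to it; a limit of directions of nonzero such \<open>Y\<close> would be
  tangent to \<open>G\<close>.\<close>

lemma reachable_near_one:
  obtains \<epsilon> where "\<epsilon> > 0" "\<And>A. A \<in> G \<Longrightarrow> norm (A - mat 1) < \<epsilon> \<Longrightarrow> A \<in> reachable G"
proof (rule ccontr)
  assume "\<not> thesis"
  then have far: "\<exists>A\<in>G. norm (A - mat 1) < \<epsilon> \<and> A \<notin> reachable G" if "\<epsilon> > 0" for \<epsilon>
    using that \<open>\<And>\<epsilon>. \<lbrakk>0 < \<epsilon>; \<And>A. \<lbrakk>A \<in> G; norm (A - mat 1) < \<epsilon>\<rbrakk> \<Longrightarrow> A \<in> reachable G\<rbrakk> \<Longrightarrow> thesis\<close> by blast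
  obtain P where P: "bounded_linear P" "\<And>x. P x \<in> lie_algebra G"
    "\<And>x y. y \<in> lie_algebra G \<Longrightarrow> (x - P x) \<bullet> y = 0"
    using orthogonal_projection_exists[OF subspace_lie_algebra] by blast
  interpret P: bounded_linear P by fact
  obtain r :: real and E :: "(real^'p^'p) \<times> real \<Rightarrow> real^'p^'p" where E:
    "r > 0" "smooth_on (ball 0 r \<times> {-2<..<2}) E"
    "\<And>X. X \<in> ball 0 r \<Longrightarrow> E (X, 0) = mat 1" "E (0, 1) = mat 1" "((\<lambda>X. E (X, 1)) has_derivative (\<lambda>V. V)) (at 0)"
    "\<And>X t. X \<in> ball 0 r \<Longrightarrow> \<bar>t\<bar> < 2 \<Longrightarrow> \<exists>J. J 0 = mat 1 \<and> J 1 = E (X, t) \<and>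
      (\<forall>s\<in>{0..1}. (J has_vector_derivative (t *\<^sub>R X) ** J s) (at s within {0..1}))"
    by (rule matrix_exponential_family) blast
  have E_G: "E (X, t) \<in> G" if "X \<in> ball 0 r" "X \<in> lie_algebra G" "\<bar>t\<bar> < 2" for X t
    using E(6)[OF that(1,3)] exponential_in_G[OF that(2)[unfolded lie_algebra_eq]] by metis
  have E_reach: "E (X, 1) \<in> reachable G" if "X \<in> ball 0 r" "X \<in> lie_algebra G" for X
  proof -
    have "smooth_on {-2<..<2} (\<lambda>t. E ((X, 0) + (0, t)))"
      by (rule smooth_on_affine[OF E(2)])
        (use that in \<open>auto intro!: bounded_linear_Pair bounded_linear_zero bounded_linear_ident\<close>)
    then show ?thesis
      unfolding reachable_def using E(3)[OF that(1)] E_G[OF that]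
      by (intro CollectI exI[of _ "{-2<..<2}"] exI[of _ "\<lambda>t. E (X, t)"]) auto
  qed
  \<comment> \<open>A chart at 1 with identity derivative: exponential along the Lie algebra, affine
    across it.\<close>
  define F where "F M = E (P M, 1) ** (mat 1 + (M - P M))" for M
  define S where "S = P -` ball 0 r"
  have S: "open S" "0 \<in> S"
    using P.continuous_on[OF continuous_on_id] E(1)
    by (auto simp: S_def P.zero continuous_on_open_vimage intro!: open_vimage)
  have F0: "F 0 = mat 1" by (simp add: F_def P.zero E(4))
  have "continuous_on S (\<lambda>M. E (P M, 1))"
    by (rule continuous_on_compose2[OF smooth_on_continuous[OF E(2)], of S "\<lambda>M. (P M, 1)"])
      (auto simp: S_def intro!: continuous_intros P.continuous_on)
  then have contF: "continuous_on S F"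
    unfolding F_def by (intro mm.continuous_on continuous_intros P.continuous_on) auto
  have "((\<lambda>M. E (P M, 1)) has_derivative P) (at 0)"
    using has_derivative_compose[of P P 0 UNIV "\<lambda>X. E (X, 1)" "\<lambda>V. V"] E(5)
      bounded_linear_imp_has_derivative[OF P(1)] by (simp add: P.zero)
  moreover have "((\<lambda>M. mat 1 + (M - P M)) has_derivative (\<lambda>M. M - P M)) (at 0)"
    by (auto intro!: derivative_eq_intros bounded_linear_imp_has_derivative P(1))
  ultimately have derF: "(F has_derivative id) (at 0)"
    using mm.FDERIV[of "\<lambda>M. E (P M, 1)" P 0 UNIV "\<lambda>M. mat 1 + (M - P M)" "\<lambda>M. M - P M"]
    by (simp add: F_def[abs_def] P.zero E(4) id_def)
  obtain C where C: "C > 0" "\<And>M. norm (M - P M) \<le> norm M * C"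
    using bounded_linear.pos_bounded[OF bounded_linear_sub[OF bounded_linear_ident P(1)]] by blast
  have "\<exists>Y. Y \<noteq> 0 \<and> norm Y < \<eta> \<and> (\<forall>X\<in>lie_algebra G. Y \<bullet> X = 0) \<and> mat 1 + Y \<in> G" if \<eta>: "\<eta> > 0" for \<eta>
  proof -
    have "0 \<in> interior (ball 0 (\<eta> / C) \<inter> S)" using S \<eta> C(1) by (simp add: interior_open open_Int)
    then have "F 0 \<in> interior (F ` (ball 0 (\<eta> / C) \<inter> S))"
      \<comment> \<open>Continuity near 0 and a right inverse of the derivative at 0 suffice for the
        image to contain a ball around 1.\<close>
      by (intro sussmann_open_mapping[OF S(1) contF S(2) derF bounded_linear_ident[folded id_def]]) auto
    then obtain \<epsilon> where "\<epsilon> > 0" "ball (mat 1) \<epsilon> \<subseteq> F ` (ball 0 (\<eta> / C) \<inter> S)"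
      unfolding mem_interior F0 by blast
    with far obtain A where A: "A \<in> G" "A \<notin> reachable G" "A \<in> F ` (ball 0 (\<eta> / C) \<inter> S)"
      by (metis (no_types, lifting) dist_commute dist_norm mem_ball subsetD)
    then obtain M where M: "norm M < \<eta> / C" "P M \<in> ball 0 r" "A = F M" by (auto simp: S_def)
    let ?Y = "M - P M" and ?E = "E (P M, 1)"
    have EG: "?E \<in> G" "?E \<in> reachable G" using E_G[OF M(2) P(2)] E_reach[OF M(2) P(2)] by auto
    \<comment> \<open>The exponential factor is reachable, so an unreachable \<open>A\<close> must
      have a nonzero normal part.\<close>
    have "?Y \<noteq> 0"
    proof
      assume "?Y = 0"
      then have "A = ?E" using M(3) by (simp add: F_def)
      then show False using EG A by simp
    qed
    moreover have "norm ?Y < \<eta>"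
    proof -
      have "norm M * C < \<eta>" using M(1) C(1) by (simp add: pos_less_divide_eq)
      then show ?thesis using C(2)[of M] by simp
    qed
    moreover have "mat 1 + ?Y \<in> G"
    proof -
      have "mat 1 + ?Y = matrix_inv ?E ** A"
        using matrix_inv(2)[OF invertible_G[OF EG(1)]] by (simp add: M(3) F_def matrix_mul_assoc)
      then show ?thesis using mult_G[OF inv_G[OF EG(1)] A(1)] by simp
    qed
    ultimately show ?thesis using P(3) by blast
  qed
  then have "\<forall>n. \<exists>Y. Y \<noteq> 0 \<and> norm Y < inverse (real (Suc n)) \<and> (\<forall>X\<in>lie_algebra G. Y \<bullet> X = 0) \<and> mat 1 + Y \<in> G"
    by simp
  then obtain Y where Y: "\<And>n. Y n \<noteq> 0" "\<And>n. norm (Y n) < inverse (real (Suc n))"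
    "\<And>n X. X \<in> lie_algebra G \<Longrightarrow> Y n \<bullet> X = 0" "\<And>n. mat 1 + Y n \<in> G" by metis
  define u where "u n = Y n /\<^sub>R norm (Y n)" for n
  have "\<forall>n. u n \<in> sphere 0 1" using Y(1) by (simp add: u_def)
  then obtain l \<sigma> where l: "l \<in> sphere 0 1" "strict_mono \<sigma>" "(u \<circ> \<sigma>) \<longlonglongrightarrow> l"
    using compact_sphere[of "0 :: real^'p^'p" 1] unfolding compact_def by meson
  have "l \<in> tangent_cone G"
    unfolding tangent_cone_def
  proof (intro CollectI allI impI)
    fix \<epsilon> :: real assume \<epsilon>: "\<epsilon> > 0"
    have "(\<lambda>n. norm (Y (\<sigma> n))) \<longlonglongrightarrow> 0"
    proof (rule Lim_null_comparison[OF _ LIMSEQ_inverse_real_of_nat])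
      have "inverse (real (Suc (\<sigma> n))) \<le> inverse (real (Suc n))" for n
        using seq_suble[OF l(2), of n] by (intro le_imp_inverse_le) auto
      then have "norm (Y (\<sigma> n)) \<le> inverse (real (Suc n))" for n
        using order_trans[OF less_imp_le[OF Y(2)]] by blast
      then show "\<forall>\<^sub>F n in sequentially. norm (norm (Y (\<sigma> n))) \<le> inverse (real (Suc n))"
        by simp
    qed
    then have "\<forall>\<^sub>F n in sequentially. norm (Y (\<sigma> n)) < \<epsilon>" using \<epsilon> order_tendstoD(2) by blast
    moreover have "\<forall>\<^sub>F n in sequentially. dist ((u \<circ> \<sigma>) n) l < \<epsilon>" using l(3) \<epsilon> tendstoD by blast
    ultimately have "\<forall>\<^sub>F n in sequentially. norm (Y (\<sigma> n)) < \<epsilon> \<and> dist ((u \<circ> \<sigma>) n) l < \<epsilon>" by eventually_elim auto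
    then obtain n where n: "norm (Y (\<sigma> n)) < \<epsilon>" "norm (u (\<sigma> n) - l) < \<epsilon>"
      unfolding eventually_sequentially by (auto simp: dist_norm)
    \<comment> \<open>The secant from 1 to \<open>1 + Y\<close> has this length and a direction
      close to \<open>l\<close>.\<close>
    let ?h = "norm (Y (\<sigma> n))"
    have "mat 1 + Y (\<sigma> n) - mat 1 - ?h *\<^sub>R l = ?h *\<^sub>R (u (\<sigma> n) - l)"
      using Y(1) by (simp add: u_def algebra_simps)
    then have "norm (mat 1 + Y (\<sigma> n) - mat 1 - ?h *\<^sub>R l) = ?h * norm (u (\<sigma> n) - l)" by simp
    also have "\<dots> \<le> \<epsilon> * ?h" using n(2) by (simp add: mult.commute[of \<epsilon>] mult_left_mono)
    finally show "\<exists>h\<in>{0<..<\<epsilon>}. \<exists>A\<in>G. norm (A - mat 1 - h *\<^sub>R l) \<le> \<epsilon> * h"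
      using n(1) Y(1,4) by (intro bexI[of _ ?h] bexI[of _ "mat 1 + Y (\<sigma> n)"]) auto
  qed
  then have "l \<in> lie_algebra G" by (simp add: lie_algebra_eq)
  then have "(u \<circ> \<sigma>) n \<bullet> l = 0" for n using Y(3) by (simp add: u_def)
  then have "(\<lambda>n. (u \<circ> \<sigma>) n \<bullet> l) \<longlonglongrightarrow> 0" by simp
  moreover have "(\<lambda>n. (u \<circ> \<sigma>) n \<bullet> l) \<longlonglongrightarrow> l \<bullet> l" by (intro tendsto_intros l(3))
  ultimately have "l \<bullet> l = 0" by (rule LIMSEQ_unique[symmetric])
  then show False using l(1) by simp
qed

text \<open>Nearby elements of \<open>G\<close> differ by a factor \<open>U\<close> near 1, so the
  reachable set and its complement are both open in \<open>G\<close>.\<close>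

lemma reachable_eq:
  assumes "connected G" shows "reachable G = G"
proof -
  obtain \<epsilon> where \<epsilon>: "\<epsilon> > 0" "\<And>A. A \<in> G \<Longrightarrow> norm (A - mat 1) < \<epsilon> \<Longrightarrow> A \<in> reachable G"
    using reachable_near_one by blast
  obtain C \<delta> where C: "C > 0" "\<delta> > 0"
    "\<And>A :: real^'p^'p. invertible A \<Longrightarrow> norm (A - mat 1) < \<delta> \<Longrightarrow> norm (matrix_inv A - mat 1) \<le> C * norm (A - mat 1)"
    using matrix_inv_near_one by metis
  obtain c where c: "c > 0" "\<And>M N. norm (M ** N) \<le> norm (M :: real^'p^'p) * norm (N :: real^'p^'p) * c"
    using mm.pos_bounded by blast
  have loc: "\<exists>e>0. \<forall>A'\<in>G. dist A' A < e \<longrightarrow> (A' \<in> reachable G \<longleftrightarrow> A \<in> reachable G)" if A: "A \<in> G" for A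
  proof -
    \<comment> \<open>Puts both \<open>U\<close> and its inverse within \<epsilon> of 1, so that
      products transfer reachability from \<open>A\<close> to \<open>A'\<close> and back.\<close>
    define d where "d = min \<delta> (min \<epsilon> (\<epsilon> / C))"
    have d: "d > 0" using \<epsilon>(1) C by (simp add: d_def)
    define k where "k = (norm (matrix_inv A) + 1) * c"
    have k: "k > 0" using c(1) by (auto simp: k_def intro!: mult_pos_pos add_nonneg_pos)
    note iA = matrix_inv[OF invertible_G[OF A]]
    have "A' \<in> reachable G \<longleftrightarrow> A \<in> reachable G" if A': "A' \<in> G" "dist A' A < d / k" for A'
    proof -
      define U where "U = matrix_inv A ** A'"
      have UG: "U \<in> G" using A A' mult_G inv_G by (simp add: U_def)
      note iU = matrix_inv[OF invertible_G[OF UG]]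
      have AU: "A ** U = A'" using iA by (simp add: U_def matrix_mul_assoc)
      then have AU': "A' ** matrix_inv U = A" using iU by (metis matrix_mul_assoc matrix_mul_rid)
      have "U - mat 1 = matrix_inv A ** (A' - A)" using iA by (simp add: U_def mm.diff_right)
      then have "norm (U - mat 1) \<le> norm (matrix_inv A) * norm (A' - A) * c" using c(2) by metis
      also have "\<dots> \<le> k * norm (A' - A)" using c(1) by (simp add: k_def algebra_simps)
      also have "\<dots> < d" using A'(2) k by (simp add: dist_norm pos_less_divide_eq mult.commute)
      finally have U1: "norm (U - mat 1) < d" .
      have "norm (matrix_inv U - mat 1) \<le> C * norm (U - mat 1)"
        using C(3)[OF invertible_G[OF UG]] U1 by (simp add: d_def)
      also have "\<dots> < \<epsilon>" using U1 C(1) by (simp add: d_def pos_less_divide_eq mult.commute)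
      finally have "matrix_inv U \<in> reachable G" using \<epsilon>(2) inv_G UG by blast
      moreover have "U \<in> reachable G" using \<epsilon>(2)[OF UG] U1 by (simp add: d_def)
      ultimately show ?thesis using reachable_mult AU AU' by metis
    qed
    then show ?thesis using d k by (intro exI[of _ "d / k"]) auto
  qed
  have "openin (top_of_set G) (reachable G)"
    unfolding openin_euclidean_subtopology_iff using reachable_subset loc by blast
  moreover have "openin (top_of_set G) (G - reachable G)"
    unfolding openin_euclidean_subtopology_iff using loc by blast
  ultimately have "reachable G = {} \<or> reachable G = G"
    using assms reachable_subset unfolding connected_clopen closedin_def by auto
  then show ?thesis using one_reachable by blast
qed

end

section \<open>Vanishing second derivatives\<close>

text \<open>The embedding of a vector as \<open>j\<close>-th column. Through it, derivatives and
  continuity of \<open>matrix (f t)\<close> reduce to those of the values on basis vectors.\<close>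

definition column :: "'n \<Rightarrow> real^'m \<Rightarrow> real^'n^'m" where
  "column j w = (\<chi> i k. if k = j then w $ i else 0)"

lemma bounded_linear_column: "bounded_linear (column j :: real^'m \<Rightarrow> real^'n^'m)"
proof -
  have "linear (column j :: real^'m \<Rightarrow> real^'n^'m)"
    by (rule linearI) (auto simp: column_def vec_eq_iff)
  then show ?thesis by (rule linear_conv_bounded_linear[THEN iffD1])
qed

lemma matrix_eq_sum_column: "matrix f = (\<Sum>j\<in>UNIV. column j (f (axis j 1)))"
  by (simp add: matrix_def column_def vec_eq_iff)

lemma matrix_has_vector_derivative:
  fixes f :: "real \<Rightarrow> real^'n \<Rightarrow> real^'m"
  assumes "\<And>v. ((\<lambda>t. f t v) has_vector_derivative f' v) (at s within S)"
  shows "((\<lambda>t. matrix (f t)) has_vector_derivative matrix f') (at s within S)"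
  unfolding matrix_eq_sum_column
  by (intro has_vector_derivative_sum bounded_linear.has_vector_derivative[OF bounded_linear_column] assms)

lemma matrix_continuous_on:
  fixes f :: "real \<Rightarrow> real^'n \<Rightarrow> real^'m"
  assumes "\<And>v. continuous_on S (\<lambda>t. f t v)"
  shows "continuous_on S (\<lambda>t. matrix (f t))"
  unfolding matrix_eq_sum_column
  by (intro continuous_on_sum bounded_linear.continuous_on[OF bounded_linear_column] assms)

lemma jacobian_unique:
  fixes f :: "real^'n \<Rightarrow> real^'m"
  assumes "(f has_derivative D) (at y)" shows "jacobian f (at y) = matrix D"
  using frechet_derivative_at[OF assms] by (simp add: jacobian_def)

lemma first_order_zero:
  fixes a :: "'a::real_normed_vector"
  assumes "s0 > 0" and "\<And>s. 0 < s \<Longrightarrow> s < s0 \<Longrightarrow> norm a \<le> C * s"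
  shows "a = 0"
proof -
  have "((\<lambda>s. C * s) \<longlongrightarrow> C * 0) (at_right 0)" by (intro tendsto_intros)
  moreover have "\<forall>\<^sub>F s in at_right 0. norm a \<le> C * s"
    using assms by (auto simp: eventually_at_right_field intro: exI[of _ s0])
  ultimately have "norm a \<le> C * 0" by (rule tendsto_lowerbound) simp
  then show ?thesis by simp
qed

text \<open>Uniqueness of Taylor coefficients: letting \<open>s\<close> tend to 0 kills
  \<open>a\<close>, after which one may divide by \<open>s\<close>.\<close>

lemma second_order_zero:
  fixes a b :: "'a::real_normed_vector"
  assumes s0: "s0 > 0" and le: "\<And>s. 0 < s \<Longrightarrow> s < s0 \<Longrightarrow> norm (a - s *\<^sub>R b) \<le> C * s\<^sup>2"
  shows "a = 0" "b = 0"
proof -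
  show a: "a = 0"
  proof (rule first_order_zero[of "min s0 1" _ "norm b + \<bar>C\<bar>"])
    fix s :: real assume s: "0 < s" "s < min s0 1"
    have "norm a \<le> norm (a - s *\<^sub>R b) + norm (s *\<^sub>R b)"
      using norm_triangle_ineq[of "a - s *\<^sub>R b" "s *\<^sub>R b"] by simp
    also have "\<dots> \<le> C * s\<^sup>2 + s * norm b" using le[of s] s by simp
    also have "C * s\<^sup>2 \<le> \<bar>C\<bar> * s"
      using s by (intro mult_mono) (auto simp: power2_eq_square)
    finally show "norm a \<le> (norm b + \<bar>C\<bar>) * s" by (simp add: algebra_simps)
  qed (use s0 in auto)
  show "b = 0"
  proof (rule first_order_zero[OF s0, of _ C])
    fix s :: real assume s: "0 < s" "s < s0"
    have "s * norm b \<le> s * (C * s)" using le[OF s] s a by (simp add: power2_eq_square mult_ac)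
    then show "norm b \<le> C * s" using s by simp
  qed
qed

lemma linear_near_0_cong:
  fixes f g :: "'a::real_normed_vector \<Rightarrow> 'b::real_normed_vector"
  assumes "linear f" "linear g" "\<forall>\<^sub>F y in nhds 0. f y = g y"
  shows "f = g"
proof
  fix v :: 'a
  obtain d where d: "d > 0" "\<And>y. dist y 0 < d \<Longrightarrow> f y = g y"
    using assms(3) unfolding eventually_nhds_metric by blast
  define s where "s = d / (2 * (norm v + 1))"
  have n: "norm v + 1 > 0" by (intro add_nonneg_pos) auto
  have s: "s > 0" using d(1) n by (simp add: s_def)
  have "norm (s *\<^sub>R v) \<le> s * (norm v + 1)" using s by (simp add: mult_left_mono)
  also have "\<dots> = d / 2" using n by (simp add: s_def divide_simps)
  finally have "dist (s *\<^sub>R v) 0 < d" using d(1) by simp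
  then have "f (s *\<^sub>R v) = g (s *\<^sub>R v)" by (rule d(2))
  then show "f v = g v" using s by (simp add: linear_scale[OF assms(1)] linear_scale[OF assms(2)])
qed

lemma eventually_scaled:
  fixes v :: "'a::real_normed_vector"
  assumes "\<forall>\<^sub>F y in nhds 0. P y"
  obtains s0 :: real where "s0 > 0" "\<And>s. 0 < s \<Longrightarrow> s < s0 \<Longrightarrow> P (s *\<^sub>R v)"
proof -
  have "((\<lambda>s. s *\<^sub>R v) \<longlongrightarrow> 0 *\<^sub>R v) (at_right 0)" by (intro tendsto_intros)
  then have "\<forall>\<^sub>F s in at_right 0. P (s *\<^sub>R v)"
    using assms by (simp add: filterlim_iff)
  then show ?thesis using that unfolding eventually_at_right_field by auto
qed

text \<open>On a ball, a vanishing derivative means constancy. This is applied to each directional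
  derivative of \<open>f\<close>, then to \<open>f\<close> minus its linear part.\<close>

lemma linear_near_0_if_second_derivative_zero:
  fixes f :: "'a::euclidean_space \<Rightarrow> 'b::euclidean_space"
  assumes S: "open S" "0 \<in> S" and f: "smooth_on S f" "f 0 = 0"
    and zero: "\<And>y v w. y \<in> S \<Longrightarrow> frechet_derivative (\<lambda>z. frechet_derivative f (at z) w) (at y) v = 0"
  shows "\<forall>\<^sub>F y in nhds 0. f y = frechet_derivative f (at 0) y"
proof -
  obtain e where e: "e > 0" "ball 0 e \<subseteq> S" using S open_contains_ball by blast
  have const: "g y = g 0" if g: "\<And>y. y \<in> ball 0 e \<Longrightarrow> (g has_derivative (\<lambda>_. 0)) (at y)" and y: "y \<in> ball 0 e"
    for g :: "'a \<Rightarrow> 'b" and y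
    using has_derivative_zero_constant[OF convex_ball, of 0 e g] g y e(1)
    by (metis centre_in_ball has_derivative_at_withinI)
  have D: "frechet_derivative f (at y) w = frechet_derivative f (at 0) w" if "y \<in> ball 0 e" for y w
  proof (rule const[OF _ that])
    fix y :: 'a assume "y \<in> ball 0 e"
    then have y: "y \<in> S" using e by blast
    have "frechet_derivative (\<lambda>z. frechet_derivative f (at z) w) (at y) = (\<lambda>_. 0)"
      using zero[OF y] by blast
    then show "((\<lambda>y. frechet_derivative f (at y) w) has_derivative (\<lambda>_. 0)) (at y)"
      using smooth_on_has_derivative[OF smooth_on_deriv[OF f(1)] y, of w] by simp
  qed
  have f0: "(f has_derivative frechet_derivative f (at 0)) (at 0)"
    using smooth_on_has_derivative f S by blast
  have "f y - frechet_derivative f (at 0) y = f 0 - frechet_derivative f (at 0) 0" if "y \<in> ball 0 e" for y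
  proof (rule const[OF _ that])
    fix y :: 'a assume y: "y \<in> ball 0 e"
    have "((\<lambda>y. f y - frechet_derivative f (at 0) y) has_derivative
        (\<lambda>w. frechet_derivative f (at y) w - frechet_derivative f (at 0) w)) (at y)"
      using y e by (intro has_derivative_diff smooth_on_has_derivative[OF f(1)]
          bounded_linear_imp_has_derivative has_derivative_bounded_linear[OF f0]) auto
    then show "((\<lambda>y. f y - frechet_derivative f (at 0) y) has_derivative (\<lambda>_. 0)) (at y)" by (simp add: D[OF y])
  qed
  then have "f y = frechet_derivative f (at 0) y" if "y \<in> ball 0 e" for y
    using that f(2) linear_0[OF has_derivative_linear[OF f0]] by fastforce
  then show ?thesis
    using e(1) by (intro eventually_nhds[THEN iffD2] exI[of _ "ball 0 e"]) auto
qed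

section \<open>Consequences of a trivial prolongation\<close>

lemma subspace_derivative:
  fixes \<gamma> :: "real \<Rightarrow> 'a::euclidean_space"
  assumes V: "subspace V" and \<gamma>: "(\<gamma> has_vector_derivative X) (at 0)" "\<forall>\<^sub>F t in nhds 0. \<gamma> t \<in> V"
  shows "X \<in> V"
proof -
  have "((\<lambda>t. (\<gamma> t - \<gamma> 0) /\<^sub>R t) \<longlongrightarrow> X) (at 0)"
  proof -
    have "((\<lambda>t. norm (\<gamma> t - \<gamma> 0 - t *\<^sub>R X) / norm t) \<longlongrightarrow> 0) (at 0)"
      using \<gamma>(1) by (simp add: has_vector_derivative_def has_derivative_at)
    moreover have "\<forall>\<^sub>F t in at 0. norm (\<gamma> t - \<gamma> 0 - t *\<^sub>R X) / norm t = norm ((\<gamma> t - \<gamma> 0) /\<^sub>R t - X)"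
    proof (rule eventually_at_filter[THEN iffD2], intro always_eventually allI impI)
      fix t :: real assume t: "t \<noteq> 0"
      then have "(\<gamma> t - \<gamma> 0) /\<^sub>R t - X = (\<gamma> t - \<gamma> 0 - t *\<^sub>R X) /\<^sub>R t" by (simp add: scaleR_diff_right)
      then show "norm (\<gamma> t - \<gamma> 0 - t *\<^sub>R X) / norm t = norm ((\<gamma> t - \<gamma> 0) /\<^sub>R t - X)"
        by (simp add: divide_inverse mult.commute)
    qed
    ultimately have "((\<lambda>t. norm ((\<gamma> t - \<gamma> 0) /\<^sub>R t - X)) \<longlongrightarrow> 0) (at 0)"
      using tendsto_cong by fast
    then show ?thesis using LIM_zero_cancel tendsto_norm_zero_iff by blast
  qed
  moreover have "\<forall>\<^sub>F t in at 0. (\<gamma> t - \<gamma> 0) /\<^sub>R t \<in> V"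
  proof -
    have "\<gamma> 0 \<in> V" using eventually_nhds_x_imp_x[OF \<gamma>(2)] .
    moreover have "\<forall>\<^sub>F t in at 0. \<gamma> t \<in> V" using \<gamma>(2) by (simp add: eventually_nhds_conv_at)
    ultimately show ?thesis by (auto elim!: eventually_mono intro!: subspace_scale subspace_diff V)
  qed
  ultimately show ?thesis
    using Lim_in_closed_set[OF closed_subspace[OF V]] by (metis trivial_limit_at)
qed

definition trivial_prolongation :: "(real^'p^'p) set \<Rightarrow> bool" where
  "trivial_prolongation V \<longleftrightarrow> (\<forall>B. bounded_bilinear B \<longrightarrow> (\<forall>x y. B x y = B y x) \<longrightarrow>
     (\<forall>x. matrix (B x) \<in> V) \<longrightarrow> (\<forall>x y. B x y = (0 :: real^'p)))"

text \<open>\<open>(v, w) \<mapsto> M D^2 f (v, w)\<close> is a symmetric bilinear map of the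
  prolongation. The factor \<open>M\<close> is the inverse Jacobian for diffeomorphisms and the
  identity for vector fields.\<close>

lemma second_derivative_zero:
  fixes f :: "real^'p \<Rightarrow> real^'p"
  assumes triv: "trivial_prolongation V" and S: "open S" "y \<in> S" and f: "smooth_on S f"
    and M: "invertible M"
    and V: "\<And>v. M ** matrix (\<lambda>w. frechet_derivative (\<lambda>z. frechet_derivative f (at z) w) (at y) v) \<in> V"
  shows "frechet_derivative (\<lambda>z. frechet_derivative f (at z) w) (at y) v = 0"
proof -
  define Q where "Q v w = frechet_derivative (\<lambda>z. frechet_derivative f (at z) w) (at y) v" for v w
  have lin: "linear (\<lambda>v. Q v w)" for w
    unfolding Q_def using has_derivative_linear[OF smooth_on_has_derivative[OF smooth_on_deriv[OF f] S(2)]] .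
  have sym: "Q v w = Q w v" for v w
    unfolding Q_def by (rule second_derivative_symmetric[OF f S])
  have lin': "linear (Q v)" for v
  proof -
    have "Q v = (\<lambda>w. Q w v)" by (rule ext) (rule sym)
    then show ?thesis using lin[of v] by simp
  qed
  define B where "B v w = M *v Q v w" for v w
  have "bilinear B"
    unfolding bilinear_def B_def
    using linear_compose[OF lin matrix_vector_mul_linear[of M]]
      linear_compose[OF lin' matrix_vector_mul_linear[of M]] by (simp add: o_def)
  then have "bounded_bilinear B" by (simp add: bilinear_conv_bounded_bilinear)
  moreover have "B v w = B w v" for v w by (simp add: B_def sym)
  moreover have "matrix (B v) \<in> V" for v
  proof -
    have "matrix (B v) = M ** matrix (Q v)"
      unfolding B_def using matrix_compose[OF lin', of "(*v) M" v] by (simp add: o_def)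
    then show ?thesis using V[of v] by (simp add: Q_def[abs_def])
  qed
  ultimately have "B v w = 0" using triv unfolding trivial_prolongation_def by blast
  then have "matrix_inv M *v (M *v Q v w) = 0" by (simp add: B_def)
  then show ?thesis using matrix_inv(2)[OF M] by (simp add: matrix_vector_mul_assoc Q_def)
qed

lemma jacobian_line_derivative:
  fixes f :: "real^'n \<Rightarrow> real^'m"
  assumes "smooth_on S f" "y \<in> S"
  shows "((\<lambda>t. jacobian f (at (y + t *\<^sub>R v))) has_vector_derivative
    matrix (\<lambda>w. frechet_derivative (\<lambda>z. frechet_derivative f (at z) w) (at y) v)) (at 0)"
  unfolding jacobian_def
proof (rule matrix_has_vector_derivative)
  fix w
  let ?g = "\<lambda>z. frechet_derivative f (at z) w"
  have d: "(?g has_derivative frechet_derivative ?g (at y)) (at (y + 0 *\<^sub>R v))"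
    using smooth_on_has_derivative[OF smooth_on_deriv[OF assms(1)] assms(2)] by simp
  have "((\<lambda>t. y + t *\<^sub>R v) has_derivative (\<lambda>t. t *\<^sub>R v)) (at 0)" by (auto intro!: derivative_eq_intros)
  from has_derivative_compose[OF this d]
  show "((\<lambda>t. ?g (y + t *\<^sub>R v)) has_vector_derivative frechet_derivative ?g (at y) v) (at 0)"
    using linear_scale[OF has_derivative_linear[OF d]] by (simp add: has_vector_derivative_def)
qed

lemma line_eventually:
  fixes y v :: "'a::real_normed_vector"
  assumes "open S" "y \<in> S"
  shows "\<forall>\<^sub>F t in nhds (0::real). y + t *\<^sub>R v \<in> S"
proof -
  have "((\<lambda>t. y + t *\<^sub>R v) \<longlongrightarrow> y + 0 *\<^sub>R v) (nhds 0)"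
    by (intro tendsto_intros filterlim_ident)
  then show ?thesis using assms topological_tendstoD by fastforce
qed

lemma eventually_nhds_jacobian:
  assumes "smooth_near_0 f" "\<forall>\<^sub>F y in nhds 0. jacobian f (at y) \<in> V"
  obtains S where "open S" "0 \<in> S" "smooth_on S f" "\<And>y. y \<in> S \<Longrightarrow> jacobian f (at y) \<in> V"
proof -
  obtain U where U: "open U" "0 \<in> U" "smooth_on U f" using assms(1) unfolding smooth_near_0_def by blast
  obtain N where N: "open N" "0 \<in> N" "\<And>y. y \<in> N \<Longrightarrow> jacobian f (at y) \<in> V"
    using assms(2) unfolding eventually_nhds by blast
  show ?thesis by (rule that[of "U \<inter> N"]) (use U N smooth_on_subset[OF U(3)] in auto)
qed

lemma linear_germ_inject: "linear_germ A = linear_germ B \<longleftrightarrow> A = B"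
proof
  assume "linear_germ A = linear_germ B"
  then have "(*v) A = (*v) B"
    unfolding linear_germ_def germ_of_eq_iff
    by (intro linear_near_0_cong matrix_vector_mul_linear) auto
  then show "A = B" by (metis matrix_of_matrix_vector_mul)
qed simp

lemma linear_germ_eqI:
  fixes f :: "real^'p \<Rightarrow> real^'p"
  assumes "linear L" "\<forall>\<^sub>F y in nhds 0. f y = L y"
  shows "germ_of f = linear_germ (matrix L)"
  unfolding linear_germ_def germ_of_eq_iff using assms by (simp add: matrix_works)

lemma jacobian_matrix_vector: "jacobian ((*v) A) (at y) = A" for A :: "real^'n^'m"
  using jacobian_unique[OF bounded_linear_imp_has_derivative[OF matrix_vector_mul_bounded_linear, of A]]
  by simp

lemma linear_germ_in_theta0:
  assumes "X \<in> lie_algebra G" shows "linear_germ X \<in> theta0 G"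
  unfolding theta0_def linear_germ_def map_germ_def smooth_near_0_def
  using assms
  by (intro CollectI exI[of _ "(*v) X"] conjI exI[of _ UNIV] smooth_on_linear)
    (auto simp: jacobian_matrix_vector)

section \<open>Germs with Jacobian in the group or its Lie algebra\<close>

lemma matrix_linear_apply:
  fixes f :: "real^'n \<Rightarrow> real^'m"
  assumes "linear f" shows "matrix f *v x = f x"
  using matrix_vector_mul[of f] assms by (metis linear_conv_bounded_linear)

context lin_group
begin

lemma Diff_linear:
  assumes triv: "trivial_prolongation (lie_algebra G)" shows "Diff G \<subseteq> linear_germ ` G"
proof
  fix \<theta> assume "\<theta> \<in> Diff G"
  then obtain \<psi> where \<psi>: "\<theta> = germ_of \<psi>" "diffeo_germ \<psi>" "\<forall>\<^sub>F y in nhds 0. jacobian \<psi> (at y) \<in> G"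
    unfolding Diff_def by blast
  have "smooth_near_0 \<psi>" "\<psi> 0 = 0" using \<psi>(2) unfolding diffeo_germ_def smooth_near_0_def by blast+
  obtain S where S: "open S" "0 \<in> S" "smooth_on S \<psi>" "\<And>y. y \<in> S \<Longrightarrow> jacobian \<psi> (at y) \<in> G"
    using eventually_nhds_jacobian[OF \<open>smooth_near_0 \<psi>\<close> \<psi>(3)] by blast
  have "frechet_derivative (\<lambda>z. frechet_derivative \<psi> (at z) w) (at y) v = 0" if y: "y \<in> S" for y v w
  proof (rule second_derivative_zero[OF triv S(1) y S(3)])
    let ?M = "matrix_inv (jacobian \<psi> (at y))"
    note inv = matrix_inv[OF invertible_G[OF S(4)[OF y]]]
    show "invertible ?M" using invertible_G inv_G S(4) y by blast
    fix v
    \<comment> \<open>The Jacobian along a line, left-translated by its inverse at \<open>y\<close>,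
      is a curve in \<open>G\<close> through 1; its velocity is the matrix in question.\<close>
    show "?M ** matrix (\<lambda>w. frechet_derivative (\<lambda>z. frechet_derivative \<psi> (at z) w) (at y) v) \<in> lie_algebra G"
      unfolding lie_algebra_eq
    proof (rule curve_in_tangent_cone[of "\<lambda>t. ?M ** jacobian \<psi> (at (y + t *\<^sub>R v))"])
      show "((\<lambda>t. ?M ** jacobian \<psi> (at (y + t *\<^sub>R v))) has_vector_derivative
          ?M ** matrix (\<lambda>w. frechet_derivative (\<lambda>z. frechet_derivative \<psi> (at z) w) (at y) v)) (at 0)"
        by (rule bounded_linear.has_vector_derivative[OF mm.bounded_linear_right
              jacobian_line_derivative[OF S(3) y]])
      show "?M ** jacobian \<psi> (at (y + 0 *\<^sub>R v)) = mat 1" using inv by simp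
      show "\<forall>\<^sub>F t in nhds 0. ?M ** jacobian \<psi> (at (y + t *\<^sub>R v)) \<in> G"
        using line_eventually[OF S(1) y, of v]
        by eventually_elim (use mult_G inv_G S(4) y in blast)
    qed
  qed
  then have "\<forall>\<^sub>F y in nhds 0. \<psi> y = frechet_derivative \<psi> (at 0) y"
    using linear_near_0_if_second_derivative_zero S \<open>\<psi> 0 = 0\<close> by blast
  moreover have "linear (frechet_derivative \<psi> (at 0))"
    using smooth_on_has_derivative[OF S(3,2)] has_derivative_linear by blast
  ultimately have "\<theta> = linear_germ (jacobian \<psi> (at 0))"
    unfolding \<psi>(1) jacobian_def by (intro linear_germ_eqI)
  then show "\<theta> \<in> linear_germ ` G" using S(2,4) by blast
qed

text \<open>The Lie algebra is a linear space, so derivatives of the Jacobian stay in it without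
  translation.\<close>

lemma theta0_linear:
  assumes triv: "trivial_prolongation (lie_algebra G)" shows "theta0 G \<subseteq> linear_germ ` lie_algebra G"
proof
  fix \<theta> assume "\<theta> \<in> theta0 G"
  then obtain \<eta> where \<eta>: "\<theta> = germ_of \<eta>" "smooth_near_0 \<eta>" "\<eta> 0 = 0"
      "\<forall>\<^sub>F y in nhds 0. jacobian \<eta> (at y) \<in> lie_algebra G"
    unfolding theta0_def map_germ_def by blast
  obtain S where S: "open S" "0 \<in> S" "smooth_on S \<eta>" "\<And>y. y \<in> S \<Longrightarrow> jacobian \<eta> (at y) \<in> lie_algebra G"
    using eventually_nhds_jacobian[OF \<eta>(2,4)] by blast
  have "frechet_derivative (\<lambda>z. frechet_derivative \<eta> (at z) w) (at y) v = 0" if y: "y \<in> S" for y v w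
  proof (rule second_derivative_zero[OF triv S(1) y S(3), of "mat 1"])
    show "invertible (mat 1 :: real^'p^'p)" using invertible_G one_G by blast
    fix v
    have "\<forall>\<^sub>F t in nhds 0. jacobian \<eta> (at (y + t *\<^sub>R v)) \<in> lie_algebra G"
      using line_eventually[OF S(1) y, of v] by eventually_elim (rule S(4))
    from subspace_derivative[OF subspace_lie_algebra jacobian_line_derivative[OF S(3) y] this]
    show "mat 1 ** matrix (\<lambda>w. frechet_derivative (\<lambda>z. frechet_derivative \<eta> (at z) w) (at y) v) \<in> lie_algebra G"
      by simp
  qed
  then have "\<forall>\<^sub>F y in nhds 0. \<eta> y = frechet_derivative \<eta> (at 0) y"
    using linear_near_0_if_second_derivative_zero S \<eta>(3) by blast
  moreover have "linear (frechet_derivative \<eta> (at 0))"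
    using smooth_on_has_derivative[OF S(3,2)] has_derivative_linear by blast
  ultimately have "\<theta> = linear_germ (jacobian \<eta> (at 0))"
    unfolding \<eta>(1) jacobian_def by (intro linear_germ_eqI)
  then show "\<theta> \<in> linear_germ ` lie_algebra G" using S(2,4) by blast
qed

lemma linear_in_Diff:
  assumes "A \<in> G" shows "linear_germ A \<in> Diff G"
proof -
  note inv = matrix_inv[OF invertible_G[OF assms]]
  have "homeomorphism UNIV UNIV ((*v) A) ((*v) (matrix_inv A))"
    by (rule homeomorphismI) (auto simp: matrix_vector_mul_assoc inv linear_continuous_on)
  then have "diffeo_germ ((*v) A)"
    unfolding diffeo_germ_def
    by (intro conjI exI[of _ UNIV] exI[of _ "(*v) (matrix_inv A)"] smooth_on_linear) auto
  then show ?thesis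
    unfolding Diff_def linear_germ_def using assms
    by (intro CollectI exI[of _ "(*v) A"]) (auto simp: jacobian_matrix_vector)
qed

text \<open>A smooth path \<alpha> in \<open>G\<close> from 1 to \<open>A\<close> gives the isotopy
  \<open>\<alpha> t *v y\<close>.\<close>

lemma linear_in_Diff0:
  assumes "connected G" "A \<in> G" shows "linear_germ A \<in> Diff0 G"
proof -
  obtain T \<alpha> where \<alpha>: "open T" "{0..1} \<subseteq> T" "smooth_on T \<alpha>" "\<And>t. t \<in> {0..1::real} \<Longrightarrow> \<alpha> t \<in> G"
    "\<alpha> 0 = mat 1" "\<alpha> 1 = A"
    using assms reachable_eq unfolding reachable_def by blast
  define \<Psi> where "\<Psi> z = \<alpha> (snd z) *v fst z" for z :: "(real^'p) \<times> real"
  have op: "open (UNIV \<times> T :: ((real^'p) \<times> real) set)" using \<alpha>(1) open_Times by blast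
  have "smooth_on (UNIV \<times> T :: ((real^'p) \<times> real) set) (\<lambda>z. \<alpha> (0 + snd z))"
    by (rule smooth_on_affine[OF \<alpha>(3) bounded_linear_snd op]) auto
  then have "smooth_on (UNIV \<times> T) \<Psi>"
    unfolding \<Psi>_def
    by (intro smooth_on_bilinear[OF bounded_bilinear_matrix_vector op]
        smooth_on_linear[OF bounded_linear_fst op]) simp
  moreover have "germ_of (\<lambda>y. \<Psi> (y, t)) = linear_germ (\<alpha> t)" for t by (simp add: \<Psi>_def linear_germ_def)
  ultimately show ?thesis
    unfolding Diff0_def using op \<alpha> linear_in_Diff assms(2)
    by (intro CollectI conjI exI[of _ \<Psi>] exI[of _ "UNIV \<times> T"])
      (auto simp: \<Psi>_def linear_germ_def)
qed

section \<open>Quadratic flows as diffeomorphism germs\<close>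

text \<open>Along an orbit the Jacobian solves the variational equation
  \<open>J' = 2 t B(x s, _) J\<close>, whose coefficients lie in the Lie algebra, so the invariance
  theorem applies.\<close>

lemma quadratic_flow_in_G:
  fixes B :: "real^'p \<Rightarrow> real^'p \<Rightarrow> real^'p"
  assumes "quadratic_flow B K" and B: "\<And>x. matrix (B x) \<in> lie_algebra G"
    and z: "(y, t) \<in> quadratic_fixpoint.W K"
  shows "jacobian (\<lambda>y. quadratic_flow.flow B K (y, t)) (at y) \<in> G"
proof -
  interpret quadratic_flow B K by fact
  interpret B: bounded_bilinear B by (rule B_bil)
  define w where "w s v = apply_bcontfun (lsol (y, t) (const_bcontfun v)) s" for s v
  define A where "A s = (2 * t) *\<^sub>R matrix (B (sol (y, t) s))" for s
  have lin: "linear (w s)" for s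
  proof (rule linearI)
    fix a b :: "real^'p" and r :: real
    have "const_bcontfun (a + b) = (const_bcontfun a + const_bcontfun b :: real \<Rightarrow>\<^sub>C (real^'p))"
      by (rule bcontfun_eqI) simp
    then show "w s (a + b) = w s a + w s b" by (simp add: w_def lsol_add[OF z])
    have "const_bcontfun (r *\<^sub>R a) = (r *\<^sub>R const_bcontfun a :: real \<Rightarrow>\<^sub>C (real^'p))"
      by (rule bcontfun_eqI) simp
    then show "w s (r *\<^sub>R a) = r *\<^sub>R w s a" by (simp add: w_def lsol_scaleR[OF z])
  qed
  have linB: "linear (B x)" for x
    using B.bounded_linear_right bounded_linear.linear by blast
  have "matrix (w 1) \<in> G"
  proof (rule G_invariant[of A])
    have "continuous_on {0..1} (\<lambda>s. matrix (B (sol (y, t) s)))"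
      by (intro matrix_continuous_on B.continuous_on continuous_on_apply_bcontfun continuous_on_const)
    then show "continuous_on {0..1} A" unfolding A_def by (intro continuous_intros)
    show "A s \<in> tangent_cone G" for s
      unfolding A_def using B tangent_cone_scaleR lie_algebra_eq by blast
    have "w 0 = (\<lambda>v. v)" unfolding w_def using variation_path(1)[OF z] by blast
    then show "matrix (w 0) = mat 1" by (simp add: matrix_def mat_def axis_def vec_eq_iff)
    fix s :: real assume s: "s \<in> {0..1}"
    have "((\<lambda>s. matrix (w s)) has_vector_derivative matrix (\<lambda>v. (2 * t) *\<^sub>R B (sol (y, t) s) (w s v)))
        (at s within {0..1})"
      using variation_path(2)[OF z s] by (intro matrix_has_vector_derivative) (simp add: w_def)
    also have "matrix (\<lambda>v. (2 * t) *\<^sub>R B (sol (y, t) s) (w s v)) = A s ** matrix (w s)"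
    proof -
      have "A s ** matrix (w s) *v v = (2 * t) *\<^sub>R B (sol (y, t) s) (w s v)" for v
        by (simp add: A_def matrix_linear_apply[OF lin] matrix_linear_apply[OF linB] matrix_vector_mul_assoc[symmetric]
            scaleR_matrix_vector_assoc[symmetric])
      then show ?thesis by (metis (no_types, lifting) matrix_of_matrix_vector_mul matrix_eq ext)
    qed
    finally show "((\<lambda>s. matrix (w s)) has_vector_derivative A s ** matrix (w s)) (at s within {0..1})" .
  qed
  moreover have "jacobian (\<lambda>y. flow (y, t)) (at y) = matrix (w 1)"
    using jacobian_unique[OF flow_space_derivative[OF z]] by (simp add: w_def[abs_def])
  ultimately show ?thesis by simp
qed

lemma quadratic_flow_diffeo_germ:
  assumes "quadratic_flow (B :: real^'p \<Rightarrow> real^'p \<Rightarrow> real^'p) K" and t: "\<bar>t\<bar> < 2"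
  shows "diffeo_germ (\<lambda>y. quadratic_flow.flow B K (y, t))"
proof -
  interpret quadratic_flow B K by fact
  have W: "(y, t) \<in> W \<longleftrightarrow> y \<in> ball 0 (\<rho> / 2)" if "\<bar>t\<bar> < 2" for y and t :: real
    using that by (auto simp: W_def)
  \<comment> \<open>Points whose image is again small enough to flow back; the times
    \<open>t\<close> and \<open>- t\<close> then exchange \<open>U t\<close> and
    \<open>U (- t)\<close>.\<close>
  define U where "U t = {y \<in> ball 0 (\<rho> / 2). flow (y, t) \<in> ball 0 (\<rho> / 2)}" for t
  have sm: "smooth_on (ball 0 (\<rho> / 2)) (\<lambda>y. flow (y, t))" if "\<bar>t\<bar> < 2" for t
  proof -
    have "smooth_on (ball 0 (\<rho> / 2)) (\<lambda>y. flow ((0, t) + (y, 0)))"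
      by (rule smooth_on_affine[OF flow_smooth])
        (use W[OF that] in \<open>auto intro!: bounded_linear_Pair bounded_linear_zero bounded_linear_ident\<close>)
    then show ?thesis by simp
  qed
  have opU: "open (U t)" if "\<bar>t\<bar> < 2" for t
  proof -
    have "U t = ball 0 (\<rho> / 2) \<inter> (\<lambda>y. flow (y, t)) -` ball 0 (\<rho> / 2)" by (auto simp: U_def)
    then show ?thesis
      using continuous_open_preimage[OF smooth_on_continuous[OF sm[OF that]]] by simp
  qed
  have rev: "flow (flow (y, t), - t) = y" "flow (y, t) \<in> U (- t)" if "y \<in> U t" "\<bar>t\<bar> < 2" for y t
  proof -
    have "(y, t) \<in> W" "(flow (y, t), - t) \<in> W" using that W[of t] W[of "- t"] by (auto simp: U_def)
    then show 1: "flow (flow (y, t), - t) = y" by (rule flow_reverse)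
    show "flow (y, t) \<in> U (- t)" using that 1 by (simp add: U_def)
  qed
  have smU: "smooth_on (U t) (\<lambda>y. flow (y, t))" if "\<bar>t\<bar> < 2" for t
    by (rule smooth_on_subset[OF sm[OF that]]) (auto simp: U_def)
  have t': "\<bar>- t\<bar> < 2" using t by simp
  have "homeomorphism (U t) (U (- t)) (\<lambda>y. flow (y, t)) (\<lambda>y. flow (y, - t))"
    using rev[OF _ t] rev[OF _ t'] smooth_on_continuous[OF smU[OF t]] smooth_on_continuous[OF smU[OF t']]
    by (intro homeomorphismI) auto
  moreover have "0 \<in> U t" using flow_0[OF t] \<rho>_pos by (simp add: U_def)
  ultimately show ?thesis
    unfolding diffeo_germ_def using opU[OF t] opU[OF t'] smU[OF t] smU[OF t'] flow_0[OF t] by blast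
qed

section \<open>Equivalence of the three conditions\<close>

text \<open>Condition (c) makes the time 1 map of the quadratic field linear:
  \<open>A y = y + B(y, y) + O(|y|^3)\<close>. Comparing orders along rays gives
  \<open>B(v, v) = 0\<close>, and polarisation does the rest.\<close>

lemma condition_c_imp_trivial_prolongation:
  assumes c: "condition_c G" shows "trivial_prolongation (lie_algebra G)"
  unfolding trivial_prolongation_def
proof (intro allI impI)
  fix B :: "real^'p \<Rightarrow> real^'p \<Rightarrow> real^'p" and x y
  assume bil: "bounded_bilinear B" and symB: "\<forall>x y. B x y = B y x" and B: "\<forall>x. matrix (B x) \<in> lie_algebra G"
  interpret B: bounded_bilinear B by fact
  obtain K where K: "K > 0" "\<And>x y. norm (B x y) \<le> norm x * norm y * K" using B.pos_bounded by blast
  have qf: "quadratic_flow B K"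
  proof (rule quadratic_flow.intro[OF bil _ K(1)])
    show "norm (B x y) \<le> K * norm x * norm y" for x y using K(2)[of x y] by (simp add: mult_ac)
  qed (use symB in blast)
  interpret quadratic_flow B K by (rule qf)
  have near: "\<forall>\<^sub>F y in nhds 0. (y, t) \<in> W" if "\<bar>t\<bar> < 2" for t
  proof -
    have "\<forall>\<^sub>F y in nhds 0. y \<in> ball (0 :: real^'p) (\<rho> / 2)" using \<rho>_pos by (intro eventually_nhds_in_open) auto
    then show ?thesis by eventually_elim (use that in \<open>auto simp: W_def\<close>)
  qed
  have Diff: "germ_of (\<lambda>y. flow (y, t)) \<in> Diff G" if t: "\<bar>t\<bar> < 2" for t
  proof -
    have "\<forall>\<^sub>F y in nhds 0. jacobian (\<lambda>y. flow (y, t)) (at y) \<in> G"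
      using near[OF t] by eventually_elim (rule quadratic_flow_in_G[OF qf B[rule_format]])
    then show ?thesis unfolding Diff_def using quadratic_flow_diffeo_germ[OF qf t] by blast
  qed
  have "germ_of (\<lambda>y. flow (y, 1)) \<in> Diff0 G"
  proof -
    have "germ_of (\<lambda>y. flow (y, 0)) = germ_of (\<lambda>y. y)"
      unfolding germ_of_eq_iff using near[of 0] by (auto elim!: eventually_mono intro: flow_id)
    moreover have "{0} \<times> {0..1} \<subseteq> W" using \<rho>_pos by (auto simp: W_def)
    ultimately show ?thesis
      unfolding Diff0_def using Diff flow_0 open_W flow_smooth
      by (intro CollectI conjI exI[of _ flow] exI[of _ W]) auto
  qed
  then obtain A where "germ_of (\<lambda>y. flow (y, 1)) = linear_germ A"
    using c unfolding condition_c_def by blast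
  then have "\<forall>\<^sub>F y in nhds 0. flow (y, 1) = A *v y" by (simp add: linear_germ_def germ_of_eq_iff)
  moreover have "\<forall>\<^sub>F y in nhds 0. (y, 1) \<in> W" using near[of 1] by simp
  ultimately have ev: "\<forall>\<^sub>F y in nhds 0. norm (A *v y - (y + B y y)) \<le> 12 * K\<^sup>2 * norm y ^ 3"
    by eventually_elim (metis flow_second_order)
  have diag: "B v v = 0" for v
  proof -
    obtain s0 where s0: "s0 > 0" "\<And>s. 0 < s \<Longrightarrow> s < s0 \<Longrightarrow>
        norm (A *v (s *\<^sub>R v) - (s *\<^sub>R v + B (s *\<^sub>R v) (s *\<^sub>R v))) \<le> 12 * K\<^sup>2 * norm (s *\<^sub>R v) ^ 3"
      using eventually_scaled[OF ev, of v] by blast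
    show ?thesis
    proof (rule second_order_zero(2)[OF s0(1), of "A *v v - v" "B v v" "12 * K\<^sup>2 * norm v ^ 3"])
      fix s :: real assume s: "0 < s" "s < s0"
      have "A *v (s *\<^sub>R v) - (s *\<^sub>R v + B (s *\<^sub>R v) (s *\<^sub>R v)) = s *\<^sub>R (A *v v - v - s *\<^sub>R B v v)"
        by (simp add: mv.scaleR_right B.scaleR_left B.scaleR_right algebra_simps)
      then have "s * norm (A *v v - v - s *\<^sub>R B v v) \<le> s * (12 * K\<^sup>2 * norm v ^ 3 * s\<^sup>2)"
        using s0(2)[OF s] s(1) by (simp add: power_mult_distrib power2_eq_square power3_eq_cube mult_ac)
      then show "norm (A *v v - v - s *\<^sub>R B v v) \<le> 12 * K\<^sup>2 * norm v ^ 3 * s\<^sup>2" using s(1) by simp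
    qed
  qed
  have "B x y + B y x = 0"
    using diag[of "x + y"] diag[of x] diag[of y] by (simp add: B.add_left B.add_right add.commute)
  then have "2 *\<^sub>R B x y = 0" using symB[rule_format, of y x] by (simp add: scaleR_2)
  then show "B x y = 0" by simp
qed

text \<open>The field \<open>B(y, y)\<close> has Jacobian \<open>2 B y\<close>, which lies in the
  Lie algebra; if it is linear near 0, comparing orders along rays makes it vanish.\<close>

lemma condition_b_imp_trivial_prolongation:
  assumes b: "condition_b G" shows "trivial_prolongation (lie_algebra G)"
  unfolding trivial_prolongation_def
proof (intro allI impI)
  fix B :: "real^'p \<Rightarrow> real^'p \<Rightarrow> real^'p" and x y
  assume bil: "bounded_bilinear B" and symB: "\<forall>x y. B x y = B y x" and B: "\<forall>x. matrix (B x) \<in> lie_algebra G"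
  interpret B: bounded_bilinear B by fact
  define \<eta> where "\<eta> y = B y y" for y
  have "smooth_on UNIV \<eta>"
    unfolding \<eta>_def by (intro smooth_on_bilinear[OF bil] smooth_on_linear bounded_linear_ident) auto
  moreover have "jacobian \<eta> (at y) \<in> lie_algebra G" for y
  proof -
    have "(\<eta> has_derivative (\<lambda>w. 2 *\<^sub>R B y w)) (at y)"
      unfolding \<eta>_def using B.FDERIV[OF has_derivative_ident has_derivative_ident, of y UNIV]
      by (rule has_derivative_eq_rhs) (use symB in \<open>auto simp: scaleR_2 fun_eq_iff\<close>)
    then have "jacobian \<eta> (at y) = matrix (\<lambda>w. 2 *\<^sub>R B y w)" by (rule jacobian_unique)
    also have "\<dots> = 2 *\<^sub>R matrix (B y)" by (simp add: matrix_def vec_eq_iff)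
    finally show ?thesis using B subspace_scale[OF subspace_lie_algebra] by metis
  qed
  ultimately have "germ_of \<eta> \<in> theta0 G"
    unfolding theta0_def map_germ_def smooth_near_0_def
    by (intro CollectI exI[of _ \<eta>]) (auto simp: \<eta>_def B.zero_left)
  then have lin: "\<exists>l. linear l \<and> (\<forall>\<^sub>F y in nhds 0. \<eta> y $ i = l y)" for i
    using b unfolding condition_b_def by blast
  have diag: "B v v = 0" for v
  proof (rule vec_eq_iff[THEN iffD2], rule allI)
    fix i
    obtain l where l: "linear l" "\<forall>\<^sub>F y in nhds 0. \<eta> y $ i = l y" using lin by blast
    obtain s0 where s0: "s0 > 0" "\<And>s. 0 < s \<Longrightarrow> s < s0 \<Longrightarrow> \<eta> (s *\<^sub>R v) $ i = l (s *\<^sub>R v)"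
      using eventually_scaled[OF l(2), of v] by blast
    have "B v v $ i = 0"
    proof (rule second_order_zero(2)[OF s0(1), of "l v" _ 0])
      fix s :: real assume s: "0 < s" "s < s0"
      have "s * (s * (B v v $ i)) = s * l v"
        using s0(2)[OF s] by (simp add: \<eta>_def B.scaleR_left B.scaleR_right linear_scale[OF l(1)])
      then show "norm (l v - s *\<^sub>R (B v v $ i)) \<le> 0 * s\<^sup>2" using s by simp
    qed
    then show "B v v $ i = 0 $ i" by simp
  qed
  have "B x y + B y x = 0"
    using diag[of "x + y"] diag[of x] diag[of y] by (simp add: B.add_left B.add_right add.commute)
  then have "2 *\<^sub>R B x y = 0" using symB[rule_format, of y x] by (simp add: scaleR_2)
  then show "B x y = 0" by simp
qed

lemma condition_b_iff: "condition_b G \<longleftrightarrow> theta0 G = linear_germ ` lie_algebra G"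
proof
  assume "condition_b G"
  then show "theta0 G = linear_germ ` lie_algebra G"
    using theta0_linear condition_b_imp_trivial_prolongation linear_germ_in_theta0 by blast
next
  assume eq: "theta0 G = linear_germ ` lie_algebra G"
  show "condition_b G"
    unfolding condition_b_def
  proof (intro allI impI)
    fix \<eta> i assume "germ_of \<eta> \<in> theta0 G"
    then obtain X where "germ_of \<eta> = linear_germ X" using eq by blast
    then have "\<forall>\<^sub>F y in nhds 0. \<eta> y = X *v y" by (simp add: linear_germ_def germ_of_eq_iff)
    then have "\<forall>\<^sub>F y in nhds 0. \<eta> y $ i = (X *v y) $ i" by eventually_elim simp
    moreover have "linear (\<lambda>y. (X *v y) $ i)"
      by (rule linearI) (simp_all add: mv.add_right mv.scaleR_right)
    ultimately show "\<exists>l. linear l \<and> (\<forall>\<^sub>F y in nhds 0. \<eta> y $ i = l y)" by blast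
  qed
qed

text \<open>The trivial prolongation mediates between the two; connectedness enters through the
  inclusion of \<open>G\<close> in \<open>Diff0 G\<close>.\<close>

lemma condition_b_iff_c:
  assumes "connected G" shows "condition_b G \<longleftrightarrow> condition_c G"
proof
  assume "condition_b G"
  then have "Diff G \<subseteq> linear_germ ` G" using Diff_linear condition_b_imp_trivial_prolongation by blast
  moreover have "Diff0 G \<subseteq> Diff G" by (auto simp: Diff0_def)
  ultimately show "condition_c G"
    unfolding condition_c_def using linear_in_Diff0[OF assms] by blast
next
  assume "condition_c G"
  then show "condition_b G"
    using condition_b_iff theta0_linear condition_c_imp_trivial_prolongation linear_germ_in_theta0 by blast
qed

lemma linear_germ_add: "linear_germ (X + Y) = linear_germ X + linear_germ Y"
  unfolding linear_germ_def by transfer (simp add: mv.add_left)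

lemma linear_germ_scaleR: "linear_germ (c *\<^sub>R X) = c *\<^sub>R linear_germ X"
  unfolding linear_germ_def by transfer (simp add: mv.scaleR_left)

text \<open>\<open>k\<close> is linear on \<open>V\<close> only; composition with a projection
  extends it to a linear map of the whole space, where dimensions can be compared.\<close>

lemma injective_endomorphism_surj:
  fixes V :: "'a::euclidean_space set"
  assumes V: "subspace V" and k: "k ` V \<subseteq> V" "inj_on k V"
    "\<And>x y. x \<in> V \<Longrightarrow> y \<in> V \<Longrightarrow> k (x + y) = k x + k y" "\<And>c x. x \<in> V \<Longrightarrow> k (c *\<^sub>R x) = c *\<^sub>R k x"
  shows "k ` V = V"
proof -
  obtain P where P: "bounded_linear P" "\<And>x. P x \<in> V" "\<And>x y. y \<in> V \<Longrightarrow> (x - P x) \<bullet> y = 0"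
    using orthogonal_projection_exists[OF V] by blast
  interpret P: bounded_linear P by fact
  have PV: "P x = x" if "x \<in> V" for x
  proof -
    have "x - P x \<in> V" using that P(2) subspace_diff[OF V] by blast
    from P(3)[OF this, of x] show ?thesis by simp
  qed
  have lin: "linear (\<lambda>x. k (P x))"
    by (rule linearI) (simp_all add: P.add P.scaleR k(3,4) P(2))
  have im: "(\<lambda>x. k (P x)) ` V = k ` V" using PV by (intro image_cong) auto
  have "inj_on (\<lambda>x. k (P x)) (span V)"
    unfolding span_eq_iff[THEN iffD2, OF V] using k(2) PV by (simp add: inj_on_def)
  then have "dim ((\<lambda>x. k (P x)) ` V) = dim V" by (rule dim_image_eq[OF lin])
  then show ?thesis
    using subspace_dim_equal[OF linear_subspace_image[OF lin V] V] k(1) by (simp add: im)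
qed

text \<open>From (a): following the embedding \<open>linear_germ\<close> by the inverse of the
  abstract isomorphism gives an injective endomorphism of the finite-dimensional Lie algebra. It is
  onto, hence so is the embedding.\<close>

lemma condition_a_iff_b: "condition_a G \<longleftrightarrow> condition_b G"
proof
  assume "condition_b G"
  then have "theta0 G = linear_germ ` lie_algebra G" by (simp add: condition_b_iff)
  moreover have "inj_on (linear_germ :: real^'p^'p \<Rightarrow> _) (lie_algebra G)"
    by (auto simp: inj_on_def linear_germ_inject)
  ultimately show "condition_a G"
    unfolding condition_a_def isomorphic_subspaces_def bij_betw_def
    by (intro exI[of _ linear_germ]) (simp add: linear_germ_add linear_germ_scaleR)
next
  assume "condition_a G"
  then obtain h where h: "bij_betw h (lie_algebra G) (theta0 G)"
    "\<And>x y. x \<in> lie_algebra G \<Longrightarrow> y \<in> lie_algebra G \<Longrightarrow> h (x + y) = h x + h y"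
    "\<And>c x. x \<in> lie_algebra G \<Longrightarrow> h (c *\<^sub>R x) = c *\<^sub>R h x"
    unfolding condition_a_def isomorphic_subspaces_def by blast
  define h' where "h' = inv_into (lie_algebra G) h"
  define k where "k X = h' (linear_germ X)" for X
  have h'_h: "h' (h X) = X" if "X \<in> lie_algebra G" for X
    using bij_betw_inv_into_left[OF h(1) that] by (simp add: h'_def)
  have h_h': "h (h' \<theta>) = \<theta>" "h' \<theta> \<in> lie_algebra G" if "\<theta> \<in> theta0 G" for \<theta>
    using bij_betw_inv_into_right[OF h(1) that] inv_into_into[of \<theta> h "lie_algebra G"] h(1) that
    by (auto simp: h'_def bij_betw_def)
  have hk: "h (k X) = linear_germ X" "k X \<in> lie_algebra G" if "X \<in> lie_algebra G" for X
    using h_h'[OF linear_germ_in_theta0[OF that]] by (simp_all add: k_def)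
  note sub = subspace_add[OF subspace_lie_algebra] subspace_scale[OF subspace_lie_algebra]
  have "k ` lie_algebra G = lie_algebra G"
  proof (rule injective_endomorphism_surj[OF subspace_lie_algebra])
    show "inj_on k (lie_algebra G)"
      by (rule inj_onI) (metis hk(1) linear_germ_inject)
    fix X assume X: "X \<in> lie_algebra G"
    show "k (c *\<^sub>R X) = c *\<^sub>R k X" for c
    proof -
      have "h (c *\<^sub>R k X) = linear_germ (c *\<^sub>R X)" using X hk h(3) by (simp add: linear_germ_scaleR)
      then show ?thesis using h'_h[OF sub(2)[OF hk(2)[OF X]]] unfolding k_def by metis
    qed
    fix Y assume Y: "Y \<in> lie_algebra G"
    have "h (k X + k Y) = linear_germ (X + Y)" using X Y hk h(2) by (simp add: linear_germ_add)
    then show "k (X + Y) = k X + k Y" using h'_h[OF sub(1)[OF hk(2)[OF X] hk(2)[OF Y]]] unfolding k_def by metis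
  qed (use hk in auto)
  have "theta0 G \<subseteq> linear_germ ` lie_algebra G"
  proof
    fix \<theta> assume \<theta>: "\<theta> \<in> theta0 G"
    then obtain X where "X \<in> lie_algebra G" "h' \<theta> = k X"
      using h_h'(2) \<open>k ` lie_algebra G = lie_algebra G\<close> by (metis imageE)
    then show "\<theta> \<in> linear_germ ` lie_algebra G" using h_h'(1)[OF \<theta>] hk(1) by auto
  qed
  then show "condition_b G" using condition_b_iff linear_germ_in_theta0 by blast
qed

end

section \<open>Tangent spaces and equivalence of map germs\<close>

text \<open>\<open>omega_image\<close> and \<open>A0_equivalent\<close> range over representatives;
  continuity of \<open>f\<close> and \<open>f 0 = 0\<close> allow a representative to be replaced by
  a linear one.\<close>

lemma germ_compose_cong:
  assumes "map_germ f" "germ_of \<xi> = germ_of \<xi>'" shows "germ_of (\<xi> \<circ> f) = germ_of (\<xi>' \<circ> f)"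
proof -
  have "isCont f 0" "f 0 = 0"
    using assms(1) smooth_near_0_has_derivative has_derivative_continuous unfolding map_germ_def by blast+
  then have "(f \<longlongrightarrow> 0) (nhds 0)" by (simp add: isCont_iff_nhds)
  moreover have "\<forall>\<^sub>F y in nhds 0. \<xi> y = \<xi>' y" using assms(2) by (simp add: germ_of_eq_iff)
  ultimately show ?thesis
    unfolding germ_of_eq_iff o_def by (rule eventually_compose_filterlim[rotated])
qed

lemma TA_eq_TRG:
  assumes "theta0 G = linear_germ ` lie_algebra G" "map_germ f" shows "TA G f = TRG G f"
proof -
  have "omega_image f (theta0 G) = {germ_of (\<lambda>x. X *v f x) | X. X \<in> lie_algebra G}"
  proof (intro equalityI subsetI)
    fix u assume "u \<in> omega_image f (theta0 G)"
    then obtain \<xi> X where "u = germ_of (\<xi> \<circ> f)" "X \<in> lie_algebra G" "germ_of \<xi> = germ_of ((*v) X)"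
      unfolding omega_image_def assms(1) linear_germ_def by auto
    then show "u \<in> {germ_of (\<lambda>x. X *v f x) | X. X \<in> lie_algebra G}"
      using germ_compose_cong[OF assms(2), of \<xi> "(*v) X"] by (auto simp: o_def)
  next
    fix u assume "u \<in> {germ_of (\<lambda>x. X *v f x) | X. X \<in> lie_algebra G}"
    then obtain X where "u = germ_of ((*v) X \<circ> f)" "X \<in> lie_algebra G" by (auto simp: o_def)
    then show "u \<in> omega_image f (theta0 G)"
      unfolding omega_image_def assms(1) linear_germ_def by blast
  qed
  then show ?thesis by (simp add: TA_def TRG_def)
qed

lemma A0_equivalent_iff_G_congruent:
  assumes "condition_c G" "map_germ g" shows "A0_equivalent G f g \<longleftrightarrow> G_congruent G f g"
proof
  assume "A0_equivalent G f g"
  then obtain \<phi> \<psi> A where "diffeo_germ \<phi>" "A \<in> G" "germ_of \<psi> = germ_of ((*v) A)"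
    "germ_of (f \<circ> \<phi>) = germ_of (\<psi> \<circ> g)"
    using assms(1) unfolding A0_equivalent_def condition_c_def linear_germ_def by blast
  then show "G_congruent G f g"
    unfolding G_congruent_def using germ_compose_cong[OF assms(2)] by metis
next
  assume "G_congruent G f g"
  then show "A0_equivalent G f g"
    using assms(1) unfolding A0_equivalent_def G_congruent_def condition_c_def linear_germ_def by blast
qed

theorem corollary7p2:
  fixes G :: "(real^'p^'p) set"
  assumes "linear_lie_group G" and "connected G"
  shows "(condition_a G \<longleftrightarrow> condition_b G) \<and> (condition_b G \<longleftrightarrow> condition_c G) \<and>
    (condition_a G \<or> condition_b G \<or> condition_c G \<longrightarrow>
      (\<forall>f :: real^'n \<Rightarrow> real^'p. map_germ f \<longrightarrow> TA G f = TRG G f) \<and>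
      (\<forall>f g :: real^'n \<Rightarrow> real^'p. map_germ f \<longrightarrow> map_germ g \<longrightarrow>
         (A0_equivalent G f g \<longleftrightarrow> G_congruent G f g)))"
proof -
  interpret lin_group G by (rule lin_group.intro) fact
  note ab = condition_a_iff_b and bc = condition_b_iff_c[OF assms(2)]
  have "TA G f = TRG G f" if "condition_b G" "map_germ f" for f :: "real^'n \<Rightarrow> real^'p"
    using TA_eq_TRG that condition_b_iff by blast
  moreover have "A0_equivalent G f g \<longleftrightarrow> G_congruent G f g" if "condition_b G" "map_germ g"
    for f g :: "real^'n \<Rightarrow> real^'p"
    using A0_equivalent_iff_G_congruent that bc by blast
  ultimately show ?thesis using ab bc by blast
qed

end
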